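(* Let $(p_{ij} \colon X_j \to X_i)_{i \sqsubseteq j \in I}$ be a projective system of topological spaces, with canonical projective limit $X, (p_i)_{i \in I}$. Let $\bullet$ be nothing, "$\leq 1$" or "$1$". If every $X_i$ is $\odot$-consonant and locally strongly sober (and compact, namely strongly sober, if $\bullet$ is "$1$") and if every $p_{ij}$ is a proper map, then $(\mathcal{P}\ell_{\mathcal V}^{cvx} \mathbf V p_{ij} \colon \mathcal{P}\ell_{\mathcal V}^{cvx} \mathbf V_\bullet X_j \to \mathcal{P}\ell_{\mathcal V}^{cvx} \mathbf V_\bullet X_i)_{i \sqsubseteq j \in I}$ is a projective system of topological spaces, and $\mathcal{P}\ell_{\mathcal V}^{cvx} \mathbf V_\bullet X, (\mathcal{P}\ell_{\mathcal V}^{cvx} \mathbf V p_i)_{i \in I}$ is its projective limit, up to homeomorphism.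
   Context: **Topology.** $\mathcal O X$ is the lattice of open subsets of $X$. The specialization preordering is: $x \leq y$ iff every open neighborhood of $x$ contains $y$; $\uparrow A$, $\downarrow A$ denote upward and downward closure, $cl(A)$ topological closure, $f[A]$ direct image. A subset is saturated iff it is upwards-closed. Compactness is the open cover property, with no separation axiom. A space is sober iff it is $T_0$ and every irreducible closed subset is the closure of a point. A space is consonant iff for every Scott-open subset $\mathcal U$ of $\mathcal O X$ and every $U \in \mathcal U$, there is a compact saturated $Q \subseteq U$ all of whose open neighborhoods belong to $\mathcal U$; $\odot$-consonant iff for every $n \in \mathbb N$ the topological sum of $n$ copies of $X$ is consonant. A space is locally strongly sober iff the set of limits of every convergent ultrafilter is the closure of a unique point; equivalently, iff it is sober, coherent (the intersection of any two compact saturated subsets is compact) and weakly Hausdorff (for all points $x,y$, every open neighborhood of $\uparrow x \cap \uparrow y$ contains $U \cap V$ for some open neighborhoods $U$ of $x$ and $V$ of $y$). A strongly sober space is a compact locally strongly sober space. A continuous map $f \colon X \to Y$ is proper iff $\downarrow f[F]$ is closed for every closed $F \subseteq X$ and $f^{-1}(Q)$ is compact saturated for every compact saturated $Q \subseteq Y$. **Projective systems.** A projective system $(p_{ij} \colon X_j \to X_i)_{i \sqsubseteq j \in I}$ consists of a directed preordered set $(I,\sqsubseteq)$, spaces $X_i$, and continuous maps $p_{ij}$ ($i \sqsubseteq j$) with $p_{ii} = \mathrm{id}$ and $p_{ij} \circ p_{jk} = p_{ik}$ for $i \sqsubseteq j \sqsubseteq k$. Its canonical projective limit is $X = \{\vec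 x \in \prod_{i} X_i \mid p_{ij}(x_j) = x_i \text{ for all } i \sqsubseteq j\}$ with the subspace topology of the product, $p_i$ being projection onto coordinate $i$. Saying that $Y, (q_i)_{i\in I}$ is the projective limit up to homeomorphism of a projective system with canonical limit $Z$ means that $y \mapsto (q_i(y))_{i \in I}$ is a (well-defined) homeomorphism from $Y$ onto $Z$. **Valuations and convex lenses.** A continuous valuation on $X$ is a Scott-continuous map $\nu \colon \mathcal O X \to \overline{\mathbb R}_+ = \mathbb R_+ \cup \{\infty\}$ with $\nu(\emptyset)=0$ and $\nu(U)+\nu(V)=\nu(U\cup V)+\nu(U\cap V)$. $\mathbf V X$ is the space of continuous valuations with the topology generated by $\{\nu \mid \nu(U)>r\}$, $U \in \mathcal O X$, $r \in \mathbb R_+$; $\mathbf V_{\leq 1} X$ and $\mathbf V_1 X$ are the subspaces where $\nu(X)\leq 1$, resp. $\nu(X)=1$; $\mathbf V_\bullet$ is $\mathbf V$, $\mathbf V_{\leq 1}$ or $\mathbf V_1$ according to $\bullet$. A continuous map $f$ acts by $\mathbf V f(\nu) = (V \mapsto \nu(f^{-1}(V)))$. A lens of a space $Y$ is a non-empty set of the form $Q \cap C$ with $Q$ compact saturated and $C$ closed in $Y$. $\mathcal{P}\ell_{\mathcal V}^{cvx} \mathbf V_\bullet X$ is the set of convex lenses $L$ of $\mathbf V_\bullet X$ (convex: closed under $r\nu_1+(1-r)\nu_2$, $r \in [0,1]$), with the Vietoris topology generated by $\{L \mid L \subseteq \mathcal U\}$ and $\{L \mid L \cap \mathcal U \neq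 \emptyset\}$, $\mathcal U$ open in $\mathbf V_\bullet X$. A continuous map $f \colon X \to Y$ acts by $L \mapsto \uparrow \mathbf V f[L] \cap cl(\mathbf V f[L])$ (upward closure and topological closure in $\mathbf V_\bullet Y$). *)

theory Defs
  imports "HOL-Analysis.Analysis"
begin

section \<open>Specialization preordering, saturated sets\<close>

definition spec_le :: "'a topology \<Rightarrow> 'a \<Rightarrow> 'a \<Rightarrow> bool" where
  "spec_le X x y \<longleftrightarrow> x \<in> topspace X \<and> y \<in> topspace X \<and> (\<forall>U. openin X U \<and> x \<in> U \<longrightarrow> y \<in> U)"

definition up_closure :: "'a topology \<Rightarrow> 'a set \<Rightarrow> 'a set" where
  "up_closure X A = {y. \<exists>x\<in>A. spec_le X x y}"

definition down_closure :: "'a topology \<Rightarrow> 'a set \<Rightarrow> 'a set" where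
  "down_closure X A = {x. \<exists>y\<in>A. spec_le X x y}"

definition saturatedin :: "'a topology \<Rightarrow> 'a set \<Rightarrow> bool" where
  "saturatedin X A \<longleftrightarrow> A \<subseteq> topspace X \<and> (\<forall>x\<in>A. \<forall>y. spec_le X x y \<longrightarrow> y \<in> A)"

section \<open>Scott topology on the lattice of open sets, consonance\<close>

definition directed_opens :: "'a topology \<Rightarrow> 'a set set \<Rightarrow> bool" where
  "directed_opens X \<D> \<longleftrightarrow>
     \<D> \<noteq> {} \<and> (\<forall>U\<in>\<D>. openin X U) \<and> (\<forall>U\<in>\<D>. \<forall>V\<in>\<D>. \<exists>W\<in>\<D>. U \<subseteq> W \<and> V \<subseteq> W)"

definition scott_open :: "'a topology \<Rightarrow> 'a set set \<Rightarrow> bool" where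
  "scott_open X \<U> \<longleftrightarrow>
     (\<forall>U\<in>\<U>. openin X U) \<and>
     (\<forall>U\<in>\<U>. \<forall>V. openin X V \<and> U \<subseteq> V \<longrightarrow> V \<in> \<U>) \<and>
     (\<forall>\<D>. directed_opens X \<D> \<and> \<Union>\<D> \<in> \<U> \<longrightarrow> (\<exists>U\<in>\<D>. U \<in> \<U>))"

definition consonant :: "'a topology \<Rightarrow> bool" where
  "consonant X \<longleftrightarrow>
     (\<forall>\<U> U. scott_open X \<U> \<and> U \<in> \<U> \<longrightarrow>
        (\<exists>Q. compactin X Q \<and> saturatedin X Q \<and> Q \<subseteq> U \<and>
             (\<forall>V. openin X V \<and> Q \<subseteq> V \<longrightarrow> V \<in> \<U>)))"

definition odot_consonant :: "'a topology \<Rightarrow> bool" where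
  "odot_consonant X \<longleftrightarrow> (\<forall>n::nat. consonant (sum_topology (\<lambda>_. X) {..<n}))"

section \<open>(Locally) strongly sober spaces\<close>

definition ultrafilter_on :: "'a set \<Rightarrow> 'a filter \<Rightarrow> bool" where
  "ultrafilter_on S F \<longleftrightarrow>
     F \<noteq> bot \<and> eventually (\<lambda>x. x \<in> S) F \<and>
     (\<forall>P. eventually P F \<or> eventually (\<lambda>x. \<not> P x) F)"

definition limits_of :: "'a topology \<Rightarrow> 'a filter \<Rightarrow> 'a set" where
  "limits_of X F = {l. limitin X (\<lambda>x. x) l F}"

definition locally_strongly_sober :: "'a topology \<Rightarrow> bool" where
  "locally_strongly_sober X \<longleftrightarrow>
     (\<forall>F. ultrafilter_on (topspace X) F \<and> limits_of X F \<noteq> {} \<longrightarrow>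
        (\<exists>!x. x \<in> topspace X \<and> limits_of X F = X closure_of {x}))"

definition strongly_sober :: "'a topology \<Rightarrow> bool" where
  "strongly_sober X \<longleftrightarrow> compact_space X \<and> locally_strongly_sober X"

section \<open>Proper maps\<close>

text \<open>This is the notion of properness for general, non-Hausdorff, spaces. It differs from
  \<^const>\<open>proper_map\<close>, which requires images of closed sets themselves to be closed.\<close>

definition sat_proper_map :: "'a topology \<Rightarrow> 'b topology \<Rightarrow> ('a \<Rightarrow> 'b) \<Rightarrow> bool" where
  "sat_proper_map X Y f \<longleftrightarrow>
     continuous_map X Y f \<and>
     (\<forall>F. closedin X F \<longrightarrow> closedin Y (down_closure Y (f ` F))) \<and>
     (\<forall>Q. compactin Y Q \<and> saturatedin Y Q \<longrightarrow>
        compactin X {x \<in> topspace X. f x \<in> Q} \<and> saturatedin X {x \<in> topspace X. f x \<in> Q})"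

section \<open>Projective systems and their limits\<close>

text \<open>The indexing preordering is \<open>r\<close>, with \<open>(i, j) \<in> r\<close> meaning that \<open>i\<close> is below \<open>j\<close>,
  and then \<open>p i j\<close> maps \<open>X j\<close> to \<open>X i\<close>.\<close>

definition projective_system ::
  "'i set \<Rightarrow> ('i \<times> 'i) set \<Rightarrow> ('i \<Rightarrow> 'a topology) \<Rightarrow> ('i \<Rightarrow> 'i \<Rightarrow> 'a \<Rightarrow> 'a) \<Rightarrow> bool" where
  "projective_system I r X p \<longleftrightarrow>
     preorder_on I r \<and> I \<noteq> {} \<and> (\<forall>i\<in>I. \<forall>j\<in>I. \<exists>k\<in>I. (i, k) \<in> r \<and> (j, k) \<in> r) \<and>
     (\<forall>i j. (i, j) \<in> r \<longrightarrow> continuous_map (X j) (X i) (p i j)) \<and>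
     (\<forall>i\<in>I. \<forall>x\<in>topspace (X i). p i i x = x) \<and>
     (\<forall>i j k. (i, j) \<in> r \<and> (j, k) \<in> r \<longrightarrow>
        (\<forall>x\<in>topspace (X k). p i j (p j k x) = p i k x))"

definition projective_limit ::
  "'i set \<Rightarrow> ('i \<times> 'i) set \<Rightarrow> ('i \<Rightarrow> 'a topology) \<Rightarrow> ('i \<Rightarrow> 'i \<Rightarrow> 'a \<Rightarrow> 'a) \<Rightarrow> ('i \<Rightarrow> 'a) topology"
  where
  "projective_limit I r X p =
     subtopology (product_topology X I) {x. \<forall>i j. (i, j) \<in> r \<longrightarrow> p i j (x j) = x i}"

definition is_projective_limit_of ::
  "'b topology \<Rightarrow> ('i \<Rightarrow> 'b \<Rightarrow> 'a) \<Rightarrow>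
   'i set \<Rightarrow> ('i \<times> 'i) set \<Rightarrow> ('i \<Rightarrow> 'a topology) \<Rightarrow> ('i \<Rightarrow> 'i \<Rightarrow> 'a \<Rightarrow> 'a) \<Rightarrow> bool" where
  "is_projective_limit_of Y q I r X p \<longleftrightarrow>
     homeomorphic_map Y (projective_limit I r X p) (\<lambda>y. \<lambda>i\<in>I. q i y)"

section \<open>Continuous valuations\<close>

text \<open>A valuation is a function on all sets, of which only the values on open sets matter; as for
  products of topologies, it is normalized by being \<^const>\<open>extensional\<close>, so that two valuations
  are equal as soon as they agree on open sets.\<close>

type_synonym 'a valuation = "'a set \<Rightarrow> ennreal"

definition scott_continuous :: "'a topology \<Rightarrow> 'a valuation \<Rightarrow> bool" where
  "scott_continuous X \<nu> \<longleftrightarrow>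
     (\<forall>U V. openin X U \<and> openin X V \<and> U \<subseteq> V \<longrightarrow> \<nu> U \<le> \<nu> V) \<and>
     (\<forall>\<D>. directed_opens X \<D> \<longrightarrow> \<nu> (\<Union>\<D>) = (SUP U\<in>\<D>. \<nu> U))"

definition continuous_valuation :: "'a topology \<Rightarrow> 'a valuation \<Rightarrow> bool" where
  "continuous_valuation X \<nu> \<longleftrightarrow>
     \<nu> \<in> extensional {U. openin X U} \<and>
     scott_continuous X \<nu> \<and>
     \<nu> {} = 0 \<and>
     (\<forall>U V. openin X U \<and> openin X V \<longrightarrow> \<nu> U + \<nu> V = \<nu> (U \<union> V) + \<nu> (U \<inter> V))"

text \<open>The whole space has to be added to the subbasis explicitly, since the zero valuation is in
  no subbasic open set, and \<^const>\<open>topology_generated_by\<close> makes the union of the subbasis the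
  whole space.\<close>

definition valuation_space :: "'a topology \<Rightarrow> 'a valuation topology" where
  "valuation_space X =
     topology_generated_by
       (insert {\<nu>. continuous_valuation X \<nu>}
          {{\<nu>. continuous_valuation X \<nu> \<and> \<nu> U > ennreal r} |U r. openin X U \<and> (0::real) \<le> r})"

datatype bullet = Unrestricted | Subprobability | Probability

fun mass_condition :: "bullet \<Rightarrow> ennreal \<Rightarrow> bool" where
  "mass_condition Unrestricted m \<longleftrightarrow> True"
| "mass_condition Subprobability m \<longleftrightarrow> m \<le> 1"
| "mass_condition Probability m \<longleftrightarrow> m = 1"

definition V_space :: "bullet \<Rightarrow> 'a topology \<Rightarrow> 'a valuation topology" where
  "V_space b X = subtopology (valuation_space X) {\<nu>. mass_condition b (\<nu> (topspace X))}"

definition V_map :: "'a topology \<Rightarrow> 'b topology \<Rightarrow> ('a \<Rightarrow> 'b) \<Rightarrow> 'a valuation \<Rightarrow> 'b valuation" where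
  "V_map X Y f \<nu> = (\<lambda>V\<in>{V. openin Y V}. \<nu> {x \<in> topspace X. f x \<in> V})"

section \<open>Convex lenses\<close>

definition lens :: "'a topology \<Rightarrow> 'a set \<Rightarrow> bool" where
  "lens Y L \<longleftrightarrow>
     L \<noteq> {} \<and> (\<exists>Q C. compactin Y Q \<and> saturatedin Y Q \<and> closedin Y C \<and> L = Q \<inter> C)"

definition convex_valuations :: "'a topology \<Rightarrow> 'a valuation set \<Rightarrow> bool" where
  "convex_valuations X L \<longleftrightarrow>
     (\<forall>\<nu>\<^sub>1\<in>L. \<forall>\<nu>\<^sub>2\<in>L. \<forall>r\<in>{0..1::real}.
        (\<lambda>U\<in>{U. openin X U}. ennreal r * \<nu>\<^sub>1 U + ennreal (1 - r) * \<nu>\<^sub>2 U) \<in> L)"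

definition convex_lenses :: "bullet \<Rightarrow> 'a topology \<Rightarrow> 'a valuation set set" where
  "convex_lenses b X = {L. lens (V_space b X) L \<and> convex_valuations X L}"

definition convex_lens_space :: "bullet \<Rightarrow> 'a topology \<Rightarrow> 'a valuation set topology" where
  "convex_lens_space b X =
     topology_generated_by
       ({{L \<in> convex_lenses b X. L \<subseteq> \<U>} |\<U>. openin (V_space b X) \<U>} \<union>
        {{L \<in> convex_lenses b X. L \<inter> \<U> \<noteq> {}} |\<U>. openin (V_space b X) \<U>})"

definition convex_lens_map ::
  "bullet \<Rightarrow> 'a topology \<Rightarrow> 'b topology \<Rightarrow> ('a \<Rightarrow> 'b) \<Rightarrow> 'a valuation set \<Rightarrow> 'b valuation set" where
  "convex_lens_map b X Y f L =
     up_closure (V_space b Y) (V_map X Y f ` L) \<inter> (V_space b Y) closure_of (V_map X Y f ` L)"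

lemma topspace_valuation_space: "topspace (valuation_space X) = {\<nu>. continuous_valuation X \<nu>}"
  unfolding valuation_space_def by auto

lemma topspace_V_space:
  "topspace (V_space b X) = {\<nu>. continuous_valuation X \<nu> \<and> mass_condition b (\<nu> (topspace X))}"
  unfolding V_space_def by (auto simp: topspace_valuation_space)

lemma topspace_convex_lens_space: "topspace (convex_lens_space b X) = convex_lenses b X"
proof
  show "topspace (convex_lens_space b X) \<subseteq> convex_lenses b X"
    unfolding convex_lens_space_def by auto
  have "L \<subseteq> topspace (V_space b X)" if "L \<in> convex_lenses b X" for L
    using that by (auto simp: convex_lenses_def lens_def dest: compactin_subset_topspace)
  then show "convex_lenses b X \<subseteq> topspace (convex_lens_space b X)"
    unfolding convex_lens_space_def by auto
qed

end

theory Submission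
  imports Defs
begin

text \<open>
  A projective limit of lenses can be computed with ultrafilters, once one knows that every ultrafilter
  of valuations has a greatest limit, given by a formula that commutes with proper maps.

  \<^bold>\<open>One space.\<close> A pointwise limit \<open>\<xi>\<close> of continuous valuations along an ultrafilter is monotone and modular,
  but need not be Scott-continuous. Put \<open>\<xi> K = (INF U \<supseteq> K. \<xi> U)\<close> for \<open>K\<close> compact saturated, and let \<open>\<nu> U\<close> be the
  supremum of \<open>\<xi> K\<close> over all \<open>K \<subseteq> U\<close>. Then \<open>\<nu>\<close> is Scott-continuous by compactness. It satisfies
  \<open>\<nu> U + \<nu> V \<le> \<nu> (U \<union> V) + \<nu> (U \<inter> V)\<close> because a locally strongly sober space is coherent and weakly Hausdorff. The
  converse inequality holds because every compact saturated \<open>K \<subseteq> U \<union> V\<close> is covered by a compact saturated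
  subset of \<open>U\<close> and one of \<open>V\<close>: this is consonance of the sum of two copies of the space, applied to the
  Scott-open set of pairs \<open>(U, V)\<close> with \<open>K \<subseteq> U \<union> V\<close>. So \<open>\<nu>\<close> is a continuous valuation below \<open>\<xi>\<close>. Consonance
  also makes every continuous valuation tight, that is, determined from the inside by compact saturated
  sets; therefore \<open>\<nu>\<close> is the largest one below \<open>\<xi>\<close>, which says that it is the greatest limit of the
  ultrafilter. For probability valuations, compactness of the space keeps the total mass of \<open>\<nu>\<close> equal to 1
  (\<open>regularization_continuous_valuation\<close>, \<open>valuation_greatest_limit\<close>).

  \<^bold>\<open>The limit.\<close> Greatest limits of points commute with proper maps, because limits lift along them. Hence
  compatible nets of points, one coordinate of which stays in a compact set, converge in the projective
  limit, and coverings of compact sets in the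
  limit already happen at some stage (\<open>point_ultralimit\<close>, \<open>compact_cover\<close>). With tightness, this shows that
  compatible valuations come from a valuation on the limit (\<open>valuation_limit_exists\<close>). Regularization commutes
  with proper maps as well, so that compatible nets of valuations have limits in the space of valuations on
  the limit (\<open>valuation_ultralimit\<close>).

  \<^bold>\<open>Lenses.\<close> Given compatible convex lenses \<open>L k\<close>, the candidate is the set \<open>L\<close> of all valuations on the limit
  whose image at each stage \<open>k\<close> is in \<open>L k\<close>. It is a convex lens, where compactness of the saturated part is again
  shown with ultrafilters. What has to be proved is that the image of \<open>L\<close> at stage \<open>i\<close> has the same upward
  closure and the same topological closure as \<open>L i\<close>. For \<open>x\<close> in \<open>L i\<close>, compatibility yields at each later stage
  elements of the lens whose images in stage \<open>i\<close> are below \<open>x\<close>, and others whose images are arbitrarily close to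
  \<open>x\<close>. Greatest limits of these nets give a valuation in \<open>L\<close> whose image is below \<open>x\<close>, and one whose image is
  above \<open>x\<close> (\<open>lens_limit_point\<close>). Finally, every open set of valuations on the limit is a directed union
  of open sets coming from the stages, and lenses are compact. So the Vietoris topology on lenses is the
  initial one for the maps to the stages, and a lens is determined by its images
  (\<open>lens_subset_open_iff\<close>, \<open>lens_meets_open_iff\<close>, \<open>ql_injective\<close>).
\<close>

section \<open>Ultrafilters and compactness\<close>

lemma ultrafilter_extends:
  assumes "F \<noteq> bot"
  shows "\<exists>G. ultrafilter_on UNIV G \<and> G \<le> F"
proof -
  define A where "A = {G. G \<noteq> bot \<and> G \<le> F}"
  define R where "R = {(G, H). G \<in> A \<and> H \<in> A \<and> H \<le> G}"
  have FR: "Field R = A"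
    unfolding R_def Field_def by auto
  have po: "Partial_order R"
    unfolding FR partial_order_on_def preorder_on_def
    by (auto simp: FR refl_on_def R_def trans_def antisym_def intro: antisym)
  have "\<exists>u\<in>Field R. \<forall>a\<in>C. (a, u) \<in> R" if C: "C \<in> Chains R" for C
  proof (cases "C = {}")
    case True
    then show ?thesis using assms by (auto simp: FR A_def)
  next
    case False
    have CA: "C \<subseteq> A" using C by (auto simp: Chains_def R_def)
    have base: "\<exists>x\<in>C. x \<le> inf G H" if "G \<in> C" "H \<in> C" for G H
      using C that by (fastforce simp: Chains_def R_def)
    have "Inf C \<noteq> bot"
    proof
      assume "Inf C = bot"
      then have "\<exists>G\<in>C. eventually (\<lambda>x. False) G"
        using eventually_Inf_base[OF False base, of "\<lambda>x. False"] by auto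
      then show False using CA by (auto simp: A_def trivial_limit_def)
    qed
    moreover have "Inf C \<le> F"
      using False CA by (auto simp: A_def intro: Inf_lower2)
    ultimately have "Inf C \<in> A" by (simp add: A_def)
    then show ?thesis
      using CA unfolding FR by (auto simp: R_def intro!: bexI[of _ "Inf C"] Inf_lower)
  qed
  from Zorns_po_lemma[OF po this] obtain G where G: "G \<in> A"
    and min: "\<And>H. (G, H) \<in> R \<Longrightarrow> H = G"
    unfolding FR by (auto simp: R_def)
  have "eventually P G \<or> eventually (\<lambda>x. \<not> P x) G" for P
  proof (rule ccontr)
    assume n: "\<not> ?thesis"
    let ?H = "inf G (principal {x. P x})"
    have "?H \<noteq> bot"
      using n by (auto simp: trivial_limit_def eventually_inf_principal)
    then have "(G, ?H) \<in> R"
      using G by (auto simp: R_def A_def intro: order_trans[OF inf_le1])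
    from min[OF this] have H: "?H = G" .
    have "eventually P ?H" by (simp add: eventually_inf_principal)
    with H have "eventually P G" by simp
    with n show False by simp
  qed
  with G show ?thesis
    by (auto simp: A_def ultrafilter_on_def)
qed

lemma ultrafilter_nontrivial: "ultrafilter_on S G \<Longrightarrow> G \<noteq> bot"
  by (simp add: ultrafilter_on_def)

lemma ultrafilter_cases:
  assumes "ultrafilter_on S G"
  shows "eventually P G \<or> eventually (\<lambda>x. \<not> P x) G"
  using assms by (simp add: ultrafilter_on_def)

lemma ultrafilter_not_eventually:
  assumes "ultrafilter_on S G" "\<not> eventually P G"
  shows "eventually (\<lambda>x. \<not> P x) G"
  using assms ultrafilter_cases by blast

lemma ultrafilter_filtermap:
  assumes "ultrafilter_on UNIV G" "\<forall>\<^sub>F g in G. f g \<in> S"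
  shows "ultrafilter_on S (filtermap f G)"
  using assms by (auto simp: ultrafilter_on_def filtermap_bot_iff eventually_filtermap)

text \<open>Nets are encoded as functions on an index type that carries an ultrafilter. This is the tool that
  turns a directed index set, given as a filter base, into such an ultrafilter.\<close>

lemma ultrafilter_of_base:
  assumes "A \<noteq> {}" "\<And>a. a \<in> A \<Longrightarrow> S a \<noteq> {}"
    and "\<And>a b. a \<in> A \<Longrightarrow> b \<in> A \<Longrightarrow> \<exists>c\<in>A. S c \<subseteq> S a \<inter> S b"
  obtains G where "ultrafilter_on UNIV G" "\<And>a. a \<in> A \<Longrightarrow> \<forall>\<^sub>F g in G. g \<in> S a"
proof -
  have *: "\<exists>c\<in>A. principal (S c) \<le> inf (principal (S a)) (principal (S b))" if "a \<in> A" "b \<in> A" for a b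
    using assms(3)[OF that] by auto
  have "(INF a\<in>A. principal (S a)) \<noteq> bot"
  proof
    assume "(INF a\<in>A. principal (S a)) = bot"
    then have "\<exists>a\<in>A. eventually (\<lambda>x. False) (principal (S a))"
      using eventually_INF_base[OF assms(1) *, of "\<lambda>x. False"] by auto
    then show False using assms(2) by (auto simp: eventually_principal)
  qed
  from ultrafilter_extends[OF this] obtain G where G: "ultrafilter_on UNIV G"
    and le: "G \<le> (INF a\<in>A. principal (S a))" by auto
  have "\<forall>\<^sub>F g in G. g \<in> S a" if "a \<in> A" for a
  proof -
    have "G \<le> principal (S a)" using le that by (meson INF_lower order_trans)
    then show ?thesis by (simp add: le_principal)
  qed
  with G show ?thesis by (rule that)
qed

text \<open>Otherwise every point of \<open>K\<close> would have an open neighborhood that \<open>f\<close> eventually avoids, and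
  finitely many of them cover \<open>K\<close>. It is essential that \<open>f\<close> itself may stay outside \<open>K\<close>: this is how limits
  are lifted along proper maps.\<close>

lemma limit_near_compact:
  assumes G: "ultrafilter_on UNIV G" and K: "compactin X K"
    and near: "\<And>V. openin X V \<Longrightarrow> K \<subseteq> V \<Longrightarrow> \<forall>\<^sub>F g in G. f g \<in> V"
  shows "\<exists>y\<in>K. limitin X f y G"
proof (rule ccontr)
  assume n: "\<not> ?thesis"
  have "\<exists>U. openin X U \<and> y \<in> U \<and> (\<forall>\<^sub>F g in G. f g \<notin> U)" if "y \<in> K" for y
    using n that compactin_subset_topspace[OF K] ultrafilter_not_eventually[OF G]
    by (fastforce simp: limitin_def)
  then obtain U where U: "\<And>y. y \<in> K \<Longrightarrow> openin X (U y)" "\<And>y. y \<in> K \<Longrightarrow> y \<in> U y"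
    "\<And>y. y \<in> K \<Longrightarrow> \<forall>\<^sub>F g in G. f g \<notin> U y"
    by metis
  have "\<exists>\<F>. finite \<F> \<and> \<F> \<subseteq> U ` K \<and> K \<subseteq> \<Union>\<F>"
  proof -
    have "Ball (U ` K) (openin X)" "K \<subseteq> \<Union>(U ` K)" using U by auto
    then show ?thesis using K by (simp add: compactin_def)
  qed
  then obtain T where T: "finite T" "T \<subseteq> K" "K \<subseteq> \<Union>(U ` T)"
    by (metis finite_subset_image)
  have 1: "\<forall>\<^sub>F g in G. f g \<in> \<Union>(U ` T)"
    using T U by (intro near) auto
  have 2: "\<forall>\<^sub>F g in G. \<forall>y\<in>T. f g \<notin> U y"
    using T U by (intro eventually_ball_finite) auto
  have "\<forall>\<^sub>F g in G. False"
    using 1 2 by eventually_elim auto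
  then show False using G by (simp add: ultrafilter_on_def)
qed

lemma limit_in_compact:
  assumes "ultrafilter_on UNIV G" "compactin X K" "\<forall>\<^sub>F g in G. f g \<in> K"
  shows "\<exists>y\<in>K. limitin X f y G"
  by (rule limit_near_compact[OF assms(1,2)], rule eventually_mono[OF assms(3)]) blast

text \<open>For an open cover without finite subcover, the sets \<open>K - \<Union>\<F>\<close>, with \<open>\<F>\<close> a finite part of the cover,
  form a filter base, and an ultrafilter that contains it cannot converge in \<open>K\<close>.\<close>

lemma compactin_by_ultrafilters:
  assumes K: "K \<subseteq> topspace X"
    and lim: "\<And>G. ultrafilter_on UNIV G \<Longrightarrow> \<forall>\<^sub>F g in G. g \<in> K \<Longrightarrow> \<exists>y\<in>K. limitin X (\<lambda>x. x) y G"
  shows "compactin X K"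
  unfolding compactin_def
proof (intro conjI allI impI K)
  fix \<U> assume \<U>: "Ball \<U> (openin X) \<and> K \<subseteq> \<Union>\<U>"
  show "\<exists>\<F>. finite \<F> \<and> \<F> \<subseteq> \<U> \<and> K \<subseteq> \<Union>\<F>"
  proof (rule ccontr)
    assume n: "\<not> ?thesis"
    let ?A = "{\<F>. finite \<F> \<and> \<F> \<subseteq> \<U>}"
    have dir: "\<exists>c\<in>?A. K - \<Union>c \<subseteq> (K - \<Union>a) \<inter> (K - \<Union>b)" if "a \<in> ?A" "b \<in> ?A" for a b
      using that by (intro bexI[of _ "a \<union> b"]) auto
    have A: "?A \<noteq> {}" by auto
    have ne: "K - \<Union>a \<noteq> {}" if "a \<in> ?A" for a using n that by auto
    obtain G where G: "ultrafilter_on UNIV G"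
      "\<And>a. a \<in> ?A \<Longrightarrow> \<forall>\<^sub>F g in G. g \<in> K - \<Union>a"
      by (rule ultrafilter_of_base[of ?A "\<lambda>a. K - \<Union>a", OF A ne dir]) blast+
    have "\<forall>\<^sub>F g in G. g \<in> K" using G(2)[of "{}"] by simp
    from lim[OF G(1) this] obtain y where y: "y \<in> K" "limitin X (\<lambda>x. x) y G" by auto
    obtain U where U: "U \<in> \<U>" "y \<in> U" using y \<U> by auto
    have "\<forall>\<^sub>F g in G. g \<in> U" using y U \<U> by (auto simp: limitin_def)
    moreover have "\<forall>\<^sub>F g in G. g \<in> K - \<Union>{U}" using G(2)[of "{U}"] U by simp
    ultimately have "\<forall>\<^sub>F g in G. False" by eventually_elim auto
    then show False using G by (simp add: ultrafilter_on_def)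
  qed
qed

section \<open>Specialization, saturation, properness\<close>

lemma spec_le_trans: "spec_le X x y \<Longrightarrow> spec_le X y z \<Longrightarrow> spec_le X x z"
  by (auto simp: spec_le_def)

lemma spec_le_refl: "x \<in> topspace X \<Longrightarrow> spec_le X x x"
  by (auto simp: spec_le_def)

lemma spec_le_iff_closure: "spec_le X x y \<longleftrightarrow> y \<in> topspace X \<and> x \<in> X closure_of {y}"
  by (auto simp: spec_le_def in_closure_of)

lemma spec_le_open: "spec_le X x y \<Longrightarrow> openin X U \<Longrightarrow> x \<in> U \<Longrightarrow> y \<in> U"
  by (auto simp: spec_le_def)

lemma closedin_lower_cone: "y \<in> topspace X \<Longrightarrow> closedin X {x. spec_le X x y}"
  by (simp add: spec_le_iff_closure)

lemma spec_le_continuous: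
  "continuous_map X Y f \<Longrightarrow> spec_le X x y \<Longrightarrow> spec_le Y (f x) (f y)"
  unfolding spec_le_def continuous_map_def by (auto simp: Pi_iff)

lemma saturatedin_up_closure: "saturatedin X (up_closure X A)"
  by (auto simp: saturatedin_def up_closure_def spec_le_def)

lemma subset_up_closure: "A \<subseteq> topspace X \<Longrightarrow> A \<subseteq> up_closure X A"
  by (auto simp: up_closure_def spec_le_def)

lemma up_closure_subset_open:
  assumes "openin X U" "A \<subseteq> U"
  shows "up_closure X A \<subseteq> U"
  using assms by (auto simp: up_closure_def spec_le_def)

lemma up_closure_least: "saturatedin X Q \<Longrightarrow> A \<subseteq> Q \<Longrightarrow> up_closure X A \<subseteq> Q"
  by (auto simp: up_closure_def saturatedin_def)

lemma compactin_up_closure: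
  assumes "compactin X A"
  shows "compactin X (up_closure X A)"
proof -
  have "\<exists>\<F>. finite \<F> \<and> \<F> \<subseteq> \<U> \<and> up_closure X A \<subseteq> \<Union>\<F>"
    if \<U>: "Ball \<U> (openin X)" "up_closure X A \<subseteq> \<Union>\<U>" for \<U>
  proof -
    have "A \<subseteq> \<Union>\<U>"
      using subset_up_closure[OF compactin_subset_topspace[OF assms]] \<U> by auto
    then obtain \<F> where "finite \<F>" "\<F> \<subseteq> \<U>" "A \<subseteq> \<Union>\<F>"
      using assms \<U>(1) unfolding compactin_def by metis
    moreover have "openin X (\<Union>\<F>)" using \<U>(1) \<open>\<F> \<subseteq> \<U>\<close> by auto
    ultimately show ?thesis using up_closure_subset_open by metis
  qed
  then show ?thesis
    by (auto simp: compactin_def up_closure_def spec_le_def)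
qed

lemma saturatedin_Un: "saturatedin X A \<Longrightarrow> saturatedin X B \<Longrightarrow> saturatedin X (A \<union> B)"
  and saturatedin_Int: "saturatedin X A \<Longrightarrow> saturatedin X B \<Longrightarrow> saturatedin X (A \<inter> B)"
  by (auto simp: saturatedin_def)

text \<open>The largest open set whose preimage lies in \<open>O'\<close> is the complement of the downward closure of
  the image of the complement of \<open>O'\<close>, and it contains \<open>Q\<close> because \<open>Q\<close> is upwards closed.\<close>

lemma proper_open_nbhd:
  assumes f: "sat_proper_map X Y f" and Q: "saturatedin Y Q" and O': "openin X O'"
    and sub: "{x \<in> topspace X. f x \<in> Q} \<subseteq> O'"
  obtains V where "openin Y V" "Q \<subseteq> V" "{x \<in> topspace X. f x \<in> V} \<subseteq> O'"
proof
  let ?D = "down_closure Y (f ` (topspace X - O'))"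
  show "openin Y (topspace Y - ?D)"
    using f O' closedin_diff[OF closedin_topspace O'] by (simp add: sat_proper_map_def openin_diff)
  show "Q \<subseteq> topspace Y - ?D"
  proof
    fix y assume y: "y \<in> Q"
    have False if "y \<in> ?D"
    proof -
      from that obtain x where x: "x \<in> topspace X" "x \<notin> O'" "spec_le Y y (f x)"
        by (auto simp: down_closure_def)
      then have "f x \<in> Q" using Q y by (auto simp: saturatedin_def)
      with x sub show False by auto
    qed
    then show "y \<in> topspace Y - ?D" using Q y by (auto simp: saturatedin_def)
  qed
  show "{x \<in> topspace X. f x \<in> topspace Y - ?D} \<subseteq> O'"
    by (auto simp: down_closure_def intro: spec_le_refl)
qed

text \<open>Limits lift along proper maps: the preimage of the upper set of \<open>y\<close> is compact, and the net
  eventually enters all its open neighborhoods.\<close>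

lemma proper_lift_limit:
  assumes f: "sat_proper_map X Y f" and G: "ultrafilter_on UNIV G"
    and h: "\<forall>\<^sub>F g in G. h g \<in> topspace X" and lim: "limitin Y (\<lambda>g. f (h g)) y G"
  shows "\<exists>x. limitin X h x G \<and> spec_le Y y (f x)"
proof -
  let ?Q = "up_closure Y {y}"
  let ?P = "{x \<in> topspace X. f x \<in> ?Q}"
  have y: "y \<in> topspace Y" using lim by (simp add: limitin_def)
  have c: "compactin X ?P"
    using f y by (auto simp: sat_proper_map_def compactin_up_closure saturatedin_up_closure)
  have near: "\<forall>\<^sub>F g in G. h g \<in> V" if V: "openin X V" "?P \<subseteq> V" for V
  proof -
    obtain W where W: "openin Y W" "?Q \<subseteq> W" "{x \<in> topspace X. f x \<in> W} \<subseteq> V"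
      using proper_open_nbhd[OF f saturatedin_up_closure V] by metis
    have "y \<in> W" using W y subset_up_closure[of "{y}" Y] by auto
    then have "\<forall>\<^sub>F g in G. f (h g) \<in> W" using lim W by (simp add: limitin_def)
    with h show ?thesis by eventually_elim (use W in auto)
  qed
  from limit_near_compact[OF G c near] show ?thesis
    by (auto simp: up_closure_def)
qed

section \<open>Locally strongly sober spaces\<close>

text \<open>Limits are closed downwards for the specialization preordering. A greatest limit plays the role that
  the unique limit plays in Hausdorff spaces.\<close>

definition greatest_limit :: "'a topology \<Rightarrow> ('g \<Rightarrow> 'a) \<Rightarrow> 'a \<Rightarrow> 'g filter \<Rightarrow> bool" where
  "greatest_limit X f x G \<longleftrightarrow> limitin X f x G \<and> (\<forall>y. limitin X f y G \<longrightarrow> spec_le X y x)"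

lemma greatest_limit_exists:
  assumes X: "locally_strongly_sober X" and G: "ultrafilter_on UNIV G"
    and f: "\<forall>\<^sub>F g in G. f g \<in> topspace X" and lim: "limitin X f y G"
  shows "\<exists>x. greatest_limit X f x G"
proof -
  let ?F = "filtermap f G"
  have eq: "limitin X (\<lambda>x. x) l ?F \<longleftrightarrow> limitin X f l G" for l
    by (simp add: limitin_def eventually_filtermap)
  have "ultrafilter_on (topspace X) ?F" using ultrafilter_filtermap[OF G f] .
  moreover have "limits_of X ?F \<noteq> {}" using lim by (auto simp: limits_of_def eq)
  ultimately obtain x where x: "x \<in> topspace X" "limits_of X ?F = X closure_of {x}"
    using X unfolding locally_strongly_sober_def by blast
  have "limitin X f l G \<longleftrightarrow> spec_le X l x" for l
    using x(2) eq[of l] by (auto simp: limits_of_def spec_le_iff_closure x(1))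
  then show ?thesis
    using spec_le_refl[OF x(1)] by (auto simp: greatest_limit_def)
qed

text \<open>The principal ultrafilter at \<open>x\<close> has the closure of \<open>x\<close> as its set of limits.\<close>

lemma locally_strongly_sober_T0:
  assumes X: "locally_strongly_sober X" and xy: "spec_le X x y" "spec_le X y x"
  shows "x = y"
proof -
  let ?F = "principal {x}"
  have x: "x \<in> topspace X" and y: "y \<in> topspace X" using xy by (auto simp: spec_le_def)
  have u: "ultrafilter_on (topspace X) ?F"
    using x by (auto simp: ultrafilter_on_def eventually_principal trivial_limit_def)
  have l: "limits_of X ?F = X closure_of {x}"
    using x by (auto simp: limits_of_def limitin_def eventually_principal in_closure_of)
  have "x \<in> X closure_of {x}" using x by (auto simp: in_closure_of)
  with l u obtain z where z: "\<And>w. w \<in> topspace X \<Longrightarrow> limits_of X ?F = X closure_of {w} \<Longrightarrow> w = z"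
    using X unfolding locally_strongly_sober_def by (metis empty_iff)
  have "X closure_of {x} = X closure_of {y}"
    using xy by (auto simp: in_closure_of spec_le_def)
  with z[OF x l] z[OF y] l show ?thesis by simp
qed

lemma compact_limit_mem:
  assumes G: "ultrafilter_on UNIV G" and Q: "compactin X Q" "saturatedin X Q"
    and f: "\<forall>\<^sub>F g in G. f g \<in> Q" and x: "greatest_limit X f x G"
  shows "x \<in> Q"
  using limit_in_compact[OF G Q(1) f] x Q(2)
  by (auto simp: greatest_limit_def saturatedin_def)

text \<open>This is coherence. Together with weak Hausdorffness, in the form for compact saturated sets given by
  the next lemma, it follows from one fact: an ultrafilter that converges to a point of \<open>Q\<^sub>1\<close> and to a point
  of \<open>Q\<^sub>2\<close> has a limit above both, hence in \<open>Q\<^sub>1 \<inter> Q\<^sub>2\<close>.\<close>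

lemma locally_strongly_sober_coherent:
  assumes X: "locally_strongly_sober X"
    and Q: "compactin X Q\<^sub>1" "saturatedin X Q\<^sub>1" "compactin X Q\<^sub>2" "saturatedin X Q\<^sub>2"
  shows "compactin X (Q\<^sub>1 \<inter> Q\<^sub>2)"
proof (rule compactin_by_ultrafilters)
  show T: "Q\<^sub>1 \<inter> Q\<^sub>2 \<subseteq> topspace X" using Q by (auto simp: saturatedin_def)
  fix G assume G: "ultrafilter_on UNIV G" and e: "\<forall>\<^sub>F g in G. g \<in> Q\<^sub>1 \<inter> Q\<^sub>2"
  have e1: "\<forall>\<^sub>F g in G. g \<in> Q\<^sub>1" and e2: "\<forall>\<^sub>F g in G. g \<in> Q\<^sub>2" and eT: "\<forall>\<^sub>F g in G. g \<in> topspace X"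
    using T by (auto intro: eventually_mono[OF e])
  obtain y where "limitin X (\<lambda>x. x) y G" using limit_in_compact[OF G Q(1) e1] by auto
  then obtain x where x: "greatest_limit X (\<lambda>x. x) x G"
    using greatest_limit_exists[OF X G eT] by blast
  show "\<exists>y\<in>Q\<^sub>1 \<inter> Q\<^sub>2. limitin X (\<lambda>x. x) y G"
    using compact_limit_mem[OF G Q(1,2) e1 x] compact_limit_mem[OF G Q(3,4) e2 x] x
    by (auto simp: greatest_limit_def)
qed

text \<open>If no pair of open neighborhoods worked, the sets \<open>U\<^sub>1 \<inter> U\<^sub>2 - W\<close> would form a filter base. An
  ultrafilter that contains it converges to points of \<open>Q\<^sub>1\<close> and of \<open>Q\<^sub>2\<close>, hence to a point of \<open>W\<close>.\<close>

lemma locally_strongly_sober_separation: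
  assumes X: "locally_strongly_sober X"
    and Q: "compactin X Q\<^sub>1" "saturatedin X Q\<^sub>1" "compactin X Q\<^sub>2" "saturatedin X Q\<^sub>2"
    and W: "openin X W" "Q\<^sub>1 \<inter> Q\<^sub>2 \<subseteq> W"
  obtains U\<^sub>1 U\<^sub>2 where "openin X U\<^sub>1" "openin X U\<^sub>2" "Q\<^sub>1 \<subseteq> U\<^sub>1" "Q\<^sub>2 \<subseteq> U\<^sub>2" "U\<^sub>1 \<inter> U\<^sub>2 \<subseteq> W"
proof (rule ccontr)
  assume n: "\<not> thesis"
  note sep = that
  let ?A = "{(U\<^sub>1, U\<^sub>2). openin X U\<^sub>1 \<and> openin X U\<^sub>2 \<and> Q\<^sub>1 \<subseteq> U\<^sub>1 \<and> Q\<^sub>2 \<subseteq> U\<^sub>2}"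
  let ?S = "\<lambda>(U\<^sub>1, U\<^sub>2). U\<^sub>1 \<inter> U\<^sub>2 - W"
  have top: "(topspace X, topspace X) \<in> ?A" using Q by (auto simp: saturatedin_def)
  have ne: "?S a \<noteq> {}" if a: "a \<in> ?A" for a
  proof
    assume e: "?S a = {}"
    obtain U\<^sub>1 U\<^sub>2 where "a = (U\<^sub>1, U\<^sub>2)" by (cases a)
    with a e show False using sep[of U\<^sub>1 U\<^sub>2] n by simp
  qed
  have dir: "\<exists>c\<in>?A. ?S c \<subseteq> ?S a \<inter> ?S b" if "a \<in> ?A" "b \<in> ?A" for a b
  proof -
    obtain a1 a2 b1 b2 where "a = (a1, a2)" "b = (b1, b2)" by (cases a, cases b)
    with that show ?thesis by (intro bexI[of _ "(a1 \<inter> b1, a2 \<inter> b2)"]) auto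
  qed
  obtain G where G: "ultrafilter_on UNIV G" "\<And>a. a \<in> ?A \<Longrightarrow> \<forall>\<^sub>F g in G. g \<in> ?S a"
    by (rule ultrafilter_of_base[of ?A ?S, OF _ ne dir]) (use top in \<open>blast+\<close>)
  have eT: "\<forall>\<^sub>F g in G. g \<in> topspace X" and eW: "\<forall>\<^sub>F g in G. g \<notin> W"
    by (auto intro: eventually_mono[OF G(2)[OF top]] dest: openin_subset)
  have "\<exists>y\<in>Q\<^sub>1. limitin X (\<lambda>x. x) y G"
  proof (rule limit_near_compact[OF G(1) Q(1)])
    fix V assume "openin X V" "Q\<^sub>1 \<subseteq> V"
    then have "(V, topspace X) \<in> ?A" using top by simp
    from G(2)[OF this] show "\<forall>\<^sub>F g in G. g \<in> V" by eventually_elim simp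
  qed
  then obtain y1 where y1: "y1 \<in> Q\<^sub>1" "limitin X (\<lambda>x. x) y1 G" by auto
  have "\<exists>y\<in>Q\<^sub>2. limitin X (\<lambda>x. x) y G"
  proof (rule limit_near_compact[OF G(1) Q(3)])
    fix V assume "openin X V" "Q\<^sub>2 \<subseteq> V"
    then have "(topspace X, V) \<in> ?A" using top by simp
    from G(2)[OF this] show "\<forall>\<^sub>F g in G. g \<in> V" by eventually_elim simp
  qed
  then obtain y2 where y2: "y2 \<in> Q\<^sub>2" "limitin X (\<lambda>x. x) y2 G" by auto
  obtain x where x: "greatest_limit X (\<lambda>x. x) x G"
    using greatest_limit_exists[OF X G(1) eT y1(2)] by blast
  have "x \<in> Q\<^sub>1 \<inter> Q\<^sub>2"
    using x y1 y2 Q by (auto simp: greatest_limit_def saturatedin_def)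
  then have "\<forall>\<^sub>F g in G. g \<in> W" using x W by (auto simp: greatest_limit_def limitin_def)
  with eW have "\<forall>\<^sub>F g in G. False" by eventually_elim auto
  then show False using G by (simp add: ultrafilter_on_def)
qed

section \<open>Consonance of binary sums\<close>

text \<open>Open subsets of the sum of two copies of \<open>X\<close> are pairs of open subsets of \<open>X\<close>, and its compact
  saturated subsets are pairs as well. Consonance of the sum is used twice: with a property of the first
  component, to show that continuous valuations are tight, and with \<open>K \<subseteq> U \<union> V\<close>, to split compact
  saturated sets.\<close>

lemma odot_consonant_pairs:
  assumes X: "odot_consonant X"
    and opn: "\<And>U V. P U V \<Longrightarrow> openin X U \<and> openin X V"
    and up: "\<And>U V U' V'. P U V \<Longrightarrow> openin X U' \<Longrightarrow> openin X V' \<Longrightarrow> U \<subseteq> U' \<Longrightarrow> V \<subseteq> V' \<Longrightarrow> P U' V'"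
    and scott: "\<And>\<D>. \<D> \<noteq> {} \<Longrightarrow> (\<And>U V. (U, V) \<in> \<D> \<Longrightarrow> openin X U \<and> openin X V) \<Longrightarrow>
      (\<And>a b. a \<in> \<D> \<Longrightarrow> b \<in> \<D> \<Longrightarrow> \<exists>c\<in>\<D>. fst a \<subseteq> fst c \<and> fst b \<subseteq> fst c \<and> snd a \<subseteq> snd c \<and> snd b \<subseteq> snd c) \<Longrightarrow>
      P (\<Union>(fst ` \<D>)) (\<Union>(snd ` \<D>)) \<Longrightarrow> \<exists>(U, V)\<in>\<D>. P U V"
    and P: "P U V"
  obtains K L where "compactin X K" "saturatedin X K" "K \<subseteq> U"
    "compactin X L" "saturatedin X L" "L \<subseteq> V"
    "\<And>U' V'. openin X U' \<Longrightarrow> openin X V' \<Longrightarrow> K \<subseteq> U' \<Longrightarrow> L \<subseteq> V' \<Longrightarrow> P U' V'"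
proof -
  let ?S = "sum_topology (\<lambda>_. X) {..<2::nat}"
  define sl where "sl i W = {x::'a. (i, x) \<in> W}" for i :: nat and W
  define mk where "mk U V = {0::nat} \<times> U \<union> {1} \<times> V" for U V :: "'a set"
  have opS: "openin ?S W \<longleftrightarrow> W \<subseteq> {..<2} \<times> topspace X \<and> openin X (sl 0 W) \<and> openin X (sl 1 W)" for W
    unfolding openin_sum_topology sl_def
    by (auto simp: less_2_cases_iff numeral_2_eq_2 less_Suc_eq)
  have sl_mk: "sl 0 (mk A B) = A" "sl 1 (mk A B) = B" for A B by (auto simp: sl_def mk_def)
  have op_mk: "openin ?S (mk A B)" if "openin X A" "openin X B" for A B
    unfolding opS sl_mk using that by (auto simp: mk_def dest: openin_subset)
  let ?U = "{W. openin ?S W \<and> P (sl 0 W) (sl 1 W)}"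
  have "scott_open ?S ?U"
    unfolding scott_open_def
  proof (intro conjI allI impI ballI)
    fix W assume "W \<in> ?U" then show "openin ?S W" by simp
  next
    fix W W' assume W: "W \<in> ?U" "openin ?S W' \<and> W \<subseteq> W'"
    have "P (sl 0 W') (sl 1 W')"
    proof (rule up[of "sl 0 W" "sl 1 W"])
      show "P (sl 0 W) (sl 1 W)" using W by simp
      show "openin X (sl 0 W')" "openin X (sl 1 W')" using W by (simp_all add: opS)
      show "sl 0 W \<subseteq> sl 0 W'" "sl 1 W \<subseteq> sl 1 W'" using W by (auto simp: sl_def)
    qed
    with W show "W' \<in> ?U" by simp
  next
    fix D assume D': "directed_opens ?S D \<and> \<Union>D \<in> ?U"
    then have D: "directed_opens ?S D" "\<Union>D \<in> ?U" by auto
    let ?D = "(\<lambda>W. (sl 0 W, sl 1 W)) ` D"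
    have un: "\<Union>(fst ` ?D) = sl 0 (\<Union>D)" "\<Union>(snd ` ?D) = sl 1 (\<Union>D)"
      by (auto simp: sl_def)
    have "\<exists>(U, V)\<in>?D. P U V"
    proof (rule scott)
      show "?D \<noteq> {}" using D by (auto simp: directed_opens_def)
      show "openin X U \<and> openin X V" if "(U, V) \<in> ?D" for U V
        using that D by (auto simp: directed_opens_def opS)
      show "\<exists>c\<in>?D. fst a \<subseteq> fst c \<and> fst b \<subseteq> fst c \<and> snd a \<subseteq> snd c \<and> snd b \<subseteq> snd c"
        if ab: "a \<in> ?D" "b \<in> ?D" for a b
      proof -
        obtain A B where AB: "A \<in> D" "B \<in> D" "a = (sl 0 A, sl 1 A)" "b = (sl 0 B, sl 1 B)"
          using ab by auto
        then obtain C where "C \<in> D" "A \<subseteq> C" "B \<subseteq> C"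
          using D(1) unfolding directed_opens_def by meson
        with AB show ?thesis by (intro bexI[of _ "(sl 0 C, sl 1 C)"]) (auto simp: sl_def)
      qed
      show "P (\<Union>(fst ` ?D)) (\<Union>(snd ` ?D))" unfolding un using D by simp
    qed
    then show "\<exists>W\<in>D. W \<in> ?U" using D(1) by (auto simp: directed_opens_def)
  qed
  moreover have "mk U V \<in> ?U" using P opn[OF P] by (simp add: sl_mk op_mk del: One_nat_def)
  moreover have "consonant ?S" using X by (simp add: odot_consonant_def)
  ultimately obtain Q where Q: "compactin ?S Q" "saturatedin ?S Q" "Q \<subseteq> mk U V"
    and QV: "\<And>W. openin ?S W \<Longrightarrow> Q \<subseteq> W \<Longrightarrow> W \<in> ?U"
    unfolding consonant_def by meson
  have QT: "Q \<subseteq> {..<2} \<times> topspace X" using compactin_subset_topspace[OF Q(1)] by auto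
  have snd_cont: "continuous_map ?S X snd"
    unfolding continuous_map_def
  proof (intro conjI allI impI)
    show "snd \<in> topspace ?S \<rightarrow> topspace X" by auto
    fix U assume U: "openin X U"
    then have "{x \<in> topspace ?S. snd x \<in> U} = Sigma {..<2} (\<lambda>_. U)" by (auto dest: openin_subset)
    then show "openin ?S {x \<in> topspace ?S. snd x \<in> U}" using U by (simp add: openin_disjoint_union)
  qed
  have slice: "compactin X (sl i Q) \<and> saturatedin X (sl i Q)" if i: "i < 2" for i
  proof
    have "closedin ?S ({i} \<times> topspace X)"
      unfolding closedin_sum_topology
    proof (intro conjI ballI)
      fix j show "closedin X {x. (j, x) \<in> {i} \<times> topspace X}" by (cases "j = i") auto
    qed (use i in auto)
    then have "compactin ?S (({i} \<times> topspace X) \<inter> Q)"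
      using Q(1) closed_Int_compactin by blast
    then have "compactin X (snd ` (({i} \<times> topspace X) \<inter> Q))"
      using image_compactin snd_cont by blast
    moreover have "snd ` (({i} \<times> topspace X) \<inter> Q) = sl i Q" using QT by (force simp: sl_def)
    ultimately show "compactin X (sl i Q)" by simp
    show "saturatedin X (sl i Q)"
      unfolding saturatedin_def
    proof (intro conjI ballI allI impI)
      show "sl i Q \<subseteq> topspace X" using QT by (auto simp: sl_def)
      fix x y assume x: "x \<in> sl i Q" and le: "spec_le X x y"
      have "spec_le ?S (i, x) (i, y)"
        using le i by (auto simp: spec_le_def openin_sum_topology)
      then show "y \<in> sl i Q" using x Q(2) by (auto simp: saturatedin_def sl_def)
    qed
  qed
  show thesis
  proof (rule that[of "sl 0 Q" "sl 1 Q"])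
    show "sl 0 Q \<subseteq> U" "sl 1 Q \<subseteq> V" using Q(3) by (auto simp: sl_def mk_def)
    show "P U' V'" if "openin X U'" "openin X V'" "sl 0 Q \<subseteq> U'" "sl 1 Q \<subseteq> V'" for U' V'
    proof -
      have "Q \<subseteq> mk U' V'" using QT that by (fastforce simp: sl_def mk_def less_2_cases_iff)
      from QV[OF op_mk this] that show ?thesis by (simp add: sl_mk del: One_nat_def)
    qed
  qed (use slice in auto)
qed

text \<open>The pairs \<open>(U, V)\<close> with \<open>K \<subseteq> U \<union> V\<close> form a Scott-open set because \<open>K\<close> is compact. Consonance yields
  \<open>K\<^sub>1\<close> and \<open>K\<^sub>2\<close> all of whose open neighborhoods cover \<open>K\<close> together, and a point outside the saturated set
  \<open>K\<^sub>1 \<union> K\<^sub>2\<close> is avoided by the complement of its closure.\<close>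

lemma compact_split:
  assumes X: "odot_consonant X" and K: "compactin X K" "saturatedin X K"
    and UV: "openin X U" "openin X V" "K \<subseteq> U \<union> V"
  obtains K\<^sub>1 K\<^sub>2 where "compactin X K\<^sub>1" "saturatedin X K\<^sub>1" "K\<^sub>1 \<subseteq> U"
    "compactin X K\<^sub>2" "saturatedin X K\<^sub>2" "K\<^sub>2 \<subseteq> V" "K \<subseteq> K\<^sub>1 \<union> K\<^sub>2"
proof -
  let ?P = "\<lambda>U V. openin X U \<and> openin X V \<and> K \<subseteq> U \<union> V"
  obtain K\<^sub>1 K\<^sub>2 where K12: "compactin X K\<^sub>1" "saturatedin X K\<^sub>1" "K\<^sub>1 \<subseteq> U"
    "compactin X K\<^sub>2" "saturatedin X K\<^sub>2" "K\<^sub>2 \<subseteq> V"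
    and P: "\<And>U' V'. openin X U' \<Longrightarrow> openin X V' \<Longrightarrow> K\<^sub>1 \<subseteq> U' \<Longrightarrow> K\<^sub>2 \<subseteq> V' \<Longrightarrow> ?P U' V'"
  proof (rule odot_consonant_pairs[OF X, of ?P U V])
    fix \<D> :: "('a set \<times> 'a set) set"
    assume ne: "\<D> \<noteq> {}" and op: "\<And>U V. (U, V) \<in> \<D> \<Longrightarrow> openin X U \<and> openin X V"
      and dir: "\<And>a b. a \<in> \<D> \<Longrightarrow> b \<in> \<D> \<Longrightarrow>
        \<exists>c\<in>\<D>. fst a \<subseteq> fst c \<and> fst b \<subseteq> fst c \<and> snd a \<subseteq> snd c \<and> snd b \<subseteq> snd c"
      and P: "?P (\<Union>(fst ` \<D>)) (\<Union>(snd ` \<D>))"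
    let ?\<U> = "(\<lambda>a. fst a \<union> snd a) ` \<D>"
    have "Ball ?\<U> (openin X)" using op by force
    moreover have "K \<subseteq> \<Union>?\<U>" using P by auto
    ultimately obtain \<F> where F: "finite \<F>" "\<F> \<subseteq> ?\<U>" "K \<subseteq> \<Union>\<F>"
      using K(1) unfolding compactin_def by meson
    have "\<exists>c\<in>\<D>. \<Union>\<F> \<subseteq> fst c \<union> snd c"
      using F(1,2)
    proof induction
      case empty then show ?case using ne by auto
    next
      case (insert A \<F>)
      then obtain a c where ac: "a \<in> \<D>" "A = fst a \<union> snd a" "c \<in> \<D>" "\<Union>\<F> \<subseteq> fst c \<union> snd c" by auto
      from dir[OF ac(1,3)] obtain d where "d \<in> \<D>" "fst a \<subseteq> fst d" "fst c \<subseteq> fst d"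
        "snd a \<subseteq> snd d" "snd c \<subseteq> snd d" by auto
      with ac show ?case by (intro bexI[of _ d]) auto
    qed
    then obtain c where c: "c \<in> \<D>" "K \<subseteq> fst c \<union> snd c" using F by auto
    then show "\<exists>(U, V)\<in>\<D>. ?P U V" using op[of "fst c" "snd c"] by (intro bexI[of _ c]) auto
  qed (use UV in auto)
  have "K \<subseteq> K\<^sub>1 \<union> K\<^sub>2"
  proof (rule ccontr)
    assume "\<not> ?thesis"
    then obtain x where x: "x \<in> K" "x \<notin> K\<^sub>1" "x \<notin> K\<^sub>2" by auto
    have xT: "x \<in> topspace X" using x K by (auto simp: saturatedin_def)
    let ?W = "topspace X - {y. spec_le X y x}"
    have "openin X ?W" using closedin_lower_cone[OF xT] by blast
    moreover have "K\<^sub>1 \<subseteq> ?W" "K\<^sub>2 \<subseteq> ?W" using x K12 by (auto simp: saturatedin_def)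
    ultimately have "K \<subseteq> ?W \<union> ?W" using P by blast
    then show False using x spec_le_refl[OF xT] by auto
  qed
  with K12 show thesis by (rule that)
qed

section \<open>Continuous valuations\<close>

lemma SUP_add_SUP_le:
  fixes f :: "'b \<Rightarrow> ennreal"
  assumes "A \<noteq> {}" "B \<noteq> {}" "\<And>a b. a \<in> A \<Longrightarrow> b \<in> B \<Longrightarrow> f a + g b \<le> c"
  shows "(SUP a\<in>A. f a) + (SUP b\<in>B. g b) \<le> c"
proof -
  have "f a + (SUP b\<in>B. g b) \<le> c" if "a \<in> A" for a
    unfolding ennreal_SUP_add_right[OF assms(2)] by (rule SUP_least) (rule assms(3)[OF that])
  then have "(SUP a\<in>A. f a + (SUP b\<in>B. g b)) \<le> c" by (rule SUP_least)
  then show ?thesis by (simp only: ennreal_SUP_add_left[OF assms(1)])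
qed

lemma INF_add_INF_ge:
  fixes f :: "'b \<Rightarrow> ennreal"
  assumes "\<And>a b. a \<in> A \<Longrightarrow> b \<in> B \<Longrightarrow> c \<le> f a + g b"
  shows "c \<le> (INF a\<in>A. f a) + (INF b\<in>B. g b)"
proof (cases "(INF a\<in>A. f a) = top \<or> (INF b\<in>B. g b) = top")
  case True
  then show ?thesis by auto
next
  case False
  show ?thesis
  proof (rule ennreal_le_epsilon)
    fix e :: real assume e: "0 < e"
    have pos: "0 < ennreal (e / 2)" using e by simp
    have "(INF a\<in>A. f a) < (INF a\<in>A. f a) + ennreal (e / 2)"
      using False e by (simp add: top.not_eq_extremum)
    then obtain a where a: "a \<in> A" "f a < (INF a\<in>A. f a) + ennreal (e / 2)"
      unfolding INF_less_iff by auto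
    have "(INF b\<in>B. g b) < (INF b\<in>B. g b) + ennreal (e / 2)"
      using False e by (simp add: top.not_eq_extremum)
    then obtain b where b: "b \<in> B" "g b < (INF b\<in>B. g b) + ennreal (e / 2)"
      unfolding INF_less_iff by auto
    have "c \<le> f a + g b" using assms a b by blast
    also have "\<dots> \<le> ((INF a\<in>A. f a) + ennreal (e / 2)) + ((INF b\<in>B. g b) + ennreal (e / 2))"
      using a b by (intro add_mono) auto
    also have "\<dots> = (INF a\<in>A. f a) + (INF b\<in>B. g b) + (ennreal (e / 2) + ennreal (e / 2))"
      by (simp add: ac_simps)
    also have "ennreal (e / 2) + ennreal (e / 2) = ennreal e"
      using e by (simp flip: ennreal_plus)
    finally show "c \<le> (INF a\<in>A. f a) + (INF b\<in>B. g b) + ennreal e" .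
  qed
qed

lemma continuous_valuation_mono:
  "continuous_valuation X \<nu> \<Longrightarrow> openin X U \<Longrightarrow> openin X V \<Longrightarrow> U \<subseteq> V \<Longrightarrow> \<nu> U \<le> \<nu> V"
  by (simp add: continuous_valuation_def scott_continuous_def)

lemma continuous_valuation_modular:
  "continuous_valuation X \<nu> \<Longrightarrow> openin X U \<Longrightarrow> openin X V \<Longrightarrow>
    \<nu> U + \<nu> V = \<nu> (U \<union> V) + \<nu> (U \<inter> V)"
  by (simp add: continuous_valuation_def)

lemma continuous_valuation_Union:
  "continuous_valuation X \<nu> \<Longrightarrow> directed_opens X \<D> \<Longrightarrow> \<nu> (\<Union>\<D>) = (SUP U\<in>\<D>. \<nu> U)"
  by (simp add: continuous_valuation_def scott_continuous_def)

lemma continuous_valuation_empty: "continuous_valuation X \<nu> \<Longrightarrow> \<nu> {} = 0"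
  by (simp add: continuous_valuation_def)

text \<open>The sets \<open>U\<close> with \<open>\<nu> U > a\<close> form a Scott-open family, to which consonance applies.\<close>

lemma continuous_valuation_tight:
  assumes X: "odot_consonant X" and \<nu>: "continuous_valuation X \<nu>" and U: "openin X U" "a < \<nu> U"
  obtains K where "compactin X K" "saturatedin X K" "K \<subseteq> U"
    "\<And>V. openin X V \<Longrightarrow> K \<subseteq> V \<Longrightarrow> a < \<nu> V"
proof -
  let ?P = "\<lambda>U V. openin X U \<and> openin X V \<and> a < \<nu> U"
  obtain K L where KL: "compactin X K" "saturatedin X K" "K \<subseteq> U"
    "compactin X L" "saturatedin X L" "L \<subseteq> U"
    and P: "\<And>U' V'. openin X U' \<Longrightarrow> openin X V' \<Longrightarrow> K \<subseteq> U' \<Longrightarrow> L \<subseteq> V' \<Longrightarrow> ?P U' V'"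
  proof (rule odot_consonant_pairs[OF X, of ?P U U])
    fix A B A' B' assume "?P A B" "openin X A'" "openin X B'" "A \<subseteq> A'" "B \<subseteq> B'"
    then show "?P A' B'" using continuous_valuation_mono[OF \<nu>, of A A'] by auto
  next
    fix \<D> :: "('a set \<times> 'a set) set"
    assume ne: "\<D> \<noteq> {}" and op: "\<And>U V. (U, V) \<in> \<D> \<Longrightarrow> openin X U \<and> openin X V"
      and dir: "\<And>a b. a \<in> \<D> \<Longrightarrow> b \<in> \<D> \<Longrightarrow>
        \<exists>c\<in>\<D>. fst a \<subseteq> fst c \<and> fst b \<subseteq> fst c \<and> snd a \<subseteq> snd c \<and> snd b \<subseteq> snd c"
      and P: "?P (\<Union>(fst ` \<D>)) (\<Union>(snd ` \<D>))"
    have "directed_opens X (fst ` \<D>)"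
      unfolding directed_opens_def
    proof (intro conjI ballI)
      fix A B assume "A \<in> fst ` \<D>" "B \<in> fst ` \<D>"
      then obtain a b where "a \<in> \<D>" "b \<in> \<D>" "A = fst a" "B = fst b" by blast
      then show "\<exists>W\<in>fst ` \<D>. A \<subseteq> W \<and> B \<subseteq> W" using dir[of a b] by auto
    qed (use ne op in force)+
    with P have "a < (SUP U\<in>fst ` \<D>. \<nu> U)" using continuous_valuation_Union[OF \<nu>] by simp
    then obtain c where c: "c \<in> \<D>" "a < \<nu> (fst c)" unfolding less_SUP_iff by auto
    then show "\<exists>(U, V)\<in>\<D>. ?P U V" using op[of "fst c" "snd c"] by (intro bexI[of _ c]) auto
  qed (use U in auto)
  show thesis
  proof (rule that[of K])
    fix V assume V: "openin X V" "K \<subseteq> V"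
    show "a < \<nu> V" using P[of V "topspace X"] V KL by (auto simp: saturatedin_def)
  qed (use KL in auto)
qed

section \<open>Inner regularization\<close>

text \<open>Pointwise limits of continuous valuations may fail to be Scott-continuous. They are repaired from
  the inside: \<open>\<xi>\<close> is extended to compact saturated sets by an infimum over open neighborhoods, and then the
  value at an open set is recomputed as a supremum over compact saturated subsets. On the spaces of
  interest here, the result is the largest continuous valuation below \<open>\<xi>\<close>.\<close>

definition outer_value :: "'a topology \<Rightarrow> 'a valuation \<Rightarrow> 'a valuation" where
  "outer_value X \<xi> K = (INF U\<in>{U. openin X U \<and> K \<subseteq> U}. \<xi> U)"

definition regularization :: "'a topology \<Rightarrow> 'a valuation \<Rightarrow> 'a valuation" where
  "regularization X \<xi> =
     (\<lambda>U\<in>{U. openin X U}. SUP K\<in>{K. compactin X K \<and> saturatedin X K \<and> K \<subseteq> U}. outer_value X \<xi> K)"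

text \<open>A continuous valuation up to Scott-continuity, which is what survives pointwise limits.\<close>

definition modular_content :: "'a topology \<Rightarrow> 'a valuation \<Rightarrow> bool" where
  "modular_content X \<xi> \<longleftrightarrow>
     (\<forall>U V. openin X U \<and> openin X V \<and> U \<subseteq> V \<longrightarrow> \<xi> U \<le> \<xi> V) \<and> \<xi> {} = 0 \<and>
     (\<forall>U V. openin X U \<and> openin X V \<longrightarrow> \<xi> U + \<xi> V = \<xi> (U \<union> V) + \<xi> (U \<inter> V))"

lemma outer_value_mono: "K \<subseteq> L \<Longrightarrow> outer_value X \<xi> K \<le> outer_value X \<xi> L"
  unfolding outer_value_def by (intro INF_superset_mono) auto

lemma outer_value_le: "openin X U \<Longrightarrow> K \<subseteq> U \<Longrightarrow> outer_value X \<xi> K \<le> \<xi> U"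
  unfolding outer_value_def by (intro INF_lower) auto

lemma outer_value_greatest:
  "(\<And>U. openin X U \<Longrightarrow> K \<subseteq> U \<Longrightarrow> a \<le> \<xi> U) \<Longrightarrow> a \<le> outer_value X \<xi> K"
  unfolding outer_value_def by (intro INF_greatest) auto

lemma le_regularization:
  "openin X U \<Longrightarrow> compactin X K \<Longrightarrow> saturatedin X K \<Longrightarrow> K \<subseteq> U \<Longrightarrow>
    outer_value X \<xi> K \<le> regularization X \<xi> U"
  unfolding regularization_def by (auto intro!: SUP_upper)

lemma regularization_least:
  assumes "openin X U"
    and "\<And>K. compactin X K \<Longrightarrow> saturatedin X K \<Longrightarrow> K \<subseteq> U \<Longrightarrow> outer_value X \<xi> K \<le> a"
  shows "regularization X \<xi> U \<le> a"
  unfolding regularization_def using assms by (auto intro!: SUP_least)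

lemma regularization_le: "openin X U \<Longrightarrow> regularization X \<xi> U \<le> \<xi> U"
  by (intro regularization_least outer_value_le)

text \<open>This is where weak Hausdorffness enters: given open neighborhoods \<open>W\<close> of \<open>K \<union> L\<close> and \<open>Z\<close> of
  \<open>K \<inter> L\<close>, there are open neighborhoods of \<open>K\<close> and \<open>L\<close> with union inside \<open>W\<close> and intersection inside \<open>Z\<close>.\<close>

lemma outer_value_supermodular:
  assumes X: "locally_strongly_sober X" and \<xi>: "modular_content X \<xi>"
    and K: "compactin X K" "saturatedin X K" and L: "compactin X L" "saturatedin X L"
  shows "outer_value X \<xi> K + outer_value X \<xi> L \<le> outer_value X \<xi> (K \<union> L) + outer_value X \<xi> (K \<inter> L)"
  unfolding outer_value_def[of X \<xi> "K \<union> L"] outer_value_def[of X \<xi> "K \<inter> L"]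
proof (rule INF_add_INF_ge)
  fix W Z assume W: "W \<in> {U. openin X U \<and> K \<union> L \<subseteq> U}" and Z: "Z \<in> {U. openin X U \<and> K \<inter> L \<subseteq> U}"
  obtain U V where UV: "openin X U" "openin X V" "K \<subseteq> U" "L \<subseteq> V" "U \<inter> V \<subseteq> Z"
    using locally_strongly_sober_separation[OF X K L, of Z] Z by blast
  let ?U = "U \<inter> W" and ?V = "V \<inter> W"
  have o: "openin X ?U" "openin X ?V" using UV W by auto
  have "outer_value X \<xi> K + outer_value X \<xi> L \<le> \<xi> ?U + \<xi> ?V"
    using UV W o by (intro add_mono outer_value_le) auto
  also have "\<dots> = \<xi> (?U \<union> ?V) + \<xi> (?U \<inter> ?V)" using \<xi> o unfolding modular_content_def by blast
  also have "\<dots> \<le> \<xi> W + \<xi> Z"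
  proof (intro add_mono)
    show "\<xi> (?U \<union> ?V) \<le> \<xi> W" using \<xi> o W unfolding modular_content_def by auto
    have "?U \<inter> ?V \<subseteq> Z" using UV by auto
    then show "\<xi> (?U \<inter> ?V) \<le> \<xi> Z" using \<xi> o Z unfolding modular_content_def by blast
  qed
  finally show "outer_value X \<xi> K + outer_value X \<xi> L \<le> \<xi> W + \<xi> Z" .
qed

lemma outer_value_submodular:
  assumes \<xi>: "modular_content X \<xi>"
  shows "outer_value X \<xi> (K \<union> L) + outer_value X \<xi> (K \<inter> L) \<le> outer_value X \<xi> K + outer_value X \<xi> L"
  unfolding outer_value_def[of X \<xi> K] outer_value_def[of X \<xi> L]
proof (rule INF_add_INF_ge)
  fix U V assume U: "U \<in> {U. openin X U \<and> K \<subseteq> U}" and V: "V \<in> {U. openin X U \<and> L \<subseteq> U}"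
  have "outer_value X \<xi> (K \<union> L) + outer_value X \<xi> (K \<inter> L) \<le> \<xi> (U \<union> V) + \<xi> (U \<inter> V)"
    using U V by (intro add_mono outer_value_le) auto
  also have "\<dots> = \<xi> U + \<xi> V" using \<xi> U V unfolding modular_content_def by simp
  finally show "outer_value X \<xi> (K \<union> L) + outer_value X \<xi> (K \<inter> L) \<le> \<xi> U + \<xi> V" .
qed

text \<open>Scott-continuity is immediate from compactness. One half of modularity combines supermodularity of the
  outer values with coherence; the other half needs every compact saturated subset of \<open>U \<union> V\<close> to split
  into one of \<open>U\<close> and one of \<open>V\<close>.\<close>

theorem regularization_continuous_valuation:
  assumes X: "locally_strongly_sober X" "odot_consonant X" and \<xi>: "modular_content X \<xi>"
  shows "continuous_valuation X (regularization X \<xi>)"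
  unfolding continuous_valuation_def scott_continuous_def
proof (intro conjI allI impI; (elim conjE)?)
  let ?\<nu> = "regularization X \<xi>" and ?o = "outer_value X \<xi>"
  show "?\<nu> \<in> extensional {U. openin X U}" by (simp add: regularization_def)
  show mono: "?\<nu> U \<le> ?\<nu> V" if "openin X U" "openin X V" "U \<subseteq> V" for U V
    using that by (intro regularization_least le_regularization) auto
  show "?\<nu> {} = 0"
    using regularization_le[of X "{}" \<xi>] \<xi> by (simp add: modular_content_def)
  show "?\<nu> (\<Union>\<D>) = (SUP U\<in>\<D>. ?\<nu> U)" if D: "directed_opens X \<D>" for \<D>
  proof (rule antisym)
    have op: "openin X U" if "U \<in> \<D>" for U using D that by (auto simp: directed_opens_def)
    then have opU: "openin X (\<Union>\<D>)" by blast
    show "(SUP U\<in>\<D>. ?\<nu> U) \<le> ?\<nu> (\<Union>\<D>)" using op opU by (intro SUP_least mono) auto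
    show "?\<nu> (\<Union>\<D>) \<le> (SUP U\<in>\<D>. ?\<nu> U)"
    proof (rule regularization_least[OF opU])
      fix K assume K: "compactin X K" "saturatedin X K" "K \<subseteq> \<Union>\<D>"
      then obtain \<F> where F: "finite \<F>" "\<F> \<subseteq> \<D>" "K \<subseteq> \<Union>\<F>"
        using op unfolding compactin_def by (metis (no_types))
      have "\<exists>W\<in>\<D>. \<Union>\<F> \<subseteq> W"
        using F(1,2)
      proof induction
        case empty then show ?case using D by (auto simp: directed_opens_def)
      next
        case (insert A \<F>)
        then obtain B where "B \<in> \<D>" "\<Union>\<F> \<subseteq> B" "A \<in> \<D>" by auto
        moreover then obtain W where "W \<in> \<D>" "A \<subseteq> W" "B \<subseteq> W"
          using D unfolding directed_opens_def by meson
        ultimately show ?case by (intro bexI[of _ W]) auto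
      qed
      then obtain W where W: "W \<in> \<D>" "K \<subseteq> W" using F by auto
      then show "?o K \<le> (SUP U\<in>\<D>. ?\<nu> U)"
        using K op by (intro SUP_upper2[of W] le_regularization) auto
    qed
  qed
  show "?\<nu> U + ?\<nu> V = ?\<nu> (U \<union> V) + ?\<nu> (U \<inter> V)" if UV: "openin X U" "openin X V" for U V
  proof (rule antisym)
    let ?C = "\<lambda>U. {K. compactin X K \<and> saturatedin X K \<and> K \<subseteq> U}"
    have ne: "?C U \<noteq> {}" for U by (auto intro!: exI[of _ "{}"] simp: saturatedin_def)
    have eq: "?\<nu> U = (SUP K\<in>?C U. ?o K)" if "openin X U" for U
      using that by (simp add: regularization_def)
    have UV': "openin X (U \<union> V)" "openin X (U \<inter> V)" using UV by auto
    show "?\<nu> U + ?\<nu> V \<le> ?\<nu> (U \<union> V) + ?\<nu> (U \<inter> V)"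
      unfolding eq[OF UV(1)] eq[OF UV(2)]
    proof (rule SUP_add_SUP_le[OF ne ne])
      fix K L assume K: "K \<in> ?C U" and L: "L \<in> ?C V"
      have "?o K + ?o L \<le> ?o (K \<union> L) + ?o (K \<inter> L)"
        using outer_value_supermodular[OF X(1) \<xi>] K L by auto
      also have "\<dots> \<le> ?\<nu> (U \<union> V) + ?\<nu> (U \<inter> V)"
        using K L UV' locally_strongly_sober_coherent[OF X(1)]
        by (intro add_mono le_regularization) (auto intro: compactin_Un saturatedin_Un saturatedin_Int)
      finally show "?o K + ?o L \<le> ?\<nu> (U \<union> V) + ?\<nu> (U \<inter> V)" .
    qed
    show "?\<nu> (U \<union> V) + ?\<nu> (U \<inter> V) \<le> ?\<nu> U + ?\<nu> V"
      unfolding eq[OF UV'(1)] eq[OF UV'(2)]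
    proof (rule SUP_add_SUP_le[OF ne ne])
      fix K L assume K: "K \<in> ?C (U \<union> V)" and L: "L \<in> ?C (U \<inter> V)"
      obtain A B where AB: "compactin X A" "saturatedin X A" "A \<subseteq> U"
        "compactin X B" "saturatedin X B" "B \<subseteq> V" "K \<subseteq> A \<union> B"
        using compact_split[OF X(2) _ _ UV, of K] K by blast
      \<comment> \<open>\<open>L\<close> is added to both pieces so that it is part of their intersection.\<close>
      have "?o K + ?o L \<le> ?o ((A \<union> L) \<union> (B \<union> L)) + ?o ((A \<union> L) \<inter> (B \<union> L))"
        using AB by (intro add_mono outer_value_mono) auto
      also have "\<dots> \<le> ?o (A \<union> L) + ?o (B \<union> L)" by (rule outer_value_submodular[OF \<xi>])
      also have "\<dots> \<le> ?\<nu> U + ?\<nu> V"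
        using AB L UV by (intro add_mono le_regularization) (auto intro: compactin_Un saturatedin_Un)
      finally show "?o K + ?o L \<le> ?\<nu> U + ?\<nu> V" .
    qed
  qed
qed

text \<open>Tightness of \<open>\<mu>\<close> shows that the values of \<open>\<mu>\<close> are already witnessed on compact saturated sets.\<close>

lemma le_regularizationI:
  assumes X: "odot_consonant X" and \<mu>: "continuous_valuation X \<mu>"
    and le: "\<And>U. openin X U \<Longrightarrow> \<mu> U \<le> \<xi> U" and U: "openin X U"
  shows "\<mu> U \<le> regularization X \<xi> U"
proof (rule dense_le)
  fix a assume "a < \<mu> U"
  then obtain K where K: "compactin X K" "saturatedin X K" "K \<subseteq> U"
    and a: "\<And>V. openin X V \<Longrightarrow> K \<subseteq> V \<Longrightarrow> a < \<mu> V"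
    using continuous_valuation_tight[OF X \<mu> U] by metis
  have "a \<le> outer_value X \<xi> K"
    using a le by (intro outer_value_greatest) (meson less_le_trans less_imp_le)
  also have "\<dots> \<le> regularization X \<xi> U" by (rule le_regularization[OF U K])
  finally show "a \<le> regularization X \<xi> U" .
qed

lemma regularization_compact_space:
  assumes "compact_space X"
  shows "regularization X \<xi> (topspace X) = \<xi> (topspace X)"
proof (rule antisym)
  show "regularization X \<xi> (topspace X) \<le> \<xi> (topspace X)" by (rule regularization_le) simp
  have "\<xi> (topspace X) \<le> outer_value X \<xi> (topspace X)"
    by (rule outer_value_greatest) (metis openin_subset order.antisym order_refl)
  also have "\<dots> \<le> regularization X \<xi> (topspace X)"
    using assms by (intro le_regularization) (auto simp: compact_space_def saturatedin_def spec_le_def)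
  finally show "\<xi> (topspace X) \<le> regularization X \<xi> (topspace X)" .
qed

text \<open>The suprema over compact saturated subsets of \<open>Y\<close> and of \<open>X\<close> are compared by taking preimages, which
  are compact saturated by properness, and upward closures of images.\<close>

lemma regularization_proper:
  assumes f: "sat_proper_map X Y f" and V: "openin Y V"
    and mono: "\<And>U U'. openin X U \<Longrightarrow> openin X U' \<Longrightarrow> U \<subseteq> U' \<Longrightarrow> \<xi> U \<le> \<xi> U'"
    and \<zeta>: "\<And>W. openin Y W \<Longrightarrow> \<zeta> W = \<xi> {x \<in> topspace X. f x \<in> W}"
  shows "regularization X \<xi> {x \<in> topspace X. f x \<in> V} = regularization Y \<zeta> V"
proof (rule antisym)
  have cont: "continuous_map X Y f" using f by (simp add: sat_proper_map_def)
  have pre: "openin X {x \<in> topspace X. f x \<in> W}" if "openin Y W" for W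
    using openin_continuous_map_preimage[OF cont that] .
  show "regularization X \<xi> {x \<in> topspace X. f x \<in> V} \<le> regularization Y \<zeta> V"
  proof (rule regularization_least[OF pre[OF V]])
    fix K assume K: "compactin X K" "saturatedin X K" "K \<subseteq> {x \<in> topspace X. f x \<in> V}"
    let ?L = "up_closure Y (f ` K)"
    have KY: "f ` K \<subseteq> topspace Y" using K cont by (auto simp: saturatedin_def continuous_map_def)
    have "outer_value X \<xi> K \<le> outer_value Y \<zeta> ?L"
    proof (rule outer_value_greatest)
      fix W assume W: "openin Y W" "?L \<subseteq> W"
      then have "f ` K \<subseteq> W" using subset_up_closure[OF KY] by auto
      then show "outer_value X \<xi> K \<le> \<zeta> W"
        using K W pre unfolding \<zeta>[OF W(1)] by (intro outer_value_le) (auto simp: saturatedin_def)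
    qed
    also have "\<dots> \<le> regularization Y \<zeta> V"
      using K V image_compactin[OF K(1) cont]
      by (intro le_regularization compactin_up_closure saturatedin_up_closure up_closure_subset_open) auto
    finally show "outer_value X \<xi> K \<le> regularization Y \<zeta> V" .
  qed
  show "regularization Y \<zeta> V \<le> regularization X \<xi> {x \<in> topspace X. f x \<in> V}"
  proof (rule regularization_least[OF V])
    fix L assume L: "compactin Y L" "saturatedin Y L" "L \<subseteq> V"
    let ?K = "{x \<in> topspace X. f x \<in> L}"
    have K: "compactin X ?K" "saturatedin X ?K" using f L by (auto simp: sat_proper_map_def)
    have "outer_value Y \<zeta> L \<le> outer_value X \<xi> ?K"
    proof (rule outer_value_greatest)
      fix U assume U: "openin X U" "?K \<subseteq> U"
      obtain W where W: "openin Y W" "L \<subseteq> W" "{x \<in> topspace X. f x \<in> W} \<subseteq> U"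
        using proper_open_nbhd[OF f L(2) U] by metis
      have "outer_value Y \<zeta> L \<le> \<zeta> W" by (rule outer_value_le[OF W(1,2)])
      also have "\<dots> \<le> \<xi> U" unfolding \<zeta>[OF W(1)] using W U pre by (intro mono) auto
      finally show "outer_value Y \<zeta> L \<le> \<xi> U" .
    qed
    also have "\<dots> \<le> regularization X \<xi> {x \<in> topspace X. f x \<in> V}"
      using L pre[OF V] K by (intro le_regularization) auto
    finally show "outer_value Y \<zeta> L \<le> regularization X \<xi> {x \<in> topspace X. f x \<in> V}" .
  qed
qed

section \<open>Spaces of continuous valuations\<close>

text \<open>The thresholds are allowed to range over all of \<^typ>\<open>ennreal\<close>, rather than over the real numbers of the
  original subbasis, which avoids conversions later.\<close>

lemma V_space_nbhd:
  assumes U: "openin (V_space b X) \<U>" and \<nu>: "\<nu> \<in> \<U>"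
  shows "\<exists>F::('a set \<times> ennreal) set. finite F \<and> (\<forall>(U, a)\<in>F. openin X U \<and> a < \<nu> U) \<and>
    (\<forall>\<mu>\<in>topspace (V_space b X). (\<forall>(U, a)\<in>F. a < \<mu> U) \<longrightarrow> \<mu> \<in> \<U>)"
proof -
  let ?S = "insert {\<nu>. continuous_valuation X \<nu>}
          {{\<nu>. continuous_valuation X \<nu> \<and> \<nu> U > ennreal r} |U r. openin X U \<and> (0::real) \<le> r}"
  obtain W where W: "openin (valuation_space X) W" "\<U> = W \<inter> {\<nu>. mass_condition b (\<nu> (topspace X))}"
    using U unfolding V_space_def openin_subtopology by auto
  have "generate_topology_on ?S W"
    using W(1) unfolding valuation_space_def by (rule openin_topology_generated_by)
  then have "\<exists>F. finite F \<and> (\<forall>(U, a)\<in>F. openin X U \<and> a < \<nu> U) \<and>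
      (\<forall>\<mu>. continuous_valuation X \<mu> \<and> (\<forall>(U, a)\<in>F. a < \<mu> U) \<longrightarrow> \<mu> \<in> W)" if "\<nu> \<in> W" for \<nu>
    using that
  proof (induction arbitrary: \<nu>)
    case Empty then show ?case by simp
  next
    case (Int A B)
    from Int.IH(1)[of \<nu>] obtain F where F: "finite F" "\<forall>(U, a)\<in>F. openin X U \<and> a < \<nu> U"
      "\<forall>\<mu>. continuous_valuation X \<mu> \<and> (\<forall>(U, a)\<in>F. a < \<mu> U) \<longrightarrow> \<mu> \<in> A"
      using Int.prems by auto
    from Int.IH(2)[of \<nu>] obtain F' where F': "finite F'" "\<forall>(U, a)\<in>F'. openin X U \<and> a < \<nu> U"
      "\<forall>\<mu>. continuous_valuation X \<mu> \<and> (\<forall>(U, a)\<in>F'. a < \<mu> U) \<longrightarrow> \<mu> \<in> B"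
      using Int.prems by auto
    show ?case using F F' by (intro exI[of _ "F \<union> F'"]) auto
  next
    case (UN K)
    then obtain k where k: "k \<in> K" "\<nu> \<in> k" by auto
    from UN.IH[OF this] obtain F where "finite F" "\<forall>(U, a)\<in>F. openin X U \<and> a < \<nu> U"
      "\<forall>\<mu>. continuous_valuation X \<mu> \<and> (\<forall>(U, a)\<in>F. a < \<mu> U) \<longrightarrow> \<mu> \<in> k" by auto
    then show ?case using k by (intro exI[of _ F]) auto
  next
    case (Basis s)
    then consider "s = {\<nu>. continuous_valuation X \<nu>}"
      | U r where "s = {\<nu>. continuous_valuation X \<nu> \<and> \<nu> U > ennreal r}" "openin X U" by auto
    then show ?case
    proof cases
      case 1 then show ?thesis by (intro exI[of _ "{}"]) auto
    next
      case 2 then show ?thesis using Basis.prems by (intro exI[of _ "{(U, ennreal r)}"]) auto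
    qed
  qed
  from this[of \<nu>] show ?thesis using \<nu> W(2) by (auto simp: topspace_V_space)
qed

lemma openin_V_space_gt:
  assumes "openin X U"
  shows "openin (V_space b X) {\<nu> \<in> topspace (V_space b X). a < \<nu> U}"
proof (cases a rule: ennreal_cases)
  case (real r)
  have "openin (valuation_space X) {\<nu>. continuous_valuation X \<nu> \<and> \<nu> U > ennreal r}"
    unfolding valuation_space_def using assms real by (intro topology_generated_by_Basis) auto
  moreover have "{\<nu> \<in> topspace (V_space b X). a < \<nu> U} =
      {\<nu>. continuous_valuation X \<nu> \<and> \<nu> U > ennreal r} \<inter> {\<nu>. mass_condition b (\<nu> (topspace X))}"
    using real by (auto simp: topspace_V_space)
  ultimately show ?thesis unfolding V_space_def openin_subtopology by blast
next
  case top
  then have eq: "{\<nu> \<in> topspace (V_space b X). a < \<nu> U} = {}" by auto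
  show ?thesis unfolding eq by simp
qed

lemma continuous_map_into_V_space:
  assumes f: "\<And>z. z \<in> topspace Z \<Longrightarrow> f z \<in> topspace (V_space b X)"
    and op: "\<And>U a. openin X U \<Longrightarrow> openin Z {z \<in> topspace Z. a < f z U}"
  shows "continuous_map Z (V_space b X) f"
  unfolding continuous_map_def
proof (intro conjI allI impI)
  show "f \<in> topspace Z \<rightarrow> topspace (V_space b X)" using f by auto
  fix \<U> assume U: "openin (V_space b X) \<U>"
  show "openin Z {z \<in> topspace Z. f z \<in> \<U>}"
  proof (subst openin_subopen, intro ballI)
    fix z assume z: "z \<in> {z \<in> topspace Z. f z \<in> \<U>}"
    then have "f z \<in> \<U>" by simp
    from V_space_nbhd[OF U this] obtain F where F: "finite F"
      "\<forall>(U, a)\<in>F. openin X U \<and> a < f z U"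
      "\<forall>\<rho>\<in>topspace (V_space b X). (\<forall>(U, a)\<in>F. a < \<rho> U) \<longrightarrow> \<rho> \<in> \<U>"
      by blast
    let ?T = "(\<Inter>c\<in>F. {z \<in> topspace Z. snd c < f z (fst c)}) \<inter> topspace Z"
    have "openin Z ?T"
    proof (rule openin_INT)
      fix c assume "c \<in> F"
      then show "openin Z {z \<in> topspace Z. snd c < f z (fst c)}" using F(2) by (intro op) auto
    qed (rule F(1))
    moreover have "z \<in> ?T" using F z by auto
    moreover have "?T \<subseteq> {z \<in> topspace Z. f z \<in> \<U>}"
    proof
      fix w assume w: "w \<in> ?T"
      then have "\<forall>(U, a)\<in>F. a < f w U" by auto
      with F(3) f w have "f w \<in> \<U>" by auto
      with w show "w \<in> {z \<in> topspace Z. f z \<in> \<U>}" by simp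
    qed
    ultimately show "\<exists>T. openin Z T \<and> z \<in> T \<and> T \<subseteq> {z \<in> topspace Z. f z \<in> \<U>}" by blast
  qed
qed

lemma spec_le_V_space:
  "spec_le (V_space b X) \<mu> \<nu> \<longleftrightarrow>
     \<mu> \<in> topspace (V_space b X) \<and> \<nu> \<in> topspace (V_space b X) \<and> (\<forall>U. openin X U \<longrightarrow> \<mu> U \<le> \<nu> U)"
proof (intro iffI conjI allI impI)
  assume le: "spec_le (V_space b X) \<mu> \<nu>"
  then show T: "\<mu> \<in> topspace (V_space b X)" "\<nu> \<in> topspace (V_space b X)" by (auto simp: spec_le_def)
  fix U assume U: "openin X U"
  show "\<mu> U \<le> \<nu> U"
  proof (rule ccontr)
    assume "\<not> ?thesis"
    then have "\<mu> \<in> {\<rho> \<in> topspace (V_space b X). \<nu> U < \<rho> U}" using T by auto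
    from spec_le_open[OF le openin_V_space_gt[OF U] this] show False by simp
  qed
next
  assume le: "\<mu> \<in> topspace (V_space b X) \<and> \<nu> \<in> topspace (V_space b X) \<and> (\<forall>U. openin X U \<longrightarrow> \<mu> U \<le> \<nu> U)"
  show "spec_le (V_space b X) \<mu> \<nu>"
    unfolding spec_le_def
  proof (intro conjI allI impI; (elim conjE)?)
    fix \<U> assume "openin (V_space b X) \<U>" "\<mu> \<in> \<U>"
    from V_space_nbhd[OF this] obtain F where F: "finite F"
      "\<forall>(U, a)\<in>F. openin X U \<and> a < \<mu> U"
      "\<forall>\<rho>\<in>topspace (V_space b X). (\<forall>(U, a)\<in>F. a < \<rho> U) \<longrightarrow> \<rho> \<in> \<U>"
      by blast
    have "a < \<nu> U" if "(U, a) \<in> F" for U a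
    proof -
      have "a < \<mu> U" "\<mu> U \<le> \<nu> U" using F(2) le that by auto
      then show ?thesis by (rule less_le_trans)
    qed
    then show "\<nu> \<in> \<U>" using F(3) le by auto
  qed (use le in auto)
qed

lemma limitin_V_space:
  "limitin (V_space b X) f \<nu> G \<longleftrightarrow>
     \<nu> \<in> topspace (V_space b X) \<and> (\<forall>\<^sub>F g in G. f g \<in> topspace (V_space b X)) \<and>
     (\<forall>U a. openin X U \<longrightarrow> a < \<nu> U \<longrightarrow> (\<forall>\<^sub>F g in G. a < f g U))"
proof (intro iffI conjI allI impI)
  assume l: "limitin (V_space b X) f \<nu> G"
  then show T: "\<nu> \<in> topspace (V_space b X)" and "\<forall>\<^sub>F g in G. f g \<in> topspace (V_space b X)"
    by (auto simp: limitin_def)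
  fix U a assume U: "openin X U" and a: "a < \<nu> U"
  then have "\<forall>\<^sub>F g in G. f g \<in> {\<nu> \<in> topspace (V_space b X). a < \<nu> U}"
    using l openin_V_space_gt[OF U] T unfolding limitin_def by blast
  then show "\<forall>\<^sub>F g in G. a < f g U" by eventually_elim simp
next
  assume r: "\<nu> \<in> topspace (V_space b X) \<and> (\<forall>\<^sub>F g in G. f g \<in> topspace (V_space b X)) \<and>
     (\<forall>U a. openin X U \<longrightarrow> a < \<nu> U \<longrightarrow> (\<forall>\<^sub>F g in G. a < f g U))"
  show "limitin (V_space b X) f \<nu> G"
    unfolding limitin_def
  proof (intro conjI allI impI; (elim conjE)?)
    fix \<U> assume "openin (V_space b X) \<U>" "\<nu> \<in> \<U>"
    from V_space_nbhd[OF this] obtain F where F: "finite F"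
      "\<forall>(U, a)\<in>F. openin X U \<and> a < \<nu> U"
      "\<forall>\<rho>\<in>topspace (V_space b X). (\<forall>(U, a)\<in>F. a < \<rho> U) \<longrightarrow> \<rho> \<in> \<U>"
      by blast
    have "\<forall>\<^sub>F g in G. \<forall>c\<in>F. snd c < f g (fst c)"
      using F r by (intro eventually_ball_finite) auto
    moreover have "\<forall>\<^sub>F g in G. f g \<in> topspace (V_space b X)" using r by blast
    ultimately show "\<forall>\<^sub>F g in G. f g \<in> \<U>" by eventually_elim (use F(3) in \<open>auto simp: case_prod_beta\<close>)
  qed (use r in auto)
qed

subsection \<open>Image valuations\<close>

lemma V_map_apply: "openin Y V \<Longrightarrow> V_map X Y f \<nu> V = \<nu> {x \<in> topspace X. f x \<in> V}"
  by (simp add: V_map_def)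

lemma V_map_extensional: "V_map X Y f \<nu> \<in> extensional {V. openin Y V}"
  by (simp add: V_map_def)

lemma continuous_valuation_V_map:
  assumes f: "continuous_map X Y f" and \<nu>: "continuous_valuation X \<nu>"
  shows "continuous_valuation Y (V_map X Y f \<nu>)"
proof -
  have pre: "openin X {x \<in> topspace X. f x \<in> W}" if "openin Y W" for W
    using openin_continuous_map_preimage[OF f that] .
  show ?thesis
    unfolding continuous_valuation_def scott_continuous_def
  proof (intro conjI allI impI; (elim conjE)?)
    show "V_map X Y f \<nu> U \<le> V_map X Y f \<nu> V" if "openin Y U" "openin Y V" "U \<subseteq> V" for U V
      using that by (auto simp: V_map_apply intro!: continuous_valuation_mono[OF \<nu>] pre)
    show "V_map X Y f \<nu> {} = 0" using continuous_valuation_empty[OF \<nu>] by (simp add: V_map_apply)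
    show "V_map X Y f \<nu> (\<Union>\<D>) = (SUP U\<in>\<D>. V_map X Y f \<nu> U)" if D: "directed_opens Y \<D>" for \<D>
    proof -
      let ?p = "\<lambda>W. {x \<in> topspace X. f x \<in> W}"
      have op: "openin Y U" if "U \<in> \<D>" for U using D that by (auto simp: directed_opens_def)
      have D': "directed_opens X (?p ` \<D>)"
        unfolding directed_opens_def
      proof (intro conjI ballI)
        show "?p ` \<D> \<noteq> {}" using D by (auto simp: directed_opens_def)
        show "openin X U" if "U \<in> ?p ` \<D>" for U using that pre op by auto
        fix A B assume "A \<in> ?p ` \<D>" "B \<in> ?p ` \<D>"
        then obtain a b where ab: "a \<in> \<D>" "b \<in> \<D>" "A = ?p a" "B = ?p b" by blast
        then obtain c where "c \<in> \<D>" "a \<subseteq> c" "b \<subseteq> c" using D unfolding directed_opens_def by meson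
        with ab show "\<exists>W\<in>?p ` \<D>. A \<subseteq> W \<and> B \<subseteq> W" by (intro bexI[of _ "?p c"]) auto
      qed
      have "openin Y (\<Union>\<D>)" using op by blast
      then have "V_map X Y f \<nu> (\<Union>\<D>) = \<nu> (?p (\<Union>\<D>))" by (rule V_map_apply)
      also have "?p (\<Union>\<D>) = \<Union>(?p ` \<D>)" by auto
      also have "\<nu> \<dots> = (SUP U\<in>?p ` \<D>. \<nu> U)" by (rule continuous_valuation_Union[OF \<nu> D'])
      also have "\<dots> = (SUP U\<in>\<D>. \<nu> (?p U))" by (simp add: image_image)
      also have "\<dots> = (SUP U\<in>\<D>. V_map X Y f \<nu> U)" using op by (intro SUP_cong) (auto simp: V_map_apply)
      finally show ?thesis .
    qed
    show "V_map X Y f \<nu> U + V_map X Y f \<nu> V = V_map X Y f \<nu> (U \<union> V) + V_map X Y f \<nu> (U \<inter> V)"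
      if "openin Y U" "openin Y V" for U V
    proof -
      have "{x \<in> topspace X. f x \<in> U \<union> V} = {x \<in> topspace X. f x \<in> U} \<union> {x \<in> topspace X. f x \<in> V}"
        "{x \<in> topspace X. f x \<in> U \<inter> V} = {x \<in> topspace X. f x \<in> U} \<inter> {x \<in> topspace X. f x \<in> V}" by auto
      then show ?thesis
        using that continuous_valuation_modular[OF \<nu> pre[OF that(1)] pre[OF that(2)]]
        by (simp add: V_map_apply openin_Un openin_Int)
    qed
  qed (rule V_map_extensional)
qed

lemma V_map_topspace:
  assumes "continuous_map X Y f"
  shows "V_map X Y f \<nu> (topspace Y) = \<nu> (topspace X)"
proof -
  have "{x \<in> topspace X. f x \<in> topspace Y} = topspace X" using assms by (auto simp: continuous_map_def)
  then show ?thesis by (simp add: V_map_apply)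
qed

lemma V_map_in_V_space:
  assumes "continuous_map X Y f" "\<nu> \<in> topspace (V_space b X)"
  shows "V_map X Y f \<nu> \<in> topspace (V_space b Y)"
  using assms by (simp add: topspace_V_space continuous_valuation_V_map V_map_topspace)

lemma continuous_map_V_map:
  assumes f: "continuous_map X Y f"
  shows "continuous_map (V_space b X) (V_space b Y) (V_map X Y f)"
proof (rule continuous_map_into_V_space)
  fix U a assume "openin Y U"
  then show "openin (V_space b X) {\<nu> \<in> topspace (V_space b X). a < V_map X Y f \<nu> U}"
    using openin_V_space_gt[OF openin_continuous_map_preimage[OF f]] by (simp add: V_map_apply)
qed (rule V_map_in_V_space[OF f])

lemma V_map_ident:
  assumes "continuous_valuation X \<nu>" "\<And>x. x \<in> topspace X \<Longrightarrow> f x = x"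
  shows "V_map X X f \<nu> = \<nu>"
proof (rule extensionalityI[of _ "{U. openin X U}"])
  fix U assume "U \<in> {U. openin X U}"
  moreover then have "{x \<in> topspace X. f x \<in> U} = U" using assms(2) openin_subset by fastforce
  ultimately show "V_map X X f \<nu> U = \<nu> U" by (simp add: V_map_apply)
qed (use assms V_map_extensional in \<open>auto simp: continuous_valuation_def\<close>)

lemma V_map_compose:
  assumes f: "continuous_map X Y f" and g: "continuous_map Y Z g"
    and h: "\<And>x. x \<in> topspace X \<Longrightarrow> g (f x) = h x"
  shows "V_map Y Z g (V_map X Y f \<nu>) = V_map X Z h \<nu>"
proof (rule extensionalityI[of _ "{U. openin Z U}"])
  fix U assume "U \<in> {U. openin Z U}"
  then have U: "openin Z U" by simp
  have "{x \<in> topspace X. f x \<in> {y \<in> topspace Y. g y \<in> U}} = {x \<in> topspace X. h x \<in> U}"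
    using f h by (auto simp: continuous_map_def)
  then show "V_map Y Z g (V_map X Y f \<nu>) U = V_map X Z h \<nu> U"
    using U openin_continuous_map_preimage[OF g U] by (simp add: V_map_apply)
qed (use V_map_extensional in auto)

subsection \<open>Convexity\<close>

definition convex_comb :: "'a topology \<Rightarrow> real \<Rightarrow> 'a valuation \<Rightarrow> 'a valuation \<Rightarrow> 'a valuation" where
  "convex_comb X t \<mu> \<nu> = (\<lambda>U\<in>{U. openin X U}. ennreal t * \<mu> U + ennreal (1 - t) * \<nu> U)"

lemma convex_valuations_iff:
  "convex_valuations X L \<longleftrightarrow> (\<forall>\<mu>\<in>L. \<forall>\<nu>\<in>L. \<forall>t\<in>{0..1}. convex_comb X t \<mu> \<nu> \<in> L)"
  by (simp add: convex_valuations_def convex_comb_def)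

lemma convex_comb_apply:
  "openin X U \<Longrightarrow> convex_comb X t \<mu> \<nu> U = ennreal t * \<mu> U + ennreal (1 - t) * \<nu> U"
  by (simp add: convex_comb_def)

lemma convex_comb_commute: "convex_comb X t \<mu> \<nu> = convex_comb X (1 - t) \<nu> \<mu>"
  by (simp add: convex_comb_def add.commute)

lemma continuous_valuation_convex_comb:
  assumes \<mu>: "continuous_valuation X \<mu>" and \<nu>: "continuous_valuation X \<nu>"
  shows "continuous_valuation X (convex_comb X t \<mu> \<nu>)"
  unfolding continuous_valuation_def scott_continuous_def
proof (intro conjI allI impI; (elim conjE)?)
  let ?c = "convex_comb X t \<mu> \<nu>"
  show "?c \<in> extensional {U. openin X U}" by (simp add: convex_comb_def)
  show mono: "?c U \<le> ?c V" if "openin X U" "openin X V" "U \<subseteq> V" for U V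
    using that continuous_valuation_mono[OF \<mu> that] continuous_valuation_mono[OF \<nu> that]
    by (auto simp: convex_comb_apply intro!: add_mono mult_left_mono)
  show "?c {} = 0"
    using \<mu> \<nu> by (simp add: convex_comb_apply continuous_valuation_empty)
  show "?c U + ?c V = ?c (U \<union> V) + ?c (U \<inter> V)" if "openin X U" "openin X V" for U V
  proof -
    have "?c U + ?c V = ennreal t * (\<mu> U + \<mu> V) + ennreal (1 - t) * (\<nu> U + \<nu> V)"
      using that by (simp add: convex_comb_apply algebra_simps)
    also have "\<dots> = ennreal t * (\<mu> (U \<union> V) + \<mu> (U \<inter> V)) + ennreal (1 - t) * (\<nu> (U \<union> V) + \<nu> (U \<inter> V))"
      by (simp only: continuous_valuation_modular[OF \<mu> that] continuous_valuation_modular[OF \<nu> that])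
    also have "\<dots> = ?c (U \<union> V) + ?c (U \<inter> V)"
      using that by (simp add: convex_comb_apply openin_Un openin_Int algebra_simps)
    finally show ?thesis .
  qed
  show "?c (\<Union>\<D>) = (SUP U\<in>\<D>. ?c U)" if D: "directed_opens X \<D>" for \<D>
  proof (rule antisym)
    have op: "openin X U" if "U \<in> \<D>" for U using D that by (auto simp: directed_opens_def)
    then have opU: "openin X (\<Union>\<D>)" by blast
    have ne: "\<D> \<noteq> {}" using D by (simp add: directed_opens_def)
    show "(SUP U\<in>\<D>. ?c U) \<le> ?c (\<Union>\<D>)" using op opU by (intro SUP_least mono) auto
    have "?c (\<Union>\<D>) = (SUP U\<in>\<D>. ennreal t * \<mu> U) + (SUP U\<in>\<D>. ennreal (1 - t) * \<nu> U)"
      unfolding convex_comb_apply[OF opU] continuous_valuation_Union[OF \<mu> D]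
        continuous_valuation_Union[OF \<nu> D] SUP_mult_left_ennreal ..
    also have "\<dots> \<le> (SUP U\<in>\<D>. ?c U)"
    proof (rule SUP_add_SUP_le[OF ne ne])
      fix A B assume AB: "A \<in> \<D>" "B \<in> \<D>"
      then obtain C where C: "C \<in> \<D>" "A \<subseteq> C" "B \<subseteq> C" using D unfolding directed_opens_def by meson
      have "ennreal t * \<mu> A + ennreal (1 - t) * \<nu> B \<le> ?c C"
        unfolding convex_comb_apply[OF op[OF C(1)]]
        using AB C op by (intro add_mono mult_left_mono continuous_valuation_mono[OF \<mu>]
            continuous_valuation_mono[OF \<nu>]) auto
      then show "ennreal t * \<mu> A + ennreal (1 - t) * \<nu> B \<le> (SUP U\<in>\<D>. ?c U)"
        using C by (intro SUP_upper2)
    qed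
    finally show "?c (\<Union>\<D>) \<le> (SUP U\<in>\<D>. ?c U)" .
  qed
qed

lemma V_space_convex_comb:
  assumes "\<mu> \<in> topspace (V_space b X)" "\<nu> \<in> topspace (V_space b X)" "t \<in> {0..1}"
  shows "convex_comb X t \<mu> \<nu> \<in> topspace (V_space b X)"
proof -
  have t: "ennreal t + ennreal (1 - t) = 1" using assms(3) by (simp flip: ennreal_plus)
  have "ennreal t * x + ennreal (1 - t) * y \<le> 1" if "x \<le> 1" "y \<le> 1" for x y
  proof -
    have "ennreal t * x + ennreal (1 - t) * y \<le> ennreal t * 1 + ennreal (1 - t) * 1"
      using that by (intro add_mono mult_left_mono) auto
    then show ?thesis using t by simp
  qed
  then have "mass_condition b (convex_comb X t \<mu> \<nu> (topspace X))"
    using assms t by (cases b) (auto simp: topspace_V_space convex_comb_apply)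
  then show ?thesis
    using assms by (auto simp: topspace_V_space continuous_valuation_convex_comb)
qed

lemma V_map_convex_comb:
  assumes f: "continuous_map X Y f"
  shows "V_map X Y f (convex_comb X t \<mu> \<nu>) = convex_comb Y t (V_map X Y f \<mu>) (V_map X Y f \<nu>)"
  by (rule extensionalityI[of _ "{U. openin Y U}"])
    (use openin_continuous_map_preimage[OF f] in
      \<open>auto simp: V_map_extensional V_map_apply convex_comb_apply, auto simp: convex_comb_def\<close>)

text \<open>Lower semicontinuity of \<open>\<lambda>t. s * t + c\<close>: it preserves the supremum \<open>t\<close> of the numbers below \<open>t\<close>, a
  non-empty set as soon as \<open>t \<noteq> 0\<close>.\<close>

lemma affine_greater_open:
  fixes a s c t :: ennreal
  assumes "a < s * t + c"
  shows "(\<forall>t'. a < s * t' + c) \<or> (\<exists>q<t. \<forall>t'>q. a < s * t' + c)"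
proof (cases "a < c")
  case True
  then have "a < s * t' + c" for t' by (rule less_le_trans) simp
  then show ?thesis by blast
next
  case False
  have "t \<noteq> 0" using False assms by auto
  then have "0 < t" by (simp add: zero_less_iff_neq_zero)
  then have ne: "{q. q < t} \<noteq> {}" by blast
  have t: "t = (SUP q\<in>{q. q < t}. q)"
  proof (rule antisym)
    show "t \<le> (SUP q\<in>{q. q < t}. q)" by (rule dense_le) (simp add: Sup_upper)
    show "(SUP q\<in>{q. q < t}. q) \<le> t" by (rule SUP_least) simp
  qed
  have "s * t + c = (SUP q\<in>{q. q < t}. s * q + c)"
    unfolding ennreal_SUP_add_left[OF ne] SUP_mult_left_ennreal[symmetric] using t by simp
  with assms have "a < (SUP q\<in>{q. q < t}. s * q + c)" by simp
  then obtain q where q: "q < t" "a < s * q + c" unfolding less_SUP_iff by auto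
  have "a < s * t' + c" if "q < t'" for t'
    using q(2) that by (elim less_le_trans) (auto intro!: add_mono mult_left_mono)
  with q show ?thesis by blast
qed

lemma continuous_map_convex_comb_left:
  assumes \<nu>: "\<nu> \<in> topspace (V_space b X)" and t: "t \<in> {0..1}"
  shows "continuous_map (V_space b X) (V_space b X) (\<lambda>\<mu>. convex_comb X t \<mu> \<nu>)"
proof (rule continuous_map_into_V_space)
  show "convex_comb X t \<mu> \<nu> \<in> topspace (V_space b X)" if "\<mu> \<in> topspace (V_space b X)" for \<mu>
    using V_space_convex_comb[OF that \<nu> t] .
  fix U a assume U: "openin X U"
  let ?T = "{\<mu> \<in> topspace (V_space b X). a < convex_comb X t \<mu> \<nu> U}"
  show "openin (V_space b X) ?T"
  proof (subst openin_subopen, intro ballI)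
    fix \<mu> assume \<mu>: "\<mu> \<in> ?T"
    then have "a < ennreal t * \<mu> U + ennreal (1 - t) * \<nu> U" using U by (simp add: convex_comb_apply)
    from affine_greater_open[OF this]
    show "\<exists>S. openin (V_space b X) S \<and> \<mu> \<in> S \<and> S \<subseteq> ?T"
    proof (elim disjE exE conjE)
      assume "\<forall>t'. a < ennreal t * t' + ennreal (1 - t) * \<nu> U"
      then show ?thesis
        using \<mu> U by (intro exI[of _ "topspace (V_space b X)"]) (auto simp: convex_comb_apply)
    next
      fix q assume "q < \<mu> U" "\<forall>t'>q. a < ennreal t * t' + ennreal (1 - t) * \<nu> U"
      then show ?thesis
        using \<mu> U openin_V_space_gt[OF U]
        by (intro exI[of _ "{\<mu> \<in> topspace (V_space b X). q < \<mu> U}"]) (auto simp: convex_comb_apply)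
    qed
  qed
qed

lemma continuous_map_convex_comb_right:
  assumes \<mu>: "\<mu> \<in> topspace (V_space b X)" and t: "t \<in> {0..1}"
  shows "continuous_map (V_space b X) (V_space b X) (\<lambda>\<nu>. convex_comb X t \<mu> \<nu>)"
proof -
  have "1 - t \<in> {0..1}" using t by auto
  from continuous_map_convex_comb_left[OF \<mu> this] show ?thesis
    by (simp add: convex_comb_commute[of X t \<mu>])
qed

text \<open>Separate continuity of convex combinations suffices: the closure is taken first in the left argument,
  with the right one in \<open>A\<close>, and then in the right one.\<close>

lemma convex_valuations_closure:
  assumes A: "A \<subseteq> topspace (V_space b X)" "convex_valuations X A"
  shows "convex_valuations X (V_space b X closure_of A)"
  unfolding convex_valuations_iff
proof (intro ballI)
  let ?cl = "V_space b X closure_of A"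
  fix \<mu> \<nu> t assume m: "\<mu> \<in> ?cl" "\<nu> \<in> ?cl" and t: "t \<in> {0..1::real}"
  have T: "\<mu> \<in> topspace (V_space b X)" using m by (meson closure_of_subset_topspace subsetD)
  have 1: "convex_comb X t \<mu> \<nu>' \<in> ?cl" if \<nu>': "\<nu>' \<in> A" for \<nu>'
  proof -
    have "(\<lambda>\<mu>. convex_comb X t \<mu> \<nu>') ` ?cl \<subseteq> V_space b X closure_of ((\<lambda>\<mu>. convex_comb X t \<mu> \<nu>') ` A)"
      using \<nu>' A t by (intro continuous_map_image_closure_subset continuous_map_convex_comb_left) auto
    also have "\<dots> \<subseteq> ?cl"
      using A(2) \<nu>' t by (intro closure_of_mono) (auto simp: convex_valuations_iff)
    finally show ?thesis using m by auto
  qed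
  have "convex_comb X t \<mu> ` ?cl \<subseteq> V_space b X closure_of (convex_comb X t \<mu> ` A)"
    using T t by (intro continuous_map_image_closure_subset continuous_map_convex_comb_right)
  also have "\<dots> \<subseteq> V_space b X closure_of ?cl" using 1 by (intro closure_of_mono) auto
  also have "\<dots> = ?cl" by simp
  finally show "convex_comb X t \<mu> \<nu> \<in> ?cl" using m by auto
qed

lemma convex_valuations_up_closure:
  assumes A: "convex_valuations X A"
  shows "convex_valuations X (up_closure (V_space b X) A)"
  unfolding convex_valuations_iff
proof (intro ballI)
  fix \<mu> \<nu> t assume m: "\<mu> \<in> up_closure (V_space b X) A" "\<nu> \<in> up_closure (V_space b X) A"
    and t: "t \<in> {0..1::real}"
  obtain \<mu>' \<nu>' where mn: "\<mu>' \<in> A" "spec_le (V_space b X) \<mu>' \<mu>" "\<nu>' \<in> A" "spec_le (V_space b X) \<nu>' \<nu>"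
    using m by (auto simp: up_closure_def)
  have "spec_le (V_space b X) (convex_comb X t \<mu>' \<nu>') (convex_comb X t \<mu> \<nu>)"
    using mn t by (auto simp: spec_le_V_space convex_comb_apply intro!: V_space_convex_comb add_mono mult_left_mono)
  moreover have "convex_comb X t \<mu>' \<nu>' \<in> A" using A mn t by (auto simp: convex_valuations_iff)
  ultimately show "convex_comb X t \<mu> \<nu> \<in> up_closure (V_space b X) A" by (auto simp: up_closure_def)
qed

lemma convex_valuations_image:
  assumes "continuous_map X Y f" "convex_valuations X A"
  shows "convex_valuations Y (V_map X Y f ` A)"
  using assms(2) unfolding convex_valuations_iff
  by (auto simp: V_map_convex_comb[OF assms(1), symmetric])

section \<open>Lenses\<close>

text \<open>The smallest lens that contains \<open>A\<close>, if \<open>A\<close> is compact and non-empty. The action of the functor on maps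
  is direct image followed by this hull.\<close>

definition lens_hull :: "'a topology \<Rightarrow> 'a set \<Rightarrow> 'a set" where
  "lens_hull Y A = up_closure Y A \<inter> Y closure_of A"

lemma convex_lens_map_eq:
  "convex_lens_map b X Y f L = lens_hull (V_space b Y) (V_map X Y f ` L)"
  by (simp add: convex_lens_map_def lens_hull_def)

lemma subset_lens_hull: "A \<subseteq> topspace Y \<Longrightarrow> A \<subseteq> lens_hull Y A"
  by (simp add: lens_hull_def subset_up_closure closure_of_subset)

lemma up_closure_mono: "A \<subseteq> B \<Longrightarrow> up_closure Y A \<subseteq> up_closure Y B"
  by (auto simp: up_closure_def)

lemma compactin_lens: "lens Y L \<Longrightarrow> compactin Y L"
  unfolding lens_def by (auto intro: compact_Int_closedin)

lemma lens_subset_topspace: "lens Y L \<Longrightarrow> L \<subseteq> topspace Y"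
  using compactin_lens compactin_subset_topspace by blast

lemma lens_hull_lens:
  assumes L: "lens Y L" shows "lens_hull Y L = L"
proof
  obtain Q C where QC: "saturatedin Y Q" "closedin Y C" "L = Q \<inter> C" using L by (auto simp: lens_def)
  have "up_closure Y L \<subseteq> Q" "Y closure_of L \<subseteq> C"
    unfolding QC(3) by (rule up_closure_least[OF QC(1)], blast, rule closure_of_minimal[OF _ QC(2)], blast)
  with QC show "lens_hull Y L \<subseteq> L" by (auto simp: lens_hull_def)
qed (rule subset_lens_hull[OF lens_subset_topspace[OF L]])

lemma lens_lens_hull:
  assumes "compactin Y A" "A \<noteq> {}" shows "lens Y (lens_hull Y A)"
  unfolding lens_def
proof (intro conjI exI)
  show "lens_hull Y A \<noteq> {}"
    using subset_lens_hull[OF compactin_subset_topspace[OF assms(1)]] assms(2) by auto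
  show "lens_hull Y A = up_closure Y A \<inter> Y closure_of A" by (simp add: lens_hull_def)
qed (use assms in \<open>auto simp: compactin_up_closure saturatedin_up_closure\<close>)

lemma lens_hull_subset_open:
  assumes "A \<subseteq> topspace Y" "openin Y U" shows "lens_hull Y A \<subseteq> U \<longleftrightarrow> A \<subseteq> U"
  using subset_lens_hull[OF assms(1)] up_closure_subset_open[OF assms(2), of A] by (auto simp: lens_hull_def)

lemma lens_hull_meets_open:
  assumes "A \<subseteq> topspace Y" "openin Y U" shows "lens_hull Y A \<inter> U \<noteq> {} \<longleftrightarrow> A \<inter> U \<noteq> {}"
  using subset_lens_hull[OF assms(1)] openin_Int_closure_of_eq_empty[OF assms(2), of A]
  by (auto simp: lens_hull_def)

text \<open>Functoriality rests on this: continuous maps are monotone and send closures into closures, so that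
  taking a hull before the image makes no difference.\<close>

lemma lens_hull_image_lens_hull:
  assumes f: "continuous_map Y Z f" and A: "A \<subseteq> topspace Y"
  shows "lens_hull Z (f ` lens_hull Y A) = lens_hull Z (f ` A)"
proof -
  have sub: "f ` A \<subseteq> f ` lens_hull Y A" using subset_lens_hull[OF A] by auto
  have "f ` lens_hull Y A \<subseteq> up_closure Z (f ` A)"
    using spec_le_continuous[OF f] by (auto simp: lens_hull_def up_closure_def)
  then have "up_closure Z (f ` lens_hull Y A) = up_closure Z (f ` A)"
    using up_closure_mono[OF sub] up_closure_least[OF saturatedin_up_closure] by blast
  moreover have "f ` lens_hull Y A \<subseteq> Z closure_of (f ` A)"
    using continuous_map_image_closure_subset[OF f, of A] by (auto simp: lens_hull_def)
  then have "Z closure_of (f ` lens_hull Y A) = Z closure_of (f ` A)"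
    using closure_of_mono[OF sub] closure_of_minimal by (metis closedin_closure_of subset_antisym)
  ultimately show ?thesis by (simp add: lens_hull_def)
qed

lemma convex_lensD:
  assumes "L \<in> convex_lenses b X"
  shows "lens (V_space b X) L" "convex_valuations X L" "L \<subseteq> topspace (V_space b X)"
    "compactin (V_space b X) L" "L \<noteq> {}" "lens_hull (V_space b X) L = L"
proof -
  show l: "lens (V_space b X) L" and "convex_valuations X L"
    using assms by (simp_all add: convex_lenses_def)
  show "L \<subseteq> topspace (V_space b X)" "compactin (V_space b X) L" "lens_hull (V_space b X) L = L"
    using lens_subset_topspace[OF l] compactin_lens[OF l] lens_hull_lens[OF l] .
  show "L \<noteq> {}" using l by (simp add: lens_def)
qed

lemma convex_lens_map_in:
  assumes f: "continuous_map X Y f" and L: "L \<in> convex_lenses b X"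
  shows "convex_lens_map b X Y f L \<in> convex_lenses b Y"
proof -
  note L' = convex_lensD[OF L]
  let ?A = "V_map X Y f ` L"
  have cA: "compactin (V_space b Y) ?A" using image_compactin[OF L'(4) continuous_map_V_map[OF f]] .
  have cv: "convex_valuations Y ?A" by (rule convex_valuations_image[OF f L'(2)])
  have "convex_valuations Y (lens_hull (V_space b Y) ?A)"
    using convex_valuations_up_closure[OF cv, of b]
      convex_valuations_closure[OF compactin_subset_topspace[OF cA] cv]
    unfolding lens_hull_def convex_valuations_iff by blast
  then show ?thesis
    using lens_lens_hull[OF cA] L'(5) by (simp add: convex_lenses_def convex_lens_map_eq)
qed

lemma convex_lens_map_subset_open:
  assumes f: "continuous_map X Y f" and L: "L \<in> convex_lenses b X" and U: "openin (V_space b Y) \<U>"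
  shows "convex_lens_map b X Y f L \<subseteq> \<U> \<longleftrightarrow> V_map X Y f ` L \<subseteq> \<U>"
    and "convex_lens_map b X Y f L \<inter> \<U> \<noteq> {} \<longleftrightarrow> V_map X Y f ` L \<inter> \<U> \<noteq> {}"
proof -
  have A: "V_map X Y f ` L \<subseteq> topspace (V_space b Y)"
    using convex_lensD(3)[OF L] V_map_in_V_space[OF f] by auto
  show "convex_lens_map b X Y f L \<subseteq> \<U> \<longleftrightarrow> V_map X Y f ` L \<subseteq> \<U>"
    "convex_lens_map b X Y f L \<inter> \<U> \<noteq> {} \<longleftrightarrow> V_map X Y f ` L \<inter> \<U> \<noteq> {}"
    unfolding convex_lens_map_eq by (rule lens_hull_subset_open[OF A U] lens_hull_meets_open[OF A U])+
qed

lemma continuous_map_convex_lens_map: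
  assumes f: "continuous_map X Y f"
  shows "continuous_map (convex_lens_space b X) (convex_lens_space b Y) (convex_lens_map b X Y f)"
proof -
  let ?S = "\<lambda>X. {{L \<in> convex_lenses b X. L \<subseteq> \<U>} |\<U>. openin (V_space b X) \<U>} \<union>
        {{L \<in> convex_lenses b X. L \<inter> \<U> \<noteq> {}} |\<U>. openin (V_space b X) \<U>}"
  let ?f = "convex_lens_map b X Y f"
  have T: "topspace (convex_lens_space b Y) = \<Union>(?S Y)"
    by (simp add: convex_lens_space_def)
  have "continuous_map (convex_lens_space b X) (topology_generated_by (?S Y)) ?f"
  proof (rule continuous_on_generated_topo)
    show "?f ` topspace (convex_lens_space b X) \<subseteq> \<Union>(?S Y)"
      unfolding T[symmetric] topspace_convex_lens_space using convex_lens_map_in[OF f] by auto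
    fix S assume "S \<in> ?S Y"
    then obtain \<U> where U: "openin (V_space b Y) \<U>"
      and S: "S = {L \<in> convex_lenses b Y. L \<subseteq> \<U>} \<or> S = {L \<in> convex_lenses b Y. L \<inter> \<U> \<noteq> {}}" by blast
    let ?V = "{\<nu> \<in> topspace (V_space b X). V_map X Y f \<nu> \<in> \<U>}"
    have V: "openin (V_space b X) ?V"
      using openin_continuous_map_preimage[OF continuous_map_V_map[OF f] U] .
    have 1: "openin (convex_lens_space b X) {L \<in> convex_lenses b X. L \<subseteq> ?V}"
      "openin (convex_lens_space b X) {L \<in> convex_lenses b X. L \<inter> ?V \<noteq> {}}"
      unfolding convex_lens_space_def by (rule topology_generated_by_Basis, use V in blast)+
    have e1: "?f L \<subseteq> \<U> \<longleftrightarrow> L \<subseteq> ?V" and e2: "?f L \<inter> \<U> \<noteq> {} \<longleftrightarrow> L \<inter> ?V \<noteq> {}"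
      if L: "L \<in> convex_lenses b X" for L
      unfolding convex_lens_map_subset_open[OF f L U] using convex_lensD(3)[OF L] by auto
    have "?f -` {L \<in> convex_lenses b Y. L \<subseteq> \<U>} \<inter> convex_lenses b X = {L \<in> convex_lenses b X. L \<subseteq> ?V}"
      using e1 convex_lens_map_in[OF f, of _ b] by blast
    moreover have "?f -` {L \<in> convex_lenses b Y. L \<inter> \<U> \<noteq> {}} \<inter> convex_lenses b X = {L \<in> convex_lenses b X. L \<inter> ?V \<noteq> {}}"
      using e2 convex_lens_map_in[OF f, of _ b] by blast
    ultimately show "openin (convex_lens_space b X) (?f -` S \<inter> topspace (convex_lens_space b X))"
      using S 1 unfolding topspace_convex_lens_space by (elim disjE) simp_all
  qed
  then show ?thesis unfolding convex_lens_space_def[of b Y] .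
qed

lemma convex_lens_map_compose:
  assumes f: "continuous_map X Y f" and g: "continuous_map Y Z g"
    and h: "\<And>x. x \<in> topspace X \<Longrightarrow> g (f x) = h x" and L: "L \<in> convex_lenses b X"
  shows "convex_lens_map b Y Z g (convex_lens_map b X Y f L) = convex_lens_map b X Z h L"
proof -
  have "V_map X Y f ` L \<subseteq> topspace (V_space b Y)"
    using convex_lensD(3)[OF L] V_map_in_V_space[OF f] by auto
  from lens_hull_image_lens_hull[OF continuous_map_V_map[OF g] this]
  show ?thesis unfolding convex_lens_map_eq by (simp add: image_image V_map_compose[OF f g h])
qed

lemma convex_lens_map_ident:
  assumes "\<And>x. x \<in> topspace X \<Longrightarrow> f x = x" and L: "L \<in> convex_lenses b X"
  shows "convex_lens_map b X X f L = L"
proof -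
  have "V_map X X f \<nu> = \<nu>" if "\<nu> \<in> L" for \<nu>
    using convex_lensD(3)[OF L] that by (intro V_map_ident assms(1)) (auto simp: topspace_V_space)
  then have "V_map X X f ` L = L" by simp
  then show ?thesis using convex_lensD(6)[OF L] by (simp add: convex_lens_map_eq)
qed

section \<open>Ultrafilters of continuous valuations\<close>

lemma ultrafilter_tendsto_Liminf:
  fixes h :: "'g \<Rightarrow> ennreal"
  assumes G: "ultrafilter_on UNIV G"
  shows "(h \<longlongrightarrow> Liminf G h) G"
proof (rule tendsto_Liminf)
  show nt: "G \<noteq> bot" using G by (rule ultrafilter_nontrivial)
  show "Limsup G h = Liminf G h"
  proof (rule antisym[OF _ Liminf_le_Limsup[OF nt]], rule dense_le)
    fix c assume c: "c < Limsup G h"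
    have "\<forall>\<^sub>F g in G. c \<le> h g"
    proof (rule ccontr)
      assume "\<not> ?thesis"
      from ultrafilter_not_eventually[OF G this] have "\<forall>\<^sub>F g in G. h g \<le> c"
        by eventually_elim auto
      from Limsup_bounded[OF this] c show False by simp
    qed
    then show "c \<le> Liminf G h" by (rule Liminf_bounded)
  qed
qed

text \<open>Along an ultrafilter, the lower limit is a limit, by compactness of \<open>[0, \<infinity>]\<close>; the choice of \<open>Liminf\<close>
  merely provides a total function.\<close>

definition pointwise_limit :: "'g filter \<Rightarrow> ('g \<Rightarrow> 'a valuation) \<Rightarrow> 'a valuation" where
  "pointwise_limit G f U = Liminf G (\<lambda>g. f g U)"

lemma pointwise_limit_tendsto:
  "ultrafilter_on UNIV G \<Longrightarrow> ((\<lambda>g. f g U) \<longlongrightarrow> pointwise_limit G f U) G"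
  unfolding pointwise_limit_def by (rule ultrafilter_tendsto_Liminf)

lemma modular_content_pointwise_limit:
  assumes G: "ultrafilter_on UNIV G" and f: "\<forall>\<^sub>F g in G. continuous_valuation X (f g)"
  shows "modular_content X (pointwise_limit G f)"
  unfolding modular_content_def
proof (intro conjI allI impI; (elim conjE)?)
  let ?\<xi> = "pointwise_limit G f"
  have nt: "G \<noteq> bot" using G by (rule ultrafilter_nontrivial)
  show "?\<xi> U \<le> ?\<xi> V" if "openin X U" "openin X V" "U \<subseteq> V" for U V
    unfolding pointwise_limit_def
    by (rule Liminf_mono, rule eventually_mono[OF f]) (rule continuous_valuation_mono[OF _ that])
  have "\<forall>\<^sub>F g in G. f g {} = 0"
    by (rule eventually_mono[OF f]) (rule continuous_valuation_empty)
  then have "Liminf G (\<lambda>g. f g {}) = Liminf G (\<lambda>g. 0)" by (rule Liminf_eq)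
  then show "?\<xi> {} = 0" using nt by (simp add: pointwise_limit_def Liminf_const)
  fix U V assume UV: "openin X U" "openin X V"
  have 1: "((\<lambda>g. f g U + f g V) \<longlongrightarrow> ?\<xi> U + ?\<xi> V) G"
    by (intro tendsto_add pointwise_limit_tendsto G)
  have 2: "((\<lambda>g. f g (U \<union> V) + f g (U \<inter> V)) \<longlongrightarrow> ?\<xi> (U \<union> V) + ?\<xi> (U \<inter> V)) G"
    by (intro tendsto_add pointwise_limit_tendsto G)
  have "\<forall>\<^sub>F g in G. f g U + f g V = f g (U \<union> V) + f g (U \<inter> V)"
    by (rule eventually_mono[OF f]) (rule continuous_valuation_modular[OF _ UV])
  from tendsto_cong[OF this] 1 have "((\<lambda>g. f g (U \<union> V) + f g (U \<inter> V)) \<longlongrightarrow> ?\<xi> U + ?\<xi> V) G" by simp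
  from tendsto_unique[OF nt this 2] show "?\<xi> U + ?\<xi> V = ?\<xi> (U \<union> V) + ?\<xi> (U \<inter> V)" .
qed

text \<open>This is local strong sobriety of \<open>V_space b X\<close>, with a formula for the greatest limit. The limits of \<open>f\<close>
  are the elements of \<open>V_space b X\<close> that lie below the pointwise limit \<open>\<xi>\<close>, and the regularization of \<open>\<xi>\<close>
  is the largest continuous valuation below \<open>\<xi>\<close>. Compactness of \<open>X\<close> guarantees that the total mass is not
  lost, as is required of probability valuations.\<close>

lemma valuation_greatest_limit:
  assumes X: "locally_strongly_sober X" "odot_consonant X" "b = Probability \<Longrightarrow> compact_space X"
    and G: "ultrafilter_on UNIV G" and f: "\<forall>\<^sub>F g in G. f g \<in> topspace (V_space b X)"
  shows "greatest_limit (V_space b X) f (regularization X (pointwise_limit G f)) G"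
proof -
  let ?\<xi> = "pointwise_limit G f" and ?\<nu> = "regularization X (pointwise_limit G f)"
  have nt: "G \<noteq> bot" using G by (rule ultrafilter_nontrivial)
  have fc: "\<forall>\<^sub>F g in G. continuous_valuation X (f g)"
    by (rule eventually_mono[OF f]) (simp add: topspace_V_space)
  have fm: "\<forall>\<^sub>F g in G. mass_condition b (f g (topspace X))"
    by (rule eventually_mono[OF f]) (simp add: topspace_V_space)
  have cv: "continuous_valuation X ?\<nu>"
    by (intro regularization_continuous_valuation X modular_content_pointwise_limit G fc)
  have le: "?\<nu> U \<le> ?\<xi> U" if "openin X U" for U using regularization_le[OF that] .
  have "mass_condition b (?\<nu> (topspace X))"
  proof (cases b)
    case Subprobability
    then have "\<forall>\<^sub>F g in G. f g (topspace X) \<le> 1" using fm by simp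
    from tendsto_upperbound[OF pointwise_limit_tendsto[OF G, of f "topspace X"] this nt]
    show ?thesis using le[of "topspace X"] Subprobability by simp
  next
    case Probability
    then have "\<forall>\<^sub>F g in G. f g (topspace X) = 1" using fm by simp
    then have "Liminf G (\<lambda>g. f g (topspace X)) = Liminf G (\<lambda>g. 1)" by (rule Liminf_eq)
    then have "?\<xi> (topspace X) = 1" using nt by (simp add: pointwise_limit_def Liminf_const)
    then show ?thesis using regularization_compact_space[OF X(3)] Probability by simp
  qed simp
  with cv have T: "?\<nu> \<in> topspace (V_space b X)" by (simp add: topspace_V_space)
  have "limitin (V_space b X) f ?\<nu> G"
    unfolding limitin_V_space
  proof (intro conjI allI impI T f)
    fix U a assume U: "openin X U" and a: "a < ?\<nu> U"
    then have "a < Liminf G (\<lambda>g. f g U)" using le[OF U] by (simp add: pointwise_limit_def)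
    then show "\<forall>\<^sub>F g in G. a < f g U" by (rule less_LiminfD)
  qed
  moreover have "spec_le (V_space b X) \<mu> ?\<nu>" if \<mu>: "limitin (V_space b X) f \<mu> G" for \<mu>
    unfolding spec_le_V_space
  proof (intro conjI allI impI T)
    show \<mu>T: "\<mu> \<in> topspace (V_space b X)" using \<mu> by (simp add: limitin_def)
    fix U assume U: "openin X U"
    have "\<mu> W \<le> ?\<xi> W" if W: "openin X W" for W
    proof (rule dense_le)
      fix a assume "a < \<mu> W"
      then have "\<forall>\<^sub>F g in G. a < f g W" using \<mu> W unfolding limitin_V_space by blast
      then have "\<forall>\<^sub>F g in G. a \<le> f g W" by eventually_elim simp
      then show "a \<le> ?\<xi> W" unfolding pointwise_limit_def by (rule Liminf_bounded)
    qed
    then show "\<mu> U \<le> ?\<nu> U"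
      using \<mu>T by (intro le_regularizationI X(2) U) (auto simp: topspace_V_space)
  qed
  ultimately show ?thesis by (simp add: greatest_limit_def)
qed

lemma V_map_regularization:
  assumes f: "sat_proper_map X Y f" and G: "ultrafilter_on UNIV G"
    and c: "\<forall>\<^sub>F g in G. continuous_valuation X (k g)" and h: "\<forall>\<^sub>F g in G. h g = V_map X Y f (k g)"
  shows "V_map X Y f (regularization X (pointwise_limit G k)) = regularization Y (pointwise_limit G h)"
proof (rule extensionalityI[of _ "{U. openin Y U}"])
  fix V assume "V \<in> {U. openin Y U}"
  then have V: "openin Y V" by simp
  have "V_map X Y f (regularization X (pointwise_limit G k)) V
      = regularization X (pointwise_limit G k) {x \<in> topspace X. f x \<in> V}"
    by (rule V_map_apply[OF V])
  also have "\<dots> = regularization Y (pointwise_limit G h) V"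
  proof (rule regularization_proper[OF f V])
    show "pointwise_limit G k U \<le> pointwise_limit G k U'" if "openin X U" "openin X U'" "U \<subseteq> U'" for U U'
      using modular_content_pointwise_limit[OF G c] that unfolding modular_content_def by blast
    fix W assume W: "openin Y W"
    show "pointwise_limit G h W = pointwise_limit G k {x \<in> topspace X. f x \<in> W}"
      unfolding pointwise_limit_def
      by (rule Liminf_eq, rule eventually_mono[OF h]) (simp add: V_map_apply[OF W])
  qed
  finally show "V_map X Y f (regularization X (pointwise_limit G k)) V = regularization Y (pointwise_limit G h) V" .
qed (simp_all add: V_map_extensional regularization_def)

section \<open>Projective systems of proper maps\<close>

locale proper_system =
  fixes I :: "'i set" and r :: "('i \<times> 'i) set"
    and X :: "'i \<Rightarrow> 'a topology" and p :: "'i \<Rightarrow> 'i \<Rightarrow> 'a \<Rightarrow> 'a"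
  assumes sys: "projective_system I r X p"
    and consonant: "\<And>i. i \<in> I \<Longrightarrow> odot_consonant (X i)"
    and sober: "\<And>i. i \<in> I \<Longrightarrow> locally_strongly_sober (X i)"
    and proper: "\<And>i j. (i, j) \<in> r \<Longrightarrow> sat_proper_map (X j) (X i) (p i j)"
begin

abbreviation "Xlim \<equiv> projective_limit I r X p"

lemma r_in: "(i, j) \<in> r \<Longrightarrow> i \<in> I" "(i, j) \<in> r \<Longrightarrow> j \<in> I"
  using sys by (auto simp: projective_system_def preorder_on_def)

lemma r_refl: "i \<in> I \<Longrightarrow> (i, i) \<in> r"
  using sys by (auto simp: projective_system_def preorder_on_def refl_on_def)

lemma r_trans: "(i, j) \<in> r \<Longrightarrow> (j, k) \<in> r \<Longrightarrow> (i, k) \<in> r"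
  using sys unfolding projective_system_def preorder_on_def by (meson transD)

lemma r_upper: "i \<in> I \<Longrightarrow> j \<in> I \<Longrightarrow> \<exists>k\<in>I. (i, k) \<in> r \<and> (j, k) \<in> r"
  using sys by (simp add: projective_system_def)

lemma r_upper_finite: "finite J \<Longrightarrow> J \<subseteq> I \<Longrightarrow> \<exists>k\<in>I. \<forall>j\<in>J. (j, k) \<in> r"
proof (induction rule: finite_induct)
  case empty then show ?case using sys by (auto simp: projective_system_def)
next
  case (insert j J)
  then obtain k where k: "k \<in> I" "\<forall>j\<in>J. (j, k) \<in> r" by auto
  obtain l where "l \<in> I" "(j, l) \<in> r" "(k, l) \<in> r" using r_upper[of j k] insert.prems k by auto
  with k show ?case by (intro bexI[of _ l]) (auto intro: r_trans)
qed

lemma p_cont: "(i, j) \<in> r \<Longrightarrow> continuous_map (X j) (X i) (p i j)"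
  using sys by (simp add: projective_system_def)

lemma p_in: "(i, j) \<in> r \<Longrightarrow> x \<in> topspace (X j) \<Longrightarrow> p i j x \<in> topspace (X i)"
  using p_cont unfolding continuous_map_def by blast

lemma p_id: "i \<in> I \<Longrightarrow> x \<in> topspace (X i) \<Longrightarrow> p i i x = x"
  using sys by (simp add: projective_system_def)

lemma p_comp: "(i, j) \<in> r \<Longrightarrow> (j, k) \<in> r \<Longrightarrow> x \<in> topspace (X k) \<Longrightarrow> p i j (p j k x) = p i k x"
  using sys unfolding projective_system_def by blast

lemma topspace_Xlim:
  "x \<in> topspace Xlim \<longleftrightarrow>
     x \<in> extensional I \<and> (\<forall>i\<in>I. x i \<in> topspace (X i)) \<and> (\<forall>i j. (i, j) \<in> r \<longrightarrow> p i j (x j) = x i)"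
  by (auto simp: projective_limit_def PiE_iff)

lemma proj_in: "i \<in> I \<Longrightarrow> x \<in> topspace Xlim \<Longrightarrow> x i \<in> topspace (X i)"
  and p_proj: "(i, j) \<in> r \<Longrightarrow> x \<in> topspace Xlim \<Longrightarrow> p i j (x j) = x i"
  by (auto simp: topspace_Xlim)

lemma proj_cont: "i \<in> I \<Longrightarrow> continuous_map Xlim (X i) (\<lambda>x. x i)"
  unfolding projective_limit_def
  by (intro continuous_map_from_subtopology continuous_map_product_projection)

abbreviation pre :: "'i \<Rightarrow> 'a set \<Rightarrow> ('i \<Rightarrow> 'a) set" where
  "pre k U \<equiv> {x \<in> topspace Xlim. x k \<in> U}"

abbreviation pull :: "'i \<Rightarrow> 'i \<Rightarrow> 'a set \<Rightarrow> 'a set" where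
  "pull k m U \<equiv> {x \<in> topspace (X m). p k m x \<in> U}"

lemma open_pre: "k \<in> I \<Longrightarrow> openin (X k) U \<Longrightarrow> openin Xlim (pre k U)"
  using openin_continuous_map_preimage[OF proj_cont] .

lemma open_pull: "(k, m) \<in> r \<Longrightarrow> openin (X k) U \<Longrightarrow> openin (X m) (pull k m U)"
  using openin_continuous_map_preimage[OF p_cont] .

lemma pre_pull: "(k, m) \<in> r \<Longrightarrow> pre m (pull k m U) = pre k U"
  using p_proj proj_in r_in by auto

lemma pull_pull:
  assumes "(k, l) \<in> r" "(l, m) \<in> r"
  shows "pull l m (pull k l U) = pull k m U"
  using p_comp[OF assms] p_in[OF assms(2)] by auto

text \<open>A basic open box restricts finitely many coordinates only, and these are all determined by one
  coordinate whose index is above theirs.\<close>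

lemma Xlim_basis:
  assumes U: "openin Xlim U" and x: "x \<in> U"
  shows "\<exists>k\<in>I. \<exists>V. openin (X k) V \<and> x k \<in> V \<and> pre k V \<subseteq> U"
proof -
  have xT: "x \<in> topspace Xlim" using U x openin_subset by blast
  let ?S = "{x. \<forall>i j. (i, j) \<in> r \<longrightarrow> p i j (x j) = x i}"
  obtain T where T: "openin (product_topology X I) T" "U = T \<inter> ?S"
    using U unfolding projective_limit_def openin_subtopology by blast
  have "x \<in> T" using x T by simp
  from product_topology_open_contains_basis[OF T(1) this] obtain B where B: "x \<in> Pi\<^sub>E I B"
    "\<forall>i. openin (X i) (B i)" "finite {i. B i \<noteq> topspace (X i)}" "Pi\<^sub>E I B \<subseteq> T" by blast
  let ?J = "{i \<in> I. B i \<noteq> topspace (X i)}"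
  have J: "finite ?J" using B(3) by (rule rev_finite_subset) auto
  then obtain k where k: "k \<in> I" "\<forall>j\<in>?J. (j, k) \<in> r" using r_upper_finite[of ?J] by auto
  let ?V = "(\<Inter>j\<in>?J. pull j k (B j)) \<inter> topspace (X k)"
  have "openin (X k) ?V" using J k B(2) by (intro openin_INT open_pull) auto
  moreover have "x k \<in> ?V"
    using k B(1) p_proj[OF _ xT] proj_in[OF k(1) xT] by (auto simp: PiE_iff)
  moreover have "pre k ?V \<subseteq> U"
  proof
    fix y assume y: "y \<in> pre k ?V"
    then have yT: "y \<in> topspace Xlim" by simp
    have "y i \<in> B i" if i: "i \<in> I" for i
    proof (cases "B i = topspace (X i)")
      case True then show ?thesis using proj_in[OF i yT] by simp
    next
      case False
      then have "i \<in> ?J" using i by simp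
      then have "p i k (y k) \<in> B i" "(i, k) \<in> r" using y k by auto
      then show ?thesis using p_proj[OF _ yT] by simp
    qed
    then have "y \<in> Pi\<^sub>E I B" using yT by (auto simp: topspace_Xlim PiE_iff)
    then show "y \<in> U" using B(4) T(2) yT by (auto simp: topspace_Xlim)
  qed
  ultimately show ?thesis using k(1) by blast
qed

text \<open>The greatest limits of the coordinates are compatible. That \<open>p k l\<close> maps the greatest limit \<open>y l\<close> to a
  point below \<open>y k\<close> is continuity. Conversely, \<open>y k\<close> is below the image of some limit of \<open>f l\<close>, because
  limits lift along proper maps, and that limit is below \<open>y l\<close>. The compact set \<open>Q\<close> serves to make all the
  coordinates convergent.\<close>

lemma point_ultralimit:
  fixes f :: "'i \<Rightarrow> 'g \<Rightarrow> 'a"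
  assumes G: "ultrafilter_on UNIV G"
    and f: "\<And>k. k \<in> I \<Longrightarrow> \<forall>\<^sub>F g in G. f k g \<in> topspace (X k)"
    and comp: "\<And>k l. (k, l) \<in> r \<Longrightarrow> \<forall>\<^sub>F g in G. f k g = p k l (f l g)"
    and i: "i \<in> I" and Q: "compactin (X i) Q" "saturatedin (X i) Q" "\<forall>\<^sub>F g in G. f i g \<in> Q"
  shows "\<exists>y\<in>topspace Xlim. y i \<in> Q \<and> (\<forall>k\<in>I. limitin (X k) (f k) (y k) G)"
proof -
  have lim_p: "limitin (X k) (f k) (p k l x) G" if kl: "(k, l) \<in> r" and x: "limitin (X l) (f l) x G" for k l x
  proof (rule limitin_transform_eventually)
    show "limitin (X k) (p k l \<circ> f l) (p k l x) G" by (rule continuous_map_limit[OF p_cont[OF kl] x])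
    show "\<forall>\<^sub>F g in G. (p k l \<circ> f l) g = f k g" using comp[OF kl] by eventually_elim simp
  qed
  have lift: "\<exists>x. limitin (X l) (f l) x G \<and> spec_le (X k) y (p k l x)"
    if kl: "(k, l) \<in> r" and y: "limitin (X k) (f k) y G" for k l y
  proof (rule proper_lift_limit[OF proper[OF kl] G f[OF r_in(2)[OF kl]]])
    show "limitin (X k) (\<lambda>g. p k l (f l g)) y G"
      by (rule limitin_transform_eventually[OF comp[OF kl] y])
  qed
  obtain q where q: "q \<in> Q" "limitin (X i) (f i) q G" using limit_in_compact[OF G Q(1,3)] by blast
  have "\<exists>x. greatest_limit (X k) (f k) x G" if k: "k \<in> I" for k
  proof -
    obtain l where l: "l \<in> I" "(i, l) \<in> r" "(k, l) \<in> r" using r_upper[OF i k] by blast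
    obtain x where "limitin (X l) (f l) x G" using lift[OF l(2) q(2)] by blast
    from lim_p[OF l(3) this] show ?thesis by (rule greatest_limit_exists[OF sober[OF k] G f[OF k]])
  qed
  then obtain y where y: "\<And>k. k \<in> I \<Longrightarrow> greatest_limit (X k) (f k) (y k) G" by metis
  have lim: "limitin (X k) (f k) (y k) G" if "k \<in> I" for k
    using y[OF that] by (simp add: greatest_limit_def)
  have great: "spec_le (X k) z (y k)" if "k \<in> I" "limitin (X k) (f k) z G" for k z
    using y[OF that(1)] that(2) by (simp add: greatest_limit_def)
  have compat: "p k l (y l) = y k" if kl: "(k, l) \<in> r" for k l
  proof (rule locally_strongly_sober_T0[OF sober[OF r_in(1)[OF kl]]])
    show "spec_le (X k) (p k l (y l)) (y k)"
      by (rule great[OF r_in(1)[OF kl] lim_p[OF kl lim[OF r_in(2)[OF kl]]]])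
    obtain x where x: "limitin (X l) (f l) x G" "spec_le (X k) (y k) (p k l x)"
      using lift[OF kl lim[OF r_in(1)[OF kl]]] by blast
    show "spec_le (X k) (y k) (p k l (y l))"
      by (rule spec_le_trans[OF x(2) spec_le_continuous[OF p_cont[OF kl] great[OF r_in(2)[OF kl] x(1)]]])
  qed
  let ?y = "\<lambda>k\<in>I. y k"
  have "?y \<in> topspace Xlim"
    using lim compat r_in by (auto simp: topspace_Xlim limitin_def)
  moreover have "?y i \<in> Q"
    using great[OF i q(2)] q(1) Q(2) i by (auto simp: saturatedin_def)
  moreover have "\<forall>k\<in>I. limitin (X k) (f k) (?y k) G" using lim by simp
  ultimately show ?thesis by blast
qed

text \<open>A pair \<open>(k, U)\<close> stands for the open subset \<open>pre k U\<close> of the limit. The pairs form a directed, cofinal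
  family for the preordering in which \<open>(k, U)\<close> is below \<open>(m, W)\<close> if \<open>W\<close> contains the pullback of \<open>U\<close> at the
  later stage \<open>m\<close>, a condition that is stronger than inclusion of the corresponding subsets of the limit.\<close>

definition open_family :: "('i \<times> 'a set) set \<Rightarrow> bool" where
  "open_family \<O> \<longleftrightarrow>
     (\<forall>k U. (k, U) \<in> \<O> \<longrightarrow> k \<in> I \<and> openin (X k) U) \<and>
     (\<forall>k\<in>I. \<exists>m U. (m, U) \<in> \<O> \<and> (k, m) \<in> r) \<and>
     (\<forall>k U l V. (k, U) \<in> \<O> \<longrightarrow> (l, V) \<in> \<O> \<longrightarrow>
        (\<exists>m W. (m, W) \<in> \<O> \<and> (k, m) \<in> r \<and> (l, m) \<in> r \<and> pull k m U \<subseteq> W \<and> pull l m V \<subseteq> W))"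

text \<open>A covering that holds in the limit already holds at some stage. If every stage had an uncovered point,
  these points would give compatible nets, and their limit in the projective limit would be an uncovered
  point of \<open>pre i Q\<close>.\<close>

lemma compact_cover:
  assumes O: "open_family \<O>" and i: "i \<in> I" and Q: "compactin (X i) Q" "saturatedin (X i) Q"
    and cover: "pre i Q \<subseteq> (\<Union>(k, U)\<in>\<O>. pre k U)"
  shows "\<exists>(m, U)\<in>\<O>. (i, m) \<in> r \<and> pull i m Q \<subseteq> U"
proof (rule ccontr)
  assume n: "\<not> ?thesis"
  \<comment> \<open>An element of \<open>S (k, U)\<close> is a member of the family beyond \<open>(k, U)\<close> with a point over \<open>Q\<close> that it misses.\<close>
  define S where "S = (\<lambda>(k, U). {(m, V, x). (m, V) \<in> \<O> \<and> (i, m) \<in> r \<and> (k, m) \<in> r \<and> pull k m U \<subseteq> V \<and>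
      x \<in> topspace (X m) \<and> p i m x \<in> Q \<and> x \<notin> V})"
  have op: "k \<in> I" "openin (X k) U" if "(k, U) \<in> \<O>" for k U
    using O that by (simp_all add: open_family_def)
  have cof: "\<exists>m U. (m, U) \<in> \<O> \<and> (k, m) \<in> r" if "k \<in> I" for k
    using O that by (simp add: open_family_def)
  have dir: "\<exists>m W. (m, W) \<in> \<O> \<and> (k, m) \<in> r \<and> (l, m) \<in> r \<and> pull k m U \<subseteq> W \<and> pull l m V \<subseteq> W"
    if "(k, U) \<in> \<O>" "(l, V) \<in> \<O>" for k U l V
    using O that by (simp add: open_family_def)
  have S_mono: "S (m, W) \<subseteq> S (k, U)" if km: "(k, m) \<in> r" "pull k m U \<subseteq> W" for k m U W
  proof -
    have "pull k l U \<subseteq> V" if "(m, l) \<in> r" "pull m l W \<subseteq> V" for l V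
      using pull_pull[OF km(1) that(1), of U] km(2) that(2) by blast
    moreover have "(k, l) \<in> r" if "(m, l) \<in> r" for l using r_trans[OF km(1) that] .
    ultimately show ?thesis unfolding S_def by auto
  qed
  obtain m0 U0 where m0: "(m0, U0) \<in> \<O>" "(i, m0) \<in> r" using cof[OF i] by blast
  have ne: "S a \<noteq> {}" if "a \<in> \<O>" for a
  proof -
    obtain k U where a: "a = (k, U)" by (cases a)
    then obtain m W where m: "(m, W) \<in> \<O>" "(k, m) \<in> r" "(m0, m) \<in> r" "pull k m U \<subseteq> W"
      using dir[OF _ m0(1), of k U] \<open>a \<in> \<O>\<close> by blast
    have im: "(i, m) \<in> r" using r_trans[OF m0(2) m(3)] .
    then obtain x where "x \<in> pull i m Q" "x \<notin> W" using n m(1) by blast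
    then have "(m, W, x) \<in> S a" using m im by (simp add: S_def a)
    then show ?thesis by blast
  qed
  have S_dir: "\<exists>c\<in>\<O>. S c \<subseteq> S a \<inter> S b" if ab: "a \<in> \<O>" "b \<in> \<O>" for a b
  proof -
    obtain k U l V where kl: "a = (k, U)" "b = (l, V)" by (cases a, cases b)
    then obtain m W where m: "(m, W) \<in> \<O>" "(k, m) \<in> r" "(l, m) \<in> r" "pull k m U \<subseteq> W" "pull l m V \<subseteq> W"
      using dir[of k U l V] ab by blast
    have "S (m, W) \<subseteq> S a" "S (m, W) \<subseteq> S b" using S_mono m kl by blast+
    with m(1) show ?thesis by blast
  qed
  have One: "\<O> \<noteq> {}" using m0 by blast
  obtain G where G: "ultrafilter_on UNIV G" and GS: "\<And>a. a \<in> \<O> \<Longrightarrow> \<forall>\<^sub>F g in G. g \<in> S a"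
    by (rule ultrafilter_of_base[of \<O> S, OF One ne S_dir]) blast+
  define f where "f = (\<lambda>k (m, V::'a set, x). p k m x)"
  have fin: "\<forall>\<^sub>F (m, V, x) in G. (k, m) \<in> r \<and> x \<in> topspace (X m)" if k: "k \<in> I" for k
  proof -
    obtain m W where m: "(m, W) \<in> \<O>" "(k, m) \<in> r" using cof[OF k] by blast
    show ?thesis
      by (rule eventually_mono[OF GS[OF m(1)]]) (auto simp: S_def intro: r_trans[OF m(2)])
  qed
  have "\<exists>y\<in>topspace Xlim. y i \<in> Q \<and> (\<forall>k\<in>I. limitin (X k) (f k) (y k) G)"
  proof (rule point_ultralimit[OF G _ _ i Q])
    show "\<forall>\<^sub>F g in G. f k g \<in> topspace (X k)" if "k \<in> I" for k
      by (rule eventually_mono[OF fin[OF that]]) (auto simp: f_def intro: p_in)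
    show "\<forall>\<^sub>F g in G. f k g = p k l (f l g)" if kl: "(k, l) \<in> r" for k l
      by (rule eventually_mono[OF fin[OF r_in(2)[OF kl]]]) (auto simp: f_def p_comp[OF kl])
    show "\<forall>\<^sub>F g in G. f i g \<in> Q"
      by (rule eventually_mono[OF GS[OF m0(1)]]) (auto simp: f_def S_def)
  qed
  then obtain y where y: "y \<in> topspace Xlim" "y i \<in> Q" "\<forall>k\<in>I. limitin (X k) (f k) (y k) G" by blast
  then obtain k U where kU: "(k, U) \<in> \<O>" "y k \<in> U" using cover by blast
  have "\<forall>\<^sub>F g in G. f k g \<in> U" using y(3) op[OF kU(1)] kU(2) by (auto simp: limitin_def)
  with GS[OF kU(1)] have "\<forall>\<^sub>F g in G. False"
    by eventually_elim (auto simp: S_def f_def)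
  then show False using G by (simp add: ultrafilter_on_def)
qed

lemma open_family_pull:
  assumes i: "i \<in> I" and U: "openin (X i) U"
  shows "open_family {(m, pull i m U) |m. (i, m) \<in> r}"
  unfolding open_family_def
proof (intro conjI ballI allI impI)
  let ?O = "{(m, pull i m U) |m. (i, m) \<in> r}"
  show "k \<in> I" "openin (X k) V" if "(k, V) \<in> ?O" for k V
    using that r_in open_pull[OF _ U] by auto
  show "\<exists>m V. (m, V) \<in> ?O \<and> (k, m) \<in> r" if "k \<in> I" for k
    using r_upper[OF i that] by blast
  fix k A l B assume "(k, A) \<in> ?O" "(l, B) \<in> ?O"
  then have kl: "(i, k) \<in> r" "(i, l) \<in> r" "A = pull i k U" "B = pull i l U" by auto
  obtain m where m: "(k, m) \<in> r" "(l, m) \<in> r" using r_upper[of k l] kl r_in by blast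
  have "pull k m A = pull i m U" "pull l m B = pull i m U"
    unfolding kl(3,4) by (rule pull_pull[OF kl(1) m(1)], rule pull_pull[OF kl(2) m(2)])
  moreover have "(m, pull i m U) \<in> ?O" using r_trans[OF kl(1) m(1)] by blast
  ultimately show "\<exists>m W. (m, W) \<in> ?O \<and> (k, m) \<in> r \<and> (l, m) \<in> r \<and> pull k m A \<subseteq> W \<and> pull l m B \<subseteq> W"
    using m by blast
qed

lemma open_family_below:
  assumes D: "directed_opens Xlim \<D>"
  shows "open_family {(m, U). m \<in> I \<and> openin (X m) U \<and> (\<exists>W\<in>\<D>. pre m U \<subseteq> W)}"
    and "\<Union>\<D> \<subseteq> (\<Union>(k, U)\<in>{(m, U). m \<in> I \<and> openin (X m) U \<and> (\<exists>W\<in>\<D>. pre m U \<subseteq> W)}. pre k U)"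
proof -
  let ?O = "{(m, U). m \<in> I \<and> openin (X m) U \<and> (\<exists>W\<in>\<D>. pre m U \<subseteq> W)}"
  show "open_family ?O"
    unfolding open_family_def
  proof (intro conjI ballI allI impI)
    show "k \<in> I" "openin (X k) U" if "(k, U) \<in> ?O" for k U using that by auto
    show "\<exists>m U. (m, U) \<in> ?O \<and> (k, m) \<in> r" if k: "k \<in> I" for k
    proof -
      obtain W where "W \<in> \<D>" using D by (auto simp: directed_opens_def)
      with k have "(k, {}) \<in> ?O" by auto
      with r_refl[OF k] show ?thesis by blast
    qed
    fix k U l V assume "(k, U) \<in> ?O" "(l, V) \<in> ?O"
    then obtain A B where k: "k \<in> I" "openin (X k) U" "A \<in> \<D>" "pre k U \<subseteq> A"
      and l: "l \<in> I" "openin (X l) V" "B \<in> \<D>" "pre l V \<subseteq> B" by auto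
    obtain C where C: "C \<in> \<D>" "A \<subseteq> C" "B \<subseteq> C" using D k(3) l(3) unfolding directed_opens_def by meson
    obtain m where m: "m \<in> I" "(k, m) \<in> r" "(l, m) \<in> r" using r_upper[OF k(1) l(1)] by blast
    let ?W = "pull k m U \<union> pull l m V"
    have o: "openin (X m) ?W" using open_pull[OF m(2) k(2)] open_pull[OF m(3) l(2)] by blast
    have "pre m ?W = pre k U \<union> pre l V"
      using pre_pull[OF m(2), of U] pre_pull[OF m(3), of V] by auto
    then have "pre m ?W \<subseteq> C" using C k(4) l(4) by auto
    with o have "(m, ?W) \<in> ?O" using m(1) C(1) by auto
    then show "\<exists>m W. (m, W) \<in> ?O \<and> (k, m) \<in> r \<and> (l, m) \<in> r \<and> pull k m U \<subseteq> W \<and> pull l m V \<subseteq> W"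
      using m(2,3) by blast
  qed
  show "\<Union>\<D> \<subseteq> (\<Union>(k, U)\<in>?O. pre k U)"
  proof
    fix x assume "x \<in> \<Union>\<D>"
    then obtain W where W: "W \<in> \<D>" "x \<in> W" by blast
    then have oW: "openin Xlim W" using D by (auto simp: directed_opens_def)
    obtain k U where "k \<in> I" "openin (X k) U" "x k \<in> U" "pre k U \<subseteq> W" using Xlim_basis[OF oW W(2)] by blast
    moreover have "x \<in> topspace Xlim" using openin_subset[OF oW] W by blast
    ultimately show "x \<in> (\<Union>(k, U)\<in>?O. pre k U)" using W(1) by blast
  qed
qed

end

section \<open>Projective limits of continuous valuations\<close>

context proper_system
begin

text \<open>The largest open subset of \<open>X k\<close> whose preimage under the projection lies in \<open>U\<close>.\<close>

definition trace_open :: "'i \<Rightarrow> ('i \<Rightarrow> 'a) set \<Rightarrow> 'a set" where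
  "trace_open k U = \<Union>{V. openin (X k) V \<and> pre k V \<subseteq> U}"

lemma open_trace: "openin (X k) (trace_open k U)"
  unfolding trace_open_def by (rule openin_Union) simp

lemma pre_trace: "pre k (trace_open k U) \<subseteq> U"
  by (auto simp: trace_open_def)

lemma trace_greatest: "openin (X k) V \<Longrightarrow> pre k V \<subseteq> U \<Longrightarrow> V \<subseteq> trace_open k U"
  unfolding trace_open_def by blast

lemma trace_mono: "U \<subseteq> U' \<Longrightarrow> trace_open k U \<subseteq> trace_open k U'"
  unfolding trace_open_def by blast

lemma pull_trace: "(k, l) \<in> r \<Longrightarrow> pull k l (trace_open k U) \<subseteq> trace_open l U"
  using pre_pull[of k l "trace_open k U"] pre_trace[of k U]
  by (intro trace_greatest open_pull open_trace) auto

lemma directed_traces: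
  "directed_opens Xlim ((\<lambda>k. pre k (trace_open k U)) ` I)"
  unfolding directed_opens_def
proof (intro conjI ballI)
  show "(\<lambda>k. pre k (trace_open k U)) ` I \<noteq> {}" using sys by (simp add: projective_system_def)
  show "openin Xlim A" if "A \<in> (\<lambda>k. pre k (trace_open k U)) ` I" for A
    using that open_pre[OF _ open_trace] by auto
  fix A B assume "A \<in> (\<lambda>k. pre k (trace_open k U)) ` I" "B \<in> (\<lambda>k. pre k (trace_open k U)) ` I"
  then obtain k l where kl: "k \<in> I" "l \<in> I" "A = pre k (trace_open k U)" "B = pre l (trace_open l U)" by auto
  obtain m where m: "m \<in> I" "(k, m) \<in> r" "(l, m) \<in> r" using r_upper[OF kl(1,2)] by blast
  have "A \<subseteq> pre m (trace_open m U)" "B \<subseteq> pre m (trace_open m U)"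
    using kl pre_pull[OF m(2), of "trace_open k U"] pre_pull[OF m(3), of "trace_open l U"]
      pull_trace[OF m(2), of U] pull_trace[OF m(3), of U] by blast+
  with m(1) show "\<exists>W\<in>(\<lambda>k. pre k (trace_open k U)) ` I. A \<subseteq> W \<and> B \<subseteq> W" by blast
qed

lemma Union_traces: "openin Xlim U \<Longrightarrow> \<Union>((\<lambda>k. pre k (trace_open k U)) ` I) = U"
proof
  assume U: "openin Xlim U"
  show "U \<subseteq> \<Union>((\<lambda>k. pre k (trace_open k U)) ` I)"
  proof
    fix x assume x: "x \<in> U"
    obtain k V where k: "k \<in> I" "openin (X k) V" "x k \<in> V" "pre k V \<subseteq> U" using Xlim_basis[OF U x] by blast
    then have "V \<subseteq> trace_open k U" by (intro trace_greatest)
    moreover have "x \<in> topspace Xlim" using U x openin_subset by blast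
    ultimately show "x \<in> \<Union>((\<lambda>k. pre k (trace_open k U)) ` I)" using k by blast
  qed
qed (use pre_trace in blast)

definition compatible_valuations :: "('i \<Rightarrow> 'a valuation) \<Rightarrow> bool" where
  "compatible_valuations \<nu> \<longleftrightarrow>
     (\<forall>k\<in>I. continuous_valuation (X k) (\<nu> k)) \<and>
     (\<forall>k l. (k, l) \<in> r \<longrightarrow> V_map (X l) (X k) (p k l) (\<nu> l) = \<nu> k)"

lemma compatible_valuations_pull:
  assumes "compatible_valuations \<nu>" "(k, l) \<in> r" "openin (X k) U"
  shows "\<nu> l (pull k l U) = \<nu> k U"
  using assms V_map_apply[OF assms(3), of "X l" "p k l" "\<nu> l"] by (simp add: compatible_valuations_def)

text \<open>By tightness the value of \<open>\<nu> i\<close> at \<open>V\<close> exceeds \<open>a\<close> because of a compact saturated subset \<open>Q\<close>. At some stage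
  \<open>m\<close> the preimage of \<open>Q\<close> is inside a single member \<open>U\<close> of the family, and by properness \<open>U\<close> contains the
  preimage of an open neighborhood of \<open>Q\<close>.\<close>

lemma compatible_valuations_cover:
  assumes \<nu>: "compatible_valuations \<nu>" and O: "open_family \<O>" and i: "i \<in> I"
    and V: "openin (X i) V" "a < \<nu> i V" "pre i V \<subseteq> (\<Union>(k, U)\<in>\<O>. pre k U)"
  shows "\<exists>m U. (m, U) \<in> \<O> \<and> a < \<nu> m U"
proof -
  have cv: "continuous_valuation (X k) (\<nu> k)" if "k \<in> I" for k
    using \<nu> that by (simp add: compatible_valuations_def)
  obtain Q where Q: "compactin (X i) Q" "saturatedin (X i) Q" "Q \<subseteq> V"
    and a: "\<And>W. openin (X i) W \<Longrightarrow> Q \<subseteq> W \<Longrightarrow> a < \<nu> i W"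
    by (rule continuous_valuation_tight[OF consonant[OF i] cv[OF i] V(1,2)]) blast
  have "pre i Q \<subseteq> (\<Union>(k, U)\<in>\<O>. pre k U)" using Q(3) V(3) by blast
  from compact_cover[OF O i Q(1,2) this] obtain m U where m: "(m, U) \<in> \<O>" "(i, m) \<in> r" "pull i m Q \<subseteq> U"
    by auto
  have U: "openin (X m) U" using O m(1) by (simp add: open_family_def)
  obtain W where W: "openin (X i) W" "Q \<subseteq> W" "pull i m W \<subseteq> U"
    by (rule proper_open_nbhd[OF proper[OF m(2)] Q(2) U m(3)])
  have "a < \<nu> i W" by (rule a[OF W(1,2)])
  also have "\<dots> = \<nu> m (pull i m W)" by (rule compatible_valuations_pull[OF \<nu> m(2) W(1), symmetric])
  also have "\<dots> \<le> \<nu> m U"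
    by (rule continuous_valuation_mono[OF cv[OF r_in(2)[OF m(2)]] open_pull[OF m(2) W(1)] U W(3)])
  finally show ?thesis using m(1) by blast
qed

text \<open>The value at an open set \<open>U\<close> of the limit has to be the supremum of the values of \<open>\<nu> k\<close> at the open sets
  approximating \<open>U\<close> at stage \<open>k\<close>. Scott-continuity, modularity and the fact that the projections give back \<open>\<nu>\<close>
  all amount to this: covering an open set of some stage \<open>k\<close> by a directed family of open sets coming from
  other stages does not lose mass, which is the previous lemma.\<close>

theorem valuation_limit_exists:
  assumes \<nu>: "compatible_valuations \<nu>"
  shows "\<exists>z. continuous_valuation Xlim z \<and> (\<forall>k\<in>I. V_map Xlim (X k) (\<lambda>x. x k) z = \<nu> k)"
proof -
  have cv: "continuous_valuation (X k) (\<nu> k)" if "k \<in> I" for k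
    using \<nu> that by (simp add: compatible_valuations_def)
  have mono: "\<nu> k U \<le> \<nu> k V" if "k \<in> I" "openin (X k) U" "openin (X k) V" "U \<subseteq> V" for k U V
    using continuous_valuation_mono[OF cv[OF that(1)] that(2-4)] .
  have Ine: "I \<noteq> {}" using sys by (simp add: projective_system_def)
  define z where "z = (\<lambda>U\<in>{U. openin Xlim U}. SUP k\<in>I. \<nu> k (trace_open k U))"
  have z: "z U = (SUP k\<in>I. \<nu> k (trace_open k U))" if "openin Xlim U" for U
    using that by (simp add: z_def)
  have z_upper: "\<nu> k V \<le> z U" if "k \<in> I" "openin Xlim U" "openin (X k) V" "pre k V \<subseteq> U" for k V U
    unfolding z[OF that(2)] using that
    by (intro SUP_upper2[of k] mono open_trace trace_greatest)
  have z_pre: "z (pre i V) = \<nu> i V" if i: "i \<in> I" and V: "openin (X i) V" for i V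
  proof (rule antisym)
    show "\<nu> i V \<le> z (pre i V)" by (rule z_upper[OF i open_pre[OF i V] V]) simp
    show "z (pre i V) \<le> \<nu> i V"
      unfolding z[OF open_pre[OF i V]]
    proof (rule SUP_least, rule ccontr)
      fix k assume k: "k \<in> I" and n: "\<not> \<nu> k (trace_open k (pre i V)) \<le> \<nu> i V"
      \<comment> \<open>\<open>\<nu>\<close> has the same value at all pullbacks of \<open>V\<close>, and these represent \<open>pre i V\<close> at the later stages.\<close>
      have "pre k (trace_open k (pre i V)) \<subseteq> (\<Union>(m, U)\<in>{(m, pull i m V) |m. (i, m) \<in> r}. pre m U)"
      proof -
        have "pre i V = pre i (pull i i V)" using pre_pull[OF r_refl[OF i]] by simp
        moreover have "(i, pull i i V) \<in> {(m, pull i m V) |m. (i, m) \<in> r}" using r_refl[OF i] by blast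
        ultimately show ?thesis using pre_trace[of k "pre i V"] by blast
      qed
      from compatible_valuations_cover[OF \<nu> open_family_pull[OF i V] k open_trace _ this, of "\<nu> i V"]
      obtain m where "(i, m) \<in> r" "\<nu> i V < \<nu> m (pull i m V)" using n by (auto simp: not_le)
      then show False using compatible_valuations_pull[OF \<nu> _ V] by simp
    qed
  qed
  have z_cover: "\<exists>W\<in>\<D>. \<exists>m\<in>I. \<exists>U. openin (X m) U \<and> pre m U \<subseteq> W \<and> a < \<nu> m U"
    if D: "directed_opens Xlim \<D>" and k: "k \<in> I" and V: "openin (X k) V" "pre k V \<subseteq> \<Union>\<D>" and a: "a < \<nu> k V"
    for \<D> k V a
    using compatible_valuations_cover[OF \<nu> open_family_below(1)[OF D] k V(1) a
        order_trans[OF V(2) open_family_below(2)[OF D]]] by auto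
  have z_mono: "z U \<le> z V" if "openin Xlim U" "openin Xlim V" "U \<subseteq> V" for U V
    unfolding z[OF that(1)] using that pre_trace by (intro SUP_least z_upper open_trace) auto
  have "continuous_valuation Xlim z"
    unfolding continuous_valuation_def scott_continuous_def
  proof (intro conjI allI impI; (elim conjE)?)
    show "z \<in> extensional {U. openin Xlim U}" by (simp add: z_def)
    show "z U \<le> z V" if "openin Xlim U" "openin Xlim V" "U \<subseteq> V" for U V using z_mono[OF that] .
    obtain i where i: "i \<in> I" using Ine by blast
    show "z {} = 0" using z_pre[OF i, of "{}"] continuous_valuation_empty[OF cv[OF i]] by simp
    show "z (\<Union>\<D>) = (SUP U\<in>\<D>. z U)" if D: "directed_opens Xlim \<D>" for \<D>
    proof (rule antisym)
      have op: "openin Xlim U" if "U \<in> \<D>" for U using D that by (auto simp: directed_opens_def)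
      then have opU: "openin Xlim (\<Union>\<D>)" by blast
      show "(SUP U\<in>\<D>. z U) \<le> z (\<Union>\<D>)" using op opU by (intro SUP_least z_mono) auto
      show "z (\<Union>\<D>) \<le> (SUP U\<in>\<D>. z U)"
        unfolding z[OF opU]
      proof (rule SUP_least, rule ccontr)
        fix k assume k: "k \<in> I" and n: "\<not> \<nu> k (trace_open k (\<Union>\<D>)) \<le> (SUP U\<in>\<D>. z U)"
        then have "(SUP U\<in>\<D>. z U) < \<nu> k (trace_open k (\<Union>\<D>))" by simp
        from z_cover[OF D k open_trace pre_trace this] obtain W m U
          where W: "W \<in> \<D>" "m \<in> I" "openin (X m) U" "pre m U \<subseteq> W" "(SUP U\<in>\<D>. z U) < \<nu> m U" by blast
        have "\<nu> m U \<le> z W" by (rule z_upper[OF W(2) op[OF W(1)] W(3,4)])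
        also have "\<dots> \<le> (SUP U\<in>\<D>. z U)" using W(1) by (rule SUP_upper)
        finally show False using W(5) by simp
      qed
    qed
    fix U V assume U: "openin Xlim U" and V: "openin Xlim V"
    let ?t = "\<lambda>k. trace_open k U \<union> trace_open k V" and ?s = "\<lambda>k. trace_open k U \<inter> trace_open k V"
    have ot: "openin (X k) (?t k)" and os: "openin (X k) (?s k)" for k
      using open_trace by auto
    have UV: "openin Xlim (U \<union> V)" "openin Xlim (U \<inter> V)" using U V by auto
    have t_up: "\<nu> k (trace_open k W) \<le> \<nu> l (trace_open l W)" if "(k, l) \<in> r" for k l W
      using compatible_valuations_pull[OF \<nu> that open_trace, of W]
        mono[OF r_in(2)[OF that] open_pull[OF that open_trace] open_trace pull_trace[OF that], of W] by simp
    show "z U + z V = z (U \<union> V) + z (U \<inter> V)"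
    proof (rule antisym)
      show "z U + z V \<le> z (U \<union> V) + z (U \<inter> V)"
        unfolding z[OF U] z[OF V]
      proof (rule SUP_add_SUP_le[OF Ine Ine])
        fix k l assume kl: "k \<in> I" "l \<in> I"
        obtain m where m: "m \<in> I" "(k, m) \<in> r" "(l, m) \<in> r" using r_upper[OF kl] by blast
        have "\<nu> k (trace_open k U) + \<nu> l (trace_open l V) \<le> \<nu> m (trace_open m U) + \<nu> m (trace_open m V)"
          by (intro add_mono t_up m)
        also have "\<dots> = \<nu> m (?t m) + \<nu> m (?s m)"
          by (rule continuous_valuation_modular[OF cv[OF m(1)] open_trace open_trace])
        also have "\<dots> \<le> z (U \<union> V) + z (U \<inter> V)"
          using pre_trace[of m U] pre_trace[of m V]
          by (intro add_mono z_upper m(1) UV ot os) auto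
        finally show "\<nu> k (trace_open k U) + \<nu> l (trace_open l V) \<le> z (U \<union> V) + z (U \<inter> V)" .
      qed
      have "z (U \<union> V) \<le> (SUP k\<in>I. \<nu> k (?t k))"
        unfolding z[OF UV(1)]
      proof (rule SUP_least, rule ccontr)
        fix k assume k: "k \<in> I" and n: "\<not> \<nu> k (trace_open k (U \<union> V)) \<le> (SUP k\<in>I. \<nu> k (?t k))"
        let ?D = "(\<lambda>k. pre k (?t k)) ` I"
        have D: "directed_opens Xlim ?D"
          unfolding directed_opens_def
        proof (intro conjI ballI)
          show "?D \<noteq> {}" using Ine by simp
          show "openin Xlim A" if "A \<in> ?D" for A using that open_pre[OF _ ot] by auto
          fix A B assume "A \<in> ?D" "B \<in> ?D"
          then obtain k l where kl: "k \<in> I" "l \<in> I" "A = pre k (?t k)" "B = pre l (?t l)" by auto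
          obtain m where m: "m \<in> I" "(k, m) \<in> r" "(l, m) \<in> r" using r_upper[OF kl(1,2)] by blast
          have "pull k m (?t k) \<subseteq> ?t m" "pull l m (?t l) \<subseteq> ?t m"
            using pull_trace[OF m(2), of U] pull_trace[OF m(2), of V]
              pull_trace[OF m(3), of U] pull_trace[OF m(3), of V] by auto
          then have "A \<subseteq> pre m (?t m)" "B \<subseteq> pre m (?t m)"
            unfolding kl(3,4) pre_pull[OF m(2), symmetric, of "?t k"] pre_pull[OF m(3), symmetric, of "?t l"]
            by auto
          with m(1) show "\<exists>W\<in>?D. A \<subseteq> W \<and> B \<subseteq> W" by blast
        qed
        have "U \<union> V \<subseteq> \<Union>?D" using Union_traces[OF U] Union_traces[OF V] by blast
        then have sub: "pre k (trace_open k (U \<union> V)) \<subseteq> \<Union>?D" using pre_trace[of k "U \<union> V"] by (rule order_trans[rotated])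
        have lt: "(SUP k\<in>I. \<nu> k (?t k)) < \<nu> k (trace_open k (U \<union> V))" using n by simp
        obtain W where WD: "W \<in> ?D" "\<exists>m\<in>I. \<exists>A. openin (X m) A \<and> pre m A \<subseteq> W \<and> (SUP k\<in>I. \<nu> k (?t k)) < \<nu> m A"
          using z_cover[OF D k open_trace sub lt] by (rule bexE)
        then obtain m A where W: "m \<in> I" "openin (X m) A" "pre m A \<subseteq> W" "(SUP k\<in>I. \<nu> k (?t k)) < \<nu> m A"
          by (elim bexE exE conjE)
        obtain l where l: "l \<in> I" "W = pre l (?t l)" using WD(1) by (rule imageE)
        have "\<nu> m A \<le> z (pre l (?t l))" using W(3) unfolding l(2) by (rule z_upper[OF W(1) open_pre[OF l(1) ot] W(2)])
        also have "\<dots> = \<nu> l (?t l)" by (rule z_pre[OF l(1) ot])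
        also have "\<dots> \<le> (SUP k\<in>I. \<nu> k (?t k))" using l(1) by (rule SUP_upper)
        finally show False using W(4) by simp
      qed
      then have "z (U \<union> V) + z (U \<inter> V) \<le> (SUP k\<in>I. \<nu> k (?t k)) + (SUP k\<in>I. \<nu> k (trace_open k (U \<inter> V)))"
        unfolding z[OF UV(2)] by (rule add_right_mono)
      also have "\<dots> \<le> z U + z V"
      proof (rule SUP_add_SUP_le[OF Ine Ine])
        fix k l assume kl: "k \<in> I" "l \<in> I"
        obtain m where m: "m \<in> I" "(k, m) \<in> r" "(l, m) \<in> r" using r_upper[OF kl] by blast
        have "\<nu> k (?t k) = \<nu> m (pull k m (?t k))" by (rule compatible_valuations_pull[OF \<nu> m(2) ot, symmetric])
        also have "\<dots> \<le> \<nu> m (?t m)"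
          using pull_trace[OF m(2), of U] pull_trace[OF m(2), of V]
          by (intro mono[OF m(1) open_pull[OF m(2) ot] ot]) auto
        finally have 1: "\<nu> k (?t k) \<le> \<nu> m (?t m)" .
        have "\<nu> l (trace_open l (U \<inter> V)) \<le> \<nu> m (trace_open m (U \<inter> V))" by (rule t_up[OF m(3)])
        also have "\<dots> \<le> \<nu> m (?s m)"
          by (rule mono[OF m(1) open_trace os]) (simp add: trace_mono)
        finally have "\<nu> k (?t k) + \<nu> l (trace_open l (U \<inter> V)) \<le> \<nu> m (?t m) + \<nu> m (?s m)"
          using 1 by (rule add_mono[rotated])
        also have "\<dots> = \<nu> m (trace_open m U) + \<nu> m (trace_open m V)"
          by (rule continuous_valuation_modular[OF cv[OF m(1)] open_trace open_trace, symmetric])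
        also have "\<dots> \<le> z U + z V"
          by (intro add_mono z_upper m(1) U V open_trace pre_trace)
        finally show "\<nu> k (?t k) + \<nu> l (trace_open l (U \<inter> V)) \<le> z U + z V" .
      qed
      finally show "z (U \<union> V) + z (U \<inter> V) \<le> z U + z V" .
    qed
  qed
  moreover have "V_map Xlim (X k) (\<lambda>x. x k) z = \<nu> k" if k: "k \<in> I" for k
  proof (rule extensionalityI[of _ "{U. openin (X k) U}"])
    fix V assume "V \<in> {U. openin (X k) U}"
    then show "V_map Xlim (X k) (\<lambda>x. x k) z V = \<nu> k V" by (simp add: V_map_apply z_pre[OF k])
  qed (use cv[OF k] V_map_extensional in \<open>auto simp: continuous_valuation_def\<close>)
  ultimately show ?thesis by blast
qed

abbreviation q :: "'i \<Rightarrow> ('i \<Rightarrow> 'a) valuation \<Rightarrow> 'a valuation" where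
  "q k \<equiv> V_map Xlim (X k) (\<lambda>x. x k)"

lemma q_in: "k \<in> I \<Longrightarrow> \<nu> \<in> topspace (V_space b Xlim) \<Longrightarrow> q k \<nu> \<in> topspace (V_space b (X k))"
  by (rule V_map_in_V_space[OF proj_cont])

lemma q_cont: "k \<in> I \<Longrightarrow> continuous_map (V_space b Xlim) (V_space b (X k)) (q k)"
  by (rule continuous_map_V_map[OF proj_cont])

lemma V_map_q: "(k, l) \<in> r \<Longrightarrow> V_map (X l) (X k) (p k l) (q l \<nu>) = q k \<nu>"
  by (rule V_map_compose[OF proj_cont[OF r_in(2)] p_cont p_proj])

lemma V_map_V_map_p:
  "(k, l) \<in> r \<Longrightarrow> (l, m) \<in> r \<Longrightarrow>
    V_map (X l) (X k) (p k l) (V_map (X m) (X l) (p l m) \<nu>) = V_map (X m) (X k) (p k m) \<nu>"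
  by (rule V_map_compose[OF p_cont p_cont p_comp])

text \<open>The greatest limits of the coordinates are regularizations of pointwise limits. Since regularization
  commutes with images along proper maps, they are compatible, and they come from a valuation on the limit.\<close>

theorem valuation_ultralimit:
  fixes f :: "'i \<Rightarrow> 'g \<Rightarrow> 'a valuation"
  assumes cpt: "\<And>k. b = Probability \<Longrightarrow> k \<in> I \<Longrightarrow> compact_space (X k)"
    and G: "ultrafilter_on UNIV G"
    and f: "\<And>k. k \<in> I \<Longrightarrow> \<forall>\<^sub>F g in G. f k g \<in> topspace (V_space b (X k))"
    and comp: "\<And>k l. (k, l) \<in> r \<Longrightarrow> \<forall>\<^sub>F g in G. f k g = V_map (X l) (X k) (p k l) (f l g)"
  shows "\<exists>z\<in>topspace (V_space b Xlim). \<forall>k\<in>I. greatest_limit (V_space b (X k)) (f k) (q k z) G"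
proof -
  define \<nu> where "\<nu> k = regularization (X k) (pointwise_limit G (f k))" for k
  have gl: "greatest_limit (V_space b (X k)) (f k) (\<nu> k) G" if k: "k \<in> I" for k
    unfolding \<nu>_def by (rule valuation_greatest_limit[OF sober[OF k] consonant[OF k] cpt[OF _ k] G f[OF k]])
  then have T: "\<nu> k \<in> topspace (V_space b (X k))" if "k \<in> I" for k
    using that by (auto simp: greatest_limit_def limitin_def)
  have "V_map (X l) (X k) (p k l) (\<nu> l) = \<nu> k" if kl: "(k, l) \<in> r" for k l
    unfolding \<nu>_def
  proof (rule V_map_regularization[OF proper[OF kl] G _ comp[OF kl]])
    show "\<forall>\<^sub>F g in G. continuous_valuation (X l) (f l g)"
      by (rule eventually_mono[OF f[OF r_in(2)[OF kl]]]) (simp add: topspace_V_space)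
  qed
  then have "compatible_valuations \<nu>"
    using T by (auto simp: compatible_valuations_def topspace_V_space)
  from valuation_limit_exists[OF this] obtain z where z: "continuous_valuation Xlim z" "\<And>k. k \<in> I \<Longrightarrow> q k z = \<nu> k"
    by blast
  obtain i where i: "i \<in> I" using sys by (auto simp: projective_system_def)
  have "z (topspace Xlim) = \<nu> i (topspace (X i))"
    using V_map_topspace[OF proj_cont[OF i], of z] z(2)[OF i] by simp
  then have "z \<in> topspace (V_space b Xlim)" using T[OF i] z(1) by (simp add: topspace_V_space)
  moreover have "\<forall>k\<in>I. greatest_limit (V_space b (X k)) (f k) (q k z) G" using z(2) gl by simp
  ultimately show ?thesis by blast
qed

lemma V_Xlim_basis:
  assumes U: "openin (V_space b Xlim) \<U>" and \<nu>: "\<nu> \<in> \<U>"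
  shows "\<exists>k\<in>I. \<exists>\<V>. openin (V_space b (X k)) \<V> \<and> q k \<nu> \<in> \<V> \<and>
    {\<mu> \<in> topspace (V_space b Xlim). q k \<mu> \<in> \<V>} \<subseteq> \<U>"
proof -
  have \<nu>T: "\<nu> \<in> topspace (V_space b Xlim)" using U \<nu> openin_subset by blast
  then have \<nu>c: "continuous_valuation Xlim \<nu>" by (simp add: topspace_V_space)
  obtain F where F: "finite F" "\<forall>(U, a)\<in>F. openin Xlim U \<and> a < \<nu> U"
    "\<forall>\<mu>\<in>topspace (V_space b Xlim). (\<forall>(U, a)\<in>F. a < \<mu> U) \<longrightarrow> \<mu> \<in> \<U>"
    using V_space_nbhd[OF U \<nu>] by blast
  have "\<forall>c\<in>F. \<exists>k. k \<in> I \<and> snd c < \<nu> (pre k (trace_open k (fst c)))"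
  proof
    fix c assume c: "c \<in> F"
    have o: "openin Xlim (fst c)" "snd c < \<nu> (fst c)" using F(2) c by auto
    have "\<nu> (fst c) = \<nu> (\<Union>((\<lambda>k. pre k (trace_open k (fst c))) ` I))" using Union_traces[OF o(1)] by simp
    also have "\<dots> = (SUP U\<in>(\<lambda>k. pre k (trace_open k (fst c))) ` I. \<nu> U)"
      by (rule continuous_valuation_Union[OF \<nu>c directed_traces])
    finally have "snd c < (SUP U\<in>(\<lambda>k. pre k (trace_open k (fst c))) ` I. \<nu> U)" using o(2) by simp
    then show "\<exists>k. k \<in> I \<and> snd c < \<nu> (pre k (trace_open k (fst c)))" unfolding less_SUP_iff by blast
  qed
  then obtain \<kappa> where "\<forall>c\<in>F. \<kappa> c \<in> I \<and> snd c < \<nu> (pre (\<kappa> c) (trace_open (\<kappa> c) (fst c)))"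
    unfolding bchoice_iff by (rule exE)
  then have \<kappa>: "\<kappa> c \<in> I" "snd c < \<nu> (pre (\<kappa> c) (trace_open (\<kappa> c) (fst c)))" if "c \<in> F" for c
    using that by auto
  have "finite (\<kappa> ` F)" "\<kappa> ` F \<subseteq> I" using F(1) \<kappa>(1) by auto
  then obtain k where k: "k \<in> I" "\<forall>j\<in>\<kappa> ` F. (j, k) \<in> r" using r_upper_finite by blast
  let ?V = "(\<Inter>c\<in>F. {\<mu> \<in> topspace (V_space b (X k)). snd c < \<mu> (trace_open k (fst c))}) \<inter> topspace (V_space b (X k))"
  have "openin (V_space b (X k)) ?V" by (intro openin_INT F(1) openin_V_space_gt open_trace)
  moreover have "q k \<nu> \<in> ?V"
  proof -
    have "snd c < q k \<nu> (trace_open k (fst c))" if c: "c \<in> F" for c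
    proof -
      have r: "(\<kappa> c, k) \<in> r" using k c by blast
      have "pre (\<kappa> c) (trace_open (\<kappa> c) (fst c)) \<subseteq> pre k (trace_open k (fst c))"
        using pre_pull[OF r, of "trace_open (\<kappa> c) (fst c)"] pull_trace[OF r, of "fst c"] by blast
      then have "\<nu> (pre (\<kappa> c) (trace_open (\<kappa> c) (fst c))) \<le> \<nu> (pre k (trace_open k (fst c)))"
        by (intro continuous_valuation_mono[OF \<nu>c] open_pre open_trace k(1) \<kappa>(1)[OF c])
      with \<kappa>(2)[OF c] show ?thesis by (simp add: V_map_apply[OF open_trace])
    qed
    then show ?thesis using q_in[OF k(1) \<nu>T] by auto
  qed
  moreover have "{\<mu> \<in> topspace (V_space b Xlim). q k \<mu> \<in> ?V} \<subseteq> \<U>"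
  proof
    fix \<mu> assume \<mu>: "\<mu> \<in> {\<mu> \<in> topspace (V_space b Xlim). q k \<mu> \<in> ?V}"
    then have \<mu>c: "continuous_valuation Xlim \<mu>" by (simp add: topspace_V_space)
    have "snd c < \<mu> (fst c)" if c: "c \<in> F" for c
    proof -
      have "snd c < q k \<mu> (trace_open k (fst c))" using \<mu> c by auto
      also have "\<dots> = \<mu> (pre k (trace_open k (fst c)))" by (rule V_map_apply[OF open_trace])
      also have "\<dots> \<le> \<mu> (fst c)"
        using F(2) c by (intro continuous_valuation_mono[OF \<mu>c] open_pre open_trace k(1) pre_trace) auto
      finally show ?thesis .
    qed
    then show "\<mu> \<in> \<U>" using F(3) \<mu> by (auto simp: case_prod_beta)
  qed
  ultimately show ?thesis using k(1) by blast
qed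

text \<open>Each point of \<open>L\<close> has a basic neighborhood inside \<open>\<U>\<close> that comes from some stage. Finitely many of them
  cover \<open>L\<close>, and they can be pulled back to a common stage.\<close>

lemma V_Xlim_compact_basis:
  assumes U: "openin (V_space b Xlim) \<U>" and L: "compactin (V_space b Xlim) L" "L \<subseteq> \<U>"
  shows "\<exists>k\<in>I. \<exists>\<V>. openin (V_space b (X k)) \<V> \<and> q k ` L \<subseteq> \<V> \<and>
    {\<mu> \<in> topspace (V_space b Xlim). q k \<mu> \<in> \<V>} \<subseteq> \<U>"
proof -
  have "\<forall>\<nu>\<in>L. \<exists>k. \<exists>\<V>. k \<in> I \<and> openin (V_space b (X k)) \<V> \<and> q k \<nu> \<in> \<V> \<and>
    {\<mu> \<in> topspace (V_space b Xlim). q k \<mu> \<in> \<V>} \<subseteq> \<U>"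
    using V_Xlim_basis[OF U] L(2) by blast
  then obtain \<kappa> where "\<forall>\<nu>\<in>L. \<exists>\<V>. \<kappa> \<nu> \<in> I \<and> openin (V_space b (X (\<kappa> \<nu>))) \<V> \<and> q (\<kappa> \<nu>) \<nu> \<in> \<V> \<and>
    {\<mu> \<in> topspace (V_space b Xlim). q (\<kappa> \<nu>) \<mu> \<in> \<V>} \<subseteq> \<U>" unfolding bchoice_iff by blast
  then obtain \<W> where W: "\<forall>\<nu>\<in>L. \<kappa> \<nu> \<in> I \<and> openin (V_space b (X (\<kappa> \<nu>))) (\<W> \<nu>) \<and> q (\<kappa> \<nu>) \<nu> \<in> \<W> \<nu> \<and>
    {\<mu> \<in> topspace (V_space b Xlim). q (\<kappa> \<nu>) \<mu> \<in> \<W> \<nu>} \<subseteq> \<U>" unfolding bchoice_iff by blast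
  let ?P = "\<lambda>\<nu>. {\<mu> \<in> topspace (V_space b Xlim). q (\<kappa> \<nu>) \<mu> \<in> \<W> \<nu>}"
  have LT: "L \<subseteq> topspace (V_space b Xlim)" using L(1) by (rule compactin_subset_topspace)
  have "Ball (?P ` L) (openin (V_space b Xlim))"
    using W openin_continuous_map_preimage[OF q_cont] by blast
  moreover have "L \<subseteq> \<Union>(?P ` L)" using W LT by blast
  ultimately obtain \<F> where "finite \<F>" "\<F> \<subseteq> ?P ` L" "L \<subseteq> \<Union>\<F>"
    using L(1) unfolding compactin_def by meson
  then obtain T where T: "finite T" "T \<subseteq> L" "L \<subseteq> \<Union>(?P ` T)"
    using finite_subset_image[of \<F> ?P L] by auto
  have "finite (\<kappa> ` T)" "\<kappa> ` T \<subseteq> I" using T W by auto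
  then obtain k where k: "k \<in> I" "\<forall>j\<in>\<kappa> ` T. (j, k) \<in> r" using r_upper_finite by blast
  let ?V = "\<Union>\<nu>\<in>T. {\<mu> \<in> topspace (V_space b (X k)). V_map (X k) (X (\<kappa> \<nu>)) (p (\<kappa> \<nu>) k) \<mu> \<in> \<W> \<nu>}"
  have eq: "q k \<mu> \<in> ?V \<longleftrightarrow> \<mu> \<in> \<Union>(?P ` T)" if \<mu>: "\<mu> \<in> topspace (V_space b Xlim)" for \<mu>
  proof -
    have "V_map (X k) (X (\<kappa> \<nu>)) (p (\<kappa> \<nu>) k) (q k \<mu>) = q (\<kappa> \<nu>) \<mu>" if "\<nu> \<in> T" for \<nu>
      using V_map_q k(2) that by blast
    then show ?thesis using \<mu> q_in[OF k(1) \<mu>] by auto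
  qed
  have "openin (V_space b (X k)) ?V"
  proof (intro openin_Union ballI, clarify)
    fix \<nu> assume "\<nu> \<in> T"
    then show "openin (V_space b (X k)) {\<mu> \<in> topspace (V_space b (X k)). V_map (X k) (X (\<kappa> \<nu>)) (p (\<kappa> \<nu>) k) \<mu> \<in> \<W> \<nu>}"
      using k(2) W T(2) by (intro openin_continuous_map_preimage[OF continuous_map_V_map[OF p_cont]]) auto
  qed
  moreover have "q k ` L \<subseteq> ?V"
  proof (rule image_subsetI)
    fix \<mu> assume \<mu>: "\<mu> \<in> L"
    then have m: "\<mu> \<in> topspace (V_space b Xlim)" "\<mu> \<in> \<Union>(?P ` T)" using LT T(3) by auto
    show "q k \<mu> \<in> ?V" by (rule eq[THEN iffD2, OF m])
  qed
  moreover have "{\<mu> \<in> topspace (V_space b Xlim). q k \<mu> \<in> ?V} \<subseteq> \<U>"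
  proof
    fix \<mu> assume \<mu>: "\<mu> \<in> {\<mu> \<in> topspace (V_space b Xlim). q k \<mu> \<in> ?V}"
    then have m: "\<mu> \<in> topspace (V_space b Xlim)" "q k \<mu> \<in> ?V" by simp_all
    have "\<mu> \<in> \<Union>(?P ` T)" by (rule eq[THEN iffD1, OF m])
    then obtain \<nu> where "\<nu> \<in> T" "\<mu> \<in> ?P \<nu>" by blast
    then show "\<mu> \<in> \<U>" using W T(2) by blast
  qed
  ultimately show ?thesis using k(1) by blast
qed

end

section \<open>Projective limits of convex lenses\<close>

lemma lens_greatest_limit:
  assumes G: "ultrafilter_on UNIV G" and L: "lens Y L" and f: "\<forall>\<^sub>F g in G. f g \<in> L"
    and x: "greatest_limit Y f x G"
  shows "x \<in> L"
proof -
  obtain Q C where QC: "compactin Y Q" "saturatedin Y Q" "closedin Y C" "L = Q \<inter> C"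
    using L by (auto simp: lens_def)
  have "\<forall>\<^sub>F g in G. f g \<in> Q" "\<forall>\<^sub>F g in G. f g \<in> C" using QC(4) by (auto intro: eventually_mono[OF f])
  then have "x \<in> Q" "x \<in> C"
    using compact_limit_mem[OF G QC(1,2) _ x] limitin_closedin[of Y f x G C] QC(3) x ultrafilter_nontrivial[OF G]
    by (auto simp: greatest_limit_def)
  then show ?thesis using QC(4) by simp
qed

lemma convex_lens_space_upper:
  "openin (V_space b X) \<U> \<Longrightarrow> openin (convex_lens_space b X) {L \<in> convex_lenses b X. L \<subseteq> \<U>}"
  unfolding convex_lens_space_def by (rule topology_generated_by_Basis) blast

lemma convex_lens_space_lower:
  "openin (V_space b X) \<U> \<Longrightarrow> openin (convex_lens_space b X) {L \<in> convex_lenses b X. L \<inter> \<U> \<noteq> {}}"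
  unfolding convex_lens_space_def by (rule topology_generated_by_Basis) blast

text \<open>A lens is the intersection of its upward closure, which is an intersection of open sets, and of its
  closure, whose complement is the largest open set that the lens does not meet.\<close>

lemma lens_subset_by_opens:
  assumes L: "lens Y L" and L': "lens Y L'"
    and up: "\<And>U. openin Y U \<Longrightarrow> L' \<subseteq> U \<Longrightarrow> L \<subseteq> U"
    and lo: "\<And>U. openin Y U \<Longrightarrow> L \<inter> U \<noteq> {} \<Longrightarrow> L' \<inter> U \<noteq> {}"
  shows "L \<subseteq> L'"
proof
  fix x assume x: "x \<in> L"
  have xT: "x \<in> topspace Y" using x lens_subset_topspace[OF L] by auto
  have "x \<in> up_closure Y L'"
  proof (rule ccontr)
    assume n: "x \<notin> up_closure Y L'"
    let ?U = "topspace Y - {y. spec_le Y y x}"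
    have "openin Y ?U" using closedin_lower_cone[OF xT] by blast
    moreover have "L' \<subseteq> ?U" using n lens_subset_topspace[OF L'] by (auto simp: up_closure_def)
    ultimately have "L \<subseteq> ?U" by (rule up)
    with x spec_le_refl[OF xT] show False by auto
  qed
  moreover have "x \<in> Y closure_of L'"
    using lo x xT unfolding in_closure_of by blast
  ultimately have "x \<in> lens_hull Y L'" by (simp add: lens_hull_def)
  then show "x \<in> L'" using lens_hull_lens[OF L'] by simp
qed

lemma topspace_projective_limit:
  "x \<in> topspace (projective_limit I r Z u) \<longleftrightarrow>
     x \<in> extensional I \<and> (\<forall>i\<in>I. x i \<in> topspace (Z i)) \<and> (\<forall>i j. (i, j) \<in> r \<longrightarrow> u i j (x j) = x i)"
  by (auto simp: projective_limit_def PiE_iff)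

text \<open>For probability valuations, compactness ensures that limits of valuations keep total mass 1.\<close>

locale proper_system_bullet = proper_system I r X p
  for I :: "'i set" and r :: "('i \<times> 'i) set" and X :: "'i \<Rightarrow> 'a topology" and p :: "'i \<Rightarrow> 'i \<Rightarrow> 'a \<Rightarrow> 'a" +
  fixes b :: bullet
  assumes compact: "b = Probability \<Longrightarrow> i \<in> I \<Longrightarrow> compact_space (X i)"
begin

abbreviation "VX k \<equiv> V_space b (X k)"
abbreviation "VL \<equiv> V_space b Xlim"
abbreviation "pv k m \<equiv> V_map (X m) (X k) (p k m)"
abbreviation "pl k m \<equiv> convex_lens_map b (X m) (X k) (p k m)"
abbreviation "ql k \<equiv> convex_lens_map b Xlim (X k) (\<lambda>x. x k)"

definition compatible_lenses :: "('i \<Rightarrow> 'a valuation set) \<Rightarrow> bool" where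
  "compatible_lenses L \<longleftrightarrow>
     (\<forall>k\<in>I. L k \<in> convex_lenses b (X k)) \<and> (\<forall>k l. (k, l) \<in> r \<longrightarrow> pl k l (L l) = L k)"

text \<open>The inverse of the comparison map; the hard part is to show that it contains enough valuations.\<close>

definition lens_limit :: "('i \<Rightarrow> 'a valuation set) \<Rightarrow> ('i \<Rightarrow> 'a) valuation set" where
  "lens_limit L = {\<nu> \<in> topspace VL. \<forall>k\<in>I. q k \<nu> \<in> L k}"

lemma I_nonempty: "I \<noteq> {}"
  using sys by (simp add: projective_system_def)

lemma compatible_lensesD:
  assumes "compatible_lenses L" "k \<in> I"
  shows "lens (VX k) (L k)" "convex_valuations (X k) (L k)" "L k \<subseteq> topspace (VX k)"
    "compactin (VX k) (L k)" "L k \<noteq> {}" "lens_hull (VX k) (L k) = L k"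
proof -
  have "L k \<in> convex_lenses b (X k)" using assms by (simp add: compatible_lenses_def)
  note convex_lensD[OF this]
  then show "lens (VX k) (L k)" "convex_valuations (X k) (L k)" "L k \<subseteq> topspace (VX k)"
    "compactin (VX k) (L k)" "L k \<noteq> {}" "lens_hull (VX k) (L k) = L k" by blast+
qed

lemma compatible_lenses_hull:
  assumes "compatible_lenses L" "(k, l) \<in> r"
  shows "lens_hull (VX k) (pv k l ` L l) = L k"
  using assms by (simp add: compatible_lenses_def convex_lens_map_eq)

lemma compatible_lenses_image:
  assumes L: "compatible_lenses L" and kl: "(k, l) \<in> r" and y: "y \<in> L l"
  shows "pv k l y \<in> L k"
proof -
  have "pv k l ` L l \<subseteq> topspace (VX k)"
    using compatible_lensesD(3)[OF L r_in(2)[OF kl]] V_map_in_V_space[OF p_cont[OF kl]] by blast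
  from subset_lens_hull[OF this] show ?thesis
    using compatible_lenses_hull[OF L kl] y by blast
qed

text \<open>The source of elements of \<open>lens_limit L\<close>. For every \<open>m\<close> above \<open>i\<close> and every member \<open>B\<close> of the
  filter base \<open>\<B>\<close>, a valuation \<open>y\<close> in \<open>L m\<close> with image in \<open>B\<close> is chosen, and its images at the stages \<open>k\<close> below
  \<open>m\<close> are recorded. These form compatible nets inside the lenses \<open>L k\<close>, so that their greatest limits are
  in \<open>L k\<close> and come from one valuation \<open>z\<close> on the limit. At stage \<open>i\<close>, the net converges along \<open>\<B>\<close>, hence \<open>q i z\<close> is
  in every closed set that contains a member of \<open>\<B>\<close> and is above every limit of \<open>\<B>\<close>.\<close>

lemma lens_limit_point:
  assumes L: "compatible_lenses L" and i: "i \<in> I" and ne: "\<B> \<noteq> {}"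
    and dir: "\<And>A B. A \<in> \<B> \<Longrightarrow> B \<in> \<B> \<Longrightarrow> \<exists>C\<in>\<B>. C \<subseteq> A \<inter> B"
    and meets: "\<And>B m. B \<in> \<B> \<Longrightarrow> (i, m) \<in> r \<Longrightarrow> \<exists>y\<in>L m. pv i m y \<in> B"
  shows "\<exists>z\<in>lens_limit L.
    (\<forall>C B. closedin (VX i) C \<longrightarrow> B \<in> \<B> \<longrightarrow> B \<subseteq> C \<longrightarrow> q i z \<in> C) \<and>
    (\<forall>\<mu>\<in>topspace (VX i). (\<forall>\<U>. openin (VX i) \<U> \<longrightarrow> \<mu> \<in> \<U> \<longrightarrow> (\<exists>B\<in>\<B>. B \<subseteq> \<U>)) \<longrightarrow> spec_le (VX i) \<mu> (q i z))"
proof -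
  define S where "S = (\<lambda>(k, B). {(m, y). (k, m) \<in> r \<and> (i, m) \<in> r \<and> y \<in> L m \<and> pv i m y \<in> B})"
  have ine: "I \<times> \<B> \<noteq> {}" using i ne by blast
  have S_ne: "S a \<noteq> {}" if a: "a \<in> I \<times> \<B>" for a
  proof -
    obtain k B where kB: "a = (k, B)" "k \<in> I" "B \<in> \<B>" using a by blast
    obtain m where m: "(k, m) \<in> r" "(i, m) \<in> r" using r_upper[OF kB(2) i] by blast
    obtain y where "y \<in> L m" "pv i m y \<in> B" using meets[OF kB(3) m(2)] by blast
    with m have "(m, y) \<in> S a" by (simp add: S_def kB(1))
    then show ?thesis by blast
  qed
  have S_dir: "\<exists>c\<in>I \<times> \<B>. S c \<subseteq> S a \<inter> S a'" if a: "a \<in> I \<times> \<B>" "a' \<in> I \<times> \<B>" for a a'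
  proof -
    obtain k B k' B' where kB: "a = (k, B)" "k \<in> I" "B \<in> \<B>" "a' = (k', B')" "k' \<in> I" "B' \<in> \<B>"
      using a by blast
    obtain m where m: "m \<in> I" "(k, m) \<in> r" "(k', m) \<in> r" using r_upper[OF kB(2,5)] by blast
    obtain C where C: "C \<in> \<B>" "C \<subseteq> B \<inter> B'" using dir[OF kB(3,6)] by blast
    have "S (m, C) \<subseteq> S a \<inter> S a'"
      unfolding S_def kB using C(2) r_trans[OF m(2)] r_trans[OF m(3)] by auto
    with m(1) C(1) show ?thesis by blast
  qed
  obtain G where G: "ultrafilter_on UNIV G" and GS: "\<And>a. a \<in> I \<times> \<B> \<Longrightarrow> \<forall>\<^sub>F g in G. g \<in> S a"
    by (rule ultrafilter_of_base[of "I \<times> \<B>" S, OF ine S_ne S_dir]) blast+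
  define f where "f = (\<lambda>k (m, y). pv k m y)"
  \<comment> \<open>Any member of \<open>\<B>\<close> may be used to express that \<open>m\<close> is eventually above \<open>k\<close>.\<close>
  obtain B0 where B0: "B0 \<in> \<B>" using ne by blast
  have ev: "\<forall>\<^sub>F (m, y) in G. (k, m) \<in> r \<and> y \<in> L m" if k: "k \<in> I" for k
    by (rule eventually_mono[OF GS[of "(k, B0)"]]) (use k B0 in \<open>auto simp: S_def\<close>)
  have fL: "\<forall>\<^sub>F g in G. f k g \<in> L k" if k: "k \<in> I" for k
    by (rule eventually_mono[OF ev[OF k]]) (auto simp: f_def intro: compatible_lenses_image[OF L])
  have fB: "\<forall>\<^sub>F g in G. f i g \<in> B" if B: "B \<in> \<B>" for B
    by (rule eventually_mono[OF GS[of "(i, B)"]]) (use i B in \<open>auto simp: S_def f_def\<close>)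
  have "\<exists>z\<in>topspace VL. \<forall>k\<in>I. greatest_limit (VX k) (f k) (q k z) G"
  proof (rule valuation_ultralimit[OF compact G])
    show "\<forall>\<^sub>F g in G. f k g \<in> topspace (VX k)" if k: "k \<in> I" for k
      by (rule eventually_mono[OF fL[OF k]]) (use compatible_lensesD(3)[OF L k] in blast)
    show "\<forall>\<^sub>F g in G. f k g = pv k l (f l g)" if kl: "(k, l) \<in> r" for k l
      by (rule eventually_mono[OF ev[OF r_in(2)[OF kl]]]) (auto simp: f_def V_map_V_map_p[OF kl])
  qed
  then obtain z where z: "z \<in> topspace VL" "\<And>k. k \<in> I \<Longrightarrow> greatest_limit (VX k) (f k) (q k z) G" by blast
  \<comment> \<open>Lenses are closed under greatest limits: the closed part contains all limits, and the compact
    saturated part contains some limit, hence also the greatest one.\<close>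
  have "z \<in> lens_limit L"
    unfolding lens_limit_def
    using z(1) lens_greatest_limit[OF G compatible_lensesD(1)[OF L] fL z(2)] by simp
  moreover have "q i z \<in> C" if C: "closedin (VX i) C" "B \<in> \<B>" "B \<subseteq> C" for C B
  proof (rule limitin_closedin)
    show "limitin (VX i) (f i) (q i z) G" using z(2)[OF i] by (simp add: greatest_limit_def)
    show "\<forall>\<^sub>F g in G. f i g \<in> C" by (rule eventually_mono[OF fB[OF C(2)]]) (use C(3) in blast)
  qed (use C ultrafilter_nontrivial[OF G] in auto)
  moreover have "spec_le (VX i) \<mu> (q i z)"
    if \<mu>: "\<mu> \<in> topspace (VX i)" "\<And>\<U>. openin (VX i) \<U> \<Longrightarrow> \<mu> \<in> \<U> \<Longrightarrow> \<exists>B\<in>\<B>. B \<subseteq> \<U>" for \<mu>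
  proof -
    have "limitin (VX i) (f i) \<mu> G"
      unfolding limitin_def
    proof (intro conjI allI impI \<mu>(1))
      fix \<U> assume "openin (VX i) \<U> \<and> \<mu> \<in> \<U>"
      then obtain B where B: "B \<in> \<B>" "B \<subseteq> \<U>" using \<mu>(2) by blast
      show "\<forall>\<^sub>F g in G. f i g \<in> \<U>" by (rule eventually_mono[OF fB[OF B(1)]]) (use B(2) in blast)
    qed
    then show ?thesis using z(2)[OF i] by (simp add: greatest_limit_def)
  qed
  ultimately show ?thesis by blast
qed

lemma image_lens_limit: "k \<in> I \<Longrightarrow> q k ` lens_limit L \<subseteq> L k"
  by (auto simp: lens_limit_def)

text \<open>Each stage above \<open>i\<close> has an element whose image is below \<open>x\<close>, since the upward closure of the image of
  \<open>L m\<close> contains \<open>L i\<close>. The filter base consists of the closure of \<open>x\<close> alone.\<close>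

lemma lens_limit_below:
  assumes L: "compatible_lenses L" and i: "i \<in> I" and x: "x \<in> L i"
  shows "\<exists>z\<in>lens_limit L. spec_le (VX i) (q i z) x"
proof -
  have xT: "x \<in> topspace (VX i)" using compatible_lensesD(3)[OF L i] x by blast
  let ?D = "{y. spec_le (VX i) y x}"
  have "\<exists>y\<in>L m. pv i m y \<in> ?D" if m: "(i, m) \<in> r" for m
    using compatible_lenses_hull[OF L m] x by (auto simp: lens_hull_def up_closure_def)
  with lens_limit_point[OF L i, of "{?D}"] closedin_lower_cone[OF xT]
  show ?thesis by auto
qed

text \<open>Each stage above \<open>i\<close> has elements whose images are as close to \<open>x\<close> as desired, since the closure of the
  image of \<open>L m\<close> contains \<open>L i\<close>. The filter base consists of the open neighborhoods of \<open>x\<close>; since the topology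
  is not Hausdorff, one gets a point above \<open>x\<close>, which is enough for closures.\<close>

lemma lens_limit_above:
  assumes L: "compatible_lenses L" and i: "i \<in> I" and x: "x \<in> L i"
  shows "\<exists>z\<in>lens_limit L. spec_le (VX i) x (q i z)"
proof -
  have xT: "x \<in> topspace (VX i)" using compatible_lensesD(3)[OF L i] x by blast
  let ?B = "{\<U>. openin (VX i) \<U> \<and> x \<in> \<U>}"
  have "?B \<noteq> {}" using xT by blast
  moreover have "\<exists>C\<in>?B. C \<subseteq> A \<inter> B" if "A \<in> ?B" "B \<in> ?B" for A B
    using that by (intro bexI[of _ "A \<inter> B"]) auto
  moreover have "\<exists>y\<in>L m. pv i m y \<in> B" if B: "B \<in> ?B" and m: "(i, m) \<in> r" for B m
  proof -
    have "x \<in> VX i closure_of (pv i m ` L m)"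
      using compatible_lenses_hull[OF L m] x by (auto simp: lens_hull_def)
    then show ?thesis using B unfolding in_closure_of by blast
  qed
  ultimately have "\<exists>z\<in>lens_limit L.
    (\<forall>C B. closedin (VX i) C \<longrightarrow> B \<in> ?B \<longrightarrow> B \<subseteq> C \<longrightarrow> q i z \<in> C) \<and>
    (\<forall>\<mu>\<in>topspace (VX i). (\<forall>\<U>. openin (VX i) \<U> \<longrightarrow> \<mu> \<in> \<U> \<longrightarrow> (\<exists>B\<in>?B. B \<subseteq> \<U>)) \<longrightarrow> spec_le (VX i) \<mu> (q i z))"
    by (rule lens_limit_point[OF L i])
  then obtain z where z: "z \<in> lens_limit L"
    "\<forall>\<mu>\<in>topspace (VX i). (\<forall>\<U>. openin (VX i) \<U> \<longrightarrow> \<mu> \<in> \<U> \<longrightarrow> (\<exists>B\<in>?B. B \<subseteq> \<U>)) \<longrightarrow> spec_le (VX i) \<mu> (q i z)"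
    by blast
  have "\<forall>\<U>. openin (VX i) \<U> \<longrightarrow> x \<in> \<U> \<longrightarrow> (\<exists>B\<in>?B. B \<subseteq> \<U>)" by blast
  with z xT show ?thesis by blast
qed

lemma lens_hull_image_lens_limit:
  assumes L: "compatible_lenses L" and k: "k \<in> I"
  shows "lens_hull (VX k) (q k ` lens_limit L) = L k"
proof -
  let ?A = "q k ` lens_limit L"
  have sub: "?A \<subseteq> L k" by (rule image_lens_limit[OF k])
  have "L k \<subseteq> up_closure (VX k) ?A"
    using lens_limit_below[OF L k] by (force simp: up_closure_def)
  then have u: "up_closure (VX k) ?A = up_closure (VX k) (L k)"
    using up_closure_least[OF saturatedin_up_closure] up_closure_mono[OF sub] by blast
  have "x \<in> VX k closure_of ?A" if x: "x \<in> L k" for x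
  proof -
    obtain z where z: "z \<in> lens_limit L" "spec_le (VX k) x (q k z)" using lens_limit_above[OF L k x] by blast
    have "x \<in> VX k closure_of {q k z}" using z(2) by (simp add: spec_le_iff_closure)
    moreover have "VX k closure_of {q k z} \<subseteq> VX k closure_of ?A" using z(1) by (intro closure_of_mono) blast
    ultimately show ?thesis by blast
  qed
  then have "VX k closure_of (L k) \<subseteq> VX k closure_of ?A" by (intro closure_of_minimal) auto
  then have c: "VX k closure_of ?A = VX k closure_of (L k)" using closure_of_mono[OF sub, of "VX k"] by blast
  show ?thesis
    using u c compatible_lensesD(6)[OF L k] by (simp add: lens_hull_def)
qed

lemma compactin_limit_up_closure:
  assumes L: "compatible_lenses L"
  shows "compactin VL {\<nu> \<in> topspace VL. \<forall>k\<in>I. q k \<nu> \<in> up_closure (VX k) (L k)}" (is "compactin VL ?Q")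
proof (rule compactin_by_ultrafilters)
  show "?Q \<subseteq> topspace VL" by blast
  fix G assume G: "ultrafilter_on UNIV G" and e: "\<forall>\<^sub>F g in G. g \<in> ?Q"
  have "\<exists>z\<in>topspace VL. \<forall>k\<in>I. greatest_limit (VX k) (q k) (q k z) G"
  proof (rule valuation_ultralimit[OF compact G])
    show "\<forall>\<^sub>F g in G. q k g \<in> topspace (VX k)" if k: "k \<in> I" for k
      by (rule eventually_mono[OF e]) (use q_in[OF k] in blast)
    show "\<forall>\<^sub>F g in G. q k g = pv k l (q l g)" if kl: "(k, l) \<in> r" for k l
      by (simp add: V_map_q[OF kl])
  qed
  then obtain z where z: "z \<in> topspace VL" "\<And>k. k \<in> I \<Longrightarrow> greatest_limit (VX k) (q k) (q k z) G" by blast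
  have "q k z \<in> up_closure (VX k) (L k)" if k: "k \<in> I" for k
  proof (rule compact_limit_mem[OF G _ saturatedin_up_closure _ z(2)[OF k]])
    show "compactin (VX k) (up_closure (VX k) (L k))"
      by (rule compactin_up_closure[OF compatible_lensesD(4)[OF L k]])
    show "\<forall>\<^sub>F g in G. q k g \<in> up_closure (VX k) (L k)"
      by (rule eventually_mono[OF e]) (use k in blast)
  qed
  then have "z \<in> ?Q" using z(1) by blast
  moreover have "limitin VL (\<lambda>x. x) z G"
    unfolding limitin_def
  proof (intro conjI allI impI z(1))
    fix \<U> assume "openin VL \<U> \<and> z \<in> \<U>"
    then obtain k \<V> where k: "k \<in> I" "openin (VX k) \<V>" "q k z \<in> \<V>" "{\<mu> \<in> topspace VL. q k \<mu> \<in> \<V>} \<subseteq> \<U>"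
      using V_Xlim_basis by blast
    have "\<forall>\<^sub>F g in G. q k g \<in> \<V>" using z(2)[OF k(1)] k(2,3) by (simp add: greatest_limit_def limitin_def)
    with e show "\<forall>\<^sub>F g in G. g \<in> \<U>" by eventually_elim (use k(4) in blast)
  qed
  ultimately show "\<exists>y\<in>?Q. limitin VL (\<lambda>x. x) y G" by blast
qed

lemma lens_limit_convex_lens:
  assumes L: "compatible_lenses L"
  shows "lens_limit L \<in> convex_lenses b Xlim"
proof -
  let ?Q = "{\<nu> \<in> topspace VL. \<forall>k\<in>I. q k \<nu> \<in> up_closure (VX k) (L k)}"
  let ?C = "\<Inter>k\<in>I. {\<nu> \<in> topspace VL. q k \<nu> \<in> VX k closure_of L k}"
  have "saturatedin VL ?Q"
    unfolding saturatedin_def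
  proof (intro conjI ballI allI impI)
    fix \<mu> \<nu> assume \<mu>: "\<mu> \<in> ?Q" and le: "spec_le VL \<mu> \<nu>"
    have "q k \<nu> \<in> up_closure (VX k) (L k)" if k: "k \<in> I" for k
      using saturatedin_up_closure[of "VX k" "L k"] spec_le_continuous[OF q_cont[OF k] le] \<mu> k
      unfolding saturatedin_def by blast
    moreover have "\<nu> \<in> topspace VL" using le by (simp add: spec_le_def)
    ultimately show "\<nu> \<in> ?Q" by blast
  qed blast
  moreover have "closedin VL ?C"
    using I_nonempty by (intro closedin_INT closedin_continuous_map_preimage[OF q_cont]) auto
  moreover have "lens_limit L = ?Q \<inter> ?C"
  proof -
    have "q k \<nu> \<in> L k \<longleftrightarrow> q k \<nu> \<in> up_closure (VX k) (L k) \<and> q k \<nu> \<in> VX k closure_of L k" if k: "k \<in> I" for k \<nu>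
      using compatible_lensesD(6)[OF L k] unfolding lens_hull_def by blast
    then show ?thesis using I_nonempty unfolding lens_limit_def by auto
  qed
  moreover have "lens_limit L \<noteq> {}"
  proof -
    obtain i where i: "i \<in> I" using I_nonempty by blast
    obtain x where "x \<in> L i" using compatible_lensesD(5)[OF L i] by blast
    from lens_limit_below[OF L i this] show ?thesis by blast
  qed
  ultimately have "lens VL (lens_limit L)"
    using compactin_limit_up_closure[OF L] unfolding lens_def by blast
  moreover have "convex_valuations Xlim (lens_limit L)"
    unfolding convex_valuations_iff
  proof (intro ballI)
    fix \<mu> \<nu> and t :: real assume m: "\<mu> \<in> lens_limit L" "\<nu> \<in> lens_limit L" and t: "t \<in> {0..1}"
    have "q k (convex_comb Xlim t \<mu> \<nu>) \<in> L k" if k: "k \<in> I" for k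
      using compatible_lensesD(2)[OF L k] m t k
      unfolding V_map_convex_comb[OF proj_cont[OF k]] convex_valuations_iff lens_limit_def by blast
    then show "convex_comb Xlim t \<mu> \<nu> \<in> lens_limit L"
      using V_space_convex_comb[of \<mu> b Xlim \<nu> t] m t by (simp add: lens_limit_def)
  qed
  ultimately show ?thesis by (simp add: convex_lenses_def)
qed

lemma ql_lens_limit:
  assumes "compatible_lenses L" "k \<in> I" shows "ql k (lens_limit L) = L k"
  using lens_hull_image_lens_limit[OF assms] by (simp add: convex_lens_map_eq)

text \<open>The two families of subbasic open sets of the Vietoris topology come from the stages, which gives
  continuity of the inverse, and also injectivity, because lenses are determined by these open sets.\<close>

lemma lens_subset_open_iff:
  assumes L: "L \<in> convex_lenses b Xlim" and U: "openin VL \<U>"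
  shows "L \<subseteq> \<U> \<longleftrightarrow> (\<exists>k\<in>I. \<exists>\<V>. openin (VX k) \<V> \<and> {\<mu> \<in> topspace VL. q k \<mu> \<in> \<V>} \<subseteq> \<U> \<and> ql k L \<subseteq> \<V>)"
proof
  assume "L \<subseteq> \<U>"
  from V_Xlim_compact_basis[OF U convex_lensD(4)[OF L] this]
  show "\<exists>k\<in>I. \<exists>\<V>. openin (VX k) \<V> \<and> {\<mu> \<in> topspace VL. q k \<mu> \<in> \<V>} \<subseteq> \<U> \<and> ql k L \<subseteq> \<V>"
    using convex_lens_map_subset_open(1)[OF proj_cont L] by blast
next
  assume "\<exists>k\<in>I. \<exists>\<V>. openin (VX k) \<V> \<and> {\<mu> \<in> topspace VL. q k \<mu> \<in> \<V>} \<subseteq> \<U> \<and> ql k L \<subseteq> \<V>"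
  then obtain k \<V> where k: "k \<in> I" "openin (VX k) \<V>" "{\<mu> \<in> topspace VL. q k \<mu> \<in> \<V>} \<subseteq> \<U>" "ql k L \<subseteq> \<V>" by blast
  have "q k ` L \<subseteq> \<V>" using convex_lens_map_subset_open(1)[OF proj_cont[OF k(1)] L k(2)] k(4) by blast
  then show "L \<subseteq> \<U>" using k(3) convex_lensD(3)[OF L] by blast
qed

lemma lens_meets_open_iff:
  assumes L: "L \<in> convex_lenses b Xlim" and U: "openin VL \<U>"
  shows "L \<inter> \<U> \<noteq> {} \<longleftrightarrow> (\<exists>k\<in>I. \<exists>\<V>. openin (VX k) \<V> \<and> {\<mu> \<in> topspace VL. q k \<mu> \<in> \<V>} \<subseteq> \<U> \<and> ql k L \<inter> \<V> \<noteq> {})"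
proof
  assume "L \<inter> \<U> \<noteq> {}"
  then obtain \<nu> where \<nu>: "\<nu> \<in> L" "\<nu> \<in> \<U>" by blast
  from V_Xlim_basis[OF U \<nu>(2)] obtain k \<V> where k: "k \<in> I" "openin (VX k) \<V>" "q k \<nu> \<in> \<V>"
    "{\<mu> \<in> topspace VL. q k \<mu> \<in> \<V>} \<subseteq> \<U>" by blast
  have "q k ` L \<inter> \<V> \<noteq> {}" using \<nu>(1) k(3) by blast
  then have "ql k L \<inter> \<V> \<noteq> {}" using convex_lens_map_subset_open(2)[OF proj_cont[OF k(1)] L k(2)] by blast
  with k show "\<exists>k\<in>I. \<exists>\<V>. openin (VX k) \<V> \<and> {\<mu> \<in> topspace VL. q k \<mu> \<in> \<V>} \<subseteq> \<U> \<and> ql k L \<inter> \<V> \<noteq> {}" by blast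
next
  assume "\<exists>k\<in>I. \<exists>\<V>. openin (VX k) \<V> \<and> {\<mu> \<in> topspace VL. q k \<mu> \<in> \<V>} \<subseteq> \<U> \<and> ql k L \<inter> \<V> \<noteq> {}"
  then obtain k \<V> where k: "k \<in> I" "openin (VX k) \<V>" "{\<mu> \<in> topspace VL. q k \<mu> \<in> \<V>} \<subseteq> \<U>" "ql k L \<inter> \<V> \<noteq> {}" by blast
  have "q k ` L \<inter> \<V> \<noteq> {}" using convex_lens_map_subset_open(2)[OF proj_cont[OF k(1)] L k(2)] k(4) by blast
  then show "L \<inter> \<U> \<noteq> {}" using k(3) convex_lensD(3)[OF L] by blast
qed

lemma ql_injective:
  assumes L: "L \<in> convex_lenses b Xlim" and L': "L' \<in> convex_lenses b Xlim"
    and eq: "\<And>k. k \<in> I \<Longrightarrow> ql k L = ql k L'"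
  shows "L = L'"
proof
  have u: "L \<subseteq> \<U> \<longleftrightarrow> L' \<subseteq> \<U>" and m: "L \<inter> \<U> \<noteq> {} \<longleftrightarrow> L' \<inter> \<U> \<noteq> {}" if U: "openin VL \<U>" for \<U>
    unfolding lens_subset_open_iff[OF L U] lens_subset_open_iff[OF L' U]
      lens_meets_open_iff[OF L U] lens_meets_open_iff[OF L' U]
    using eq by (auto cong: bex_cong)
  show "L \<subseteq> L'"
    by (rule lens_subset_by_opens[OF convex_lensD(1)[OF L] convex_lensD(1)[OF L']]) (use u m in blast)+
  show "L' \<subseteq> L"
    by (rule lens_subset_by_opens[OF convex_lensD(1)[OF L'] convex_lensD(1)[OF L]]) (use u m in blast)+
qed

theorem projective_system_convex_lenses:
  "projective_system I r (\<lambda>i. convex_lens_space b (X i)) pl"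
  unfolding projective_system_def
proof (intro conjI allI impI ballI)
  show "preorder_on I r" "I \<noteq> {}" using sys by (simp_all add: projective_system_def)
  show "\<exists>k\<in>I. (i, k) \<in> r \<and> (j, k) \<in> r" if "i \<in> I" "j \<in> I" for i j using r_upper[OF that] .
  show "continuous_map (convex_lens_space b (X j)) (convex_lens_space b (X i)) (pl i j)" if "(i, j) \<in> r" for i j
    by (rule continuous_map_convex_lens_map[OF p_cont[OF that]])
  show "pl i i L = L" if "i \<in> I" "L \<in> topspace (convex_lens_space b (X i))" for i L
    using that p_id unfolding topspace_convex_lens_space by (intro convex_lens_map_ident) auto
  show "pl i j (pl j k L) = pl i k L"
    if "(i, j) \<in> r \<and> (j, k) \<in> r" "L \<in> topspace (convex_lens_space b (X k))" for i j k L
    using that p_comp p_cont unfolding topspace_convex_lens_space by (intro convex_lens_map_compose) auto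
qed

theorem projective_limit_convex_lenses:
  "is_projective_limit_of (convex_lens_space b Xlim) ql I r (\<lambda>i. convex_lens_space b (X i)) pl"
proof -
  let ?Z = "projective_limit I r (\<lambda>i. convex_lens_space b (X i)) pl"
  let ?f = "\<lambda>L. \<lambda>i\<in>I. ql i L"
  have Z_iff: "M \<in> topspace ?Z \<longleftrightarrow> M \<in> extensional I \<and> compatible_lenses M" for M
    by (auto simp: topspace_projective_limit compatible_lenses_def topspace_convex_lens_space)
  have f_compat: "compatible_lenses (?f L)" if L: "L \<in> convex_lenses b Xlim" for L
    unfolding compatible_lenses_def
  proof (intro conjI ballI allI impI)
    show "?f L k \<in> convex_lenses b (X k)" if "k \<in> I" for k
      using convex_lens_map_in[OF proj_cont[OF that] L] that by simp
    show "pl k l (?f L l) = ?f L k" if kl: "(k, l) \<in> r" for k l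
    proof -
      have "pl k l (ql l L) = ql k L"
        by (rule convex_lens_map_compose[OF proj_cont[OF r_in(2)[OF kl]] p_cont[OF kl] _ L]) (rule p_proj[OF kl])
      then show ?thesis using r_in[OF kl] by simp
    qed
  qed
  have fg: "?f (lens_limit M) = M" if M: "M \<in> topspace ?Z" for M
    by (rule extensionalityI[of _ I]) (use M ql_lens_limit in \<open>auto simp: Z_iff\<close>)
  have g_in: "lens_limit M \<in> convex_lenses b Xlim" if "M \<in> topspace ?Z" for M
    using that lens_limit_convex_lens by (simp add: Z_iff)
  have gf: "lens_limit (?f L) = L" if L: "L \<in> convex_lenses b Xlim" for L
    by (rule ql_injective[OF lens_limit_convex_lens[OF f_compat[OF L]] L])
      (simp add: ql_lens_limit[OF f_compat[OF L]])
  have f_cont: "continuous_map (convex_lens_space b Xlim) ?Z ?f"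
    unfolding projective_limit_def[of I r "\<lambda>i. convex_lens_space b (X i)" pl]
      continuous_map_in_subtopology continuous_map_componentwise
  proof (intro conjI ballI)
    show "?f ` topspace (convex_lens_space b Xlim) \<subseteq> extensional I" by auto
    show "continuous_map (convex_lens_space b Xlim) (convex_lens_space b (X k)) (\<lambda>L. ?f L k)" if k: "k \<in> I" for k
      using continuous_map_convex_lens_map[OF proj_cont[OF k], of b] k by simp
    show "?f \<in> topspace (convex_lens_space b Xlim) \<rightarrow> {x. \<forall>i j. (i, j) \<in> r \<longrightarrow> pl i j (x j) = x i}"
      using f_compat unfolding compatible_lenses_def topspace_convex_lens_space by blast
  qed
  have sub_iff: "lens_limit M \<subseteq> \<U> \<longleftrightarrow>
      (\<exists>k\<in>I. \<exists>\<V>. openin (VX k) \<V> \<and> {\<mu> \<in> topspace VL. q k \<mu> \<in> \<V>} \<subseteq> \<U> \<and> M k \<subseteq> \<V>)"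
    and meet_iff: "lens_limit M \<inter> \<U> \<noteq> {} \<longleftrightarrow>
      (\<exists>k\<in>I. \<exists>\<V>. openin (VX k) \<V> \<and> {\<mu> \<in> topspace VL. q k \<mu> \<in> \<V>} \<subseteq> \<U> \<and> M k \<inter> \<V> \<noteq> {})"
    if M: "M \<in> topspace ?Z" and U: "openin VL \<U>" for M \<U>
    unfolding lens_subset_open_iff[OF g_in[OF M] U] lens_meets_open_iff[OF g_in[OF M] U]
    using M ql_lens_limit[of M] by (simp_all add: Z_iff)
  have comp_cont: "continuous_map ?Z (convex_lens_space b (X k)) (\<lambda>M. M k)" if "k \<in> I" for k
    unfolding projective_limit_def
    by (intro continuous_map_from_subtopology continuous_map_product_projection that)
  let ?S = "{{L \<in> convex_lenses b Xlim. L \<subseteq> \<U>} |\<U>. openin VL \<U>} \<union>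
        {{L \<in> convex_lenses b Xlim. L \<inter> \<U> \<noteq> {}} |\<U>. openin VL \<U>}"
  have "continuous_map ?Z (topology_generated_by ?S) lens_limit"
  proof (rule continuous_on_generated_topo)
    have "topspace (convex_lens_space b Xlim) = \<Union>?S" by (simp add: convex_lens_space_def)
    then show "lens_limit ` topspace ?Z \<subseteq> \<Union>?S"
      using g_in unfolding topspace_convex_lens_space by blast
    fix S assume "S \<in> ?S"
    then consider \<U> where "openin VL \<U>" "S = {L \<in> convex_lenses b Xlim. L \<subseteq> \<U>}"
      | \<U> where "openin VL \<U>" "S = {L \<in> convex_lenses b Xlim. L \<inter> \<U> \<noteq> {}}" by blast
    then show "openin ?Z (lens_limit -` S \<inter> topspace ?Z)"
    proof cases
      case (1 \<U>)
      show ?thesis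
      proof (subst openin_subopen, intro ballI)
        fix M assume "M \<in> lens_limit -` S \<inter> topspace ?Z"
        then have M: "M \<in> topspace ?Z" "lens_limit M \<subseteq> \<U>" using 1(2) by auto
        then obtain k \<V> where k: "k \<in> I" "openin (VX k) \<V>"
          "{\<mu> \<in> topspace VL. q k \<mu> \<in> \<V>} \<subseteq> \<U>" "M k \<subseteq> \<V>"
          using sub_iff[OF M(1) 1(1)] by blast
        let ?T = "{M \<in> topspace ?Z. M k \<in> {L \<in> convex_lenses b (X k). L \<subseteq> \<V>}}"
        have "openin ?Z ?T"
          by (rule openin_continuous_map_preimage[OF comp_cont[OF k(1)] convex_lens_space_upper[OF k(2)]])
        moreover have "M \<in> ?T" using M(1) k by (simp add: Z_iff compatible_lenses_def)
        moreover have "?T \<subseteq> lens_limit -` S \<inter> topspace ?Z"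
        proof
          fix N assume "N \<in> ?T"
          then have N: "N \<in> topspace ?Z" "N k \<subseteq> \<V>" by simp_all
          have "lens_limit N \<subseteq> \<U>" using sub_iff[OF N(1) 1(1)] k N(2) by blast
          then show "N \<in> lens_limit -` S \<inter> topspace ?Z" using 1(2) g_in[OF N(1)] N(1) by simp
        qed
        ultimately show "\<exists>T. openin ?Z T \<and> M \<in> T \<and> T \<subseteq> lens_limit -` S \<inter> topspace ?Z" by blast
      qed
    next
      case (2 \<U>)
      show ?thesis
      proof (subst openin_subopen, intro ballI)
        fix M assume "M \<in> lens_limit -` S \<inter> topspace ?Z"
        then have M: "M \<in> topspace ?Z" "lens_limit M \<inter> \<U> \<noteq> {}" using 2(2) by auto
        then obtain k \<V> where k: "k \<in> I" "openin (VX k) \<V>"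
          "{\<mu> \<in> topspace VL. q k \<mu> \<in> \<V>} \<subseteq> \<U>" "M k \<inter> \<V> \<noteq> {}"
          using meet_iff[OF M(1) 2(1)] by blast
        let ?T = "{M \<in> topspace ?Z. M k \<in> {L \<in> convex_lenses b (X k). L \<inter> \<V> \<noteq> {}}}"
        have "openin ?Z ?T"
          by (rule openin_continuous_map_preimage[OF comp_cont[OF k(1)] convex_lens_space_lower[OF k(2)]])
        moreover have "M \<in> ?T" using M(1) k by (simp add: Z_iff compatible_lenses_def)
        moreover have "?T \<subseteq> lens_limit -` S \<inter> topspace ?Z"
        proof
          fix N assume "N \<in> ?T"
          then have N: "N \<in> topspace ?Z" "N k \<inter> \<V> \<noteq> {}" by simp_all
          have "lens_limit N \<inter> \<U> \<noteq> {}" using meet_iff[OF N(1) 2(1)] k N(2) by blast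
          then show "N \<in> lens_limit -` S \<inter> topspace ?Z" using 2(2) g_in[OF N(1)] N(1) by simp
        qed
        ultimately show "\<exists>T. openin ?Z T \<and> M \<in> T \<and> T \<subseteq> lens_limit -` S \<inter> topspace ?Z" by blast
      qed
    qed
  qed
  then have g_cont: "continuous_map ?Z (convex_lens_space b Xlim) lens_limit"
    unfolding convex_lens_space_def[of b Xlim] .
  have "homeomorphic_maps (convex_lens_space b Xlim) ?Z ?f lens_limit"
    unfolding homeomorphic_maps_def topspace_convex_lens_space
    using f_cont g_cont gf fg by blast
  then show ?thesis
    unfolding is_projective_limit_of_def by (rule homeomorphic_maps_imp_map)
qed

end

theorem theorem15p4:
  fixes I :: "'i set" and r :: "('i \<times> 'i) set"
    and X :: "'i \<Rightarrow> 'a topology" and p :: "'i \<Rightarrow> 'i \<Rightarrow> 'a \<Rightarrow> 'a"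
    and b :: bullet
  assumes "projective_system I r X p"
    and "\<And>i. i \<in> I \<Longrightarrow> odot_consonant (X i)"
    and "\<And>i. i \<in> I \<Longrightarrow> locally_strongly_sober (X i)"
    and "\<And>i. b = Probability \<Longrightarrow> i \<in> I \<Longrightarrow> strongly_sober (X i)"
    and "\<And>i j. (i, j) \<in> r \<Longrightarrow> sat_proper_map (X j) (X i) (p i j)"
  shows "projective_system I r (\<lambda>i. convex_lens_space b (X i))
           (\<lambda>i j. convex_lens_map b (X j) (X i) (p i j)) \<and>
         is_projective_limit_of
           (convex_lens_space b (projective_limit I r X p))
           (\<lambda>i. convex_lens_map b (projective_limit I r X p) (X i) (\<lambda>x. x i))
           I r (\<lambda>i. convex_lens_space b (X i))
           (\<lambda>i j. convex_lens_map b (X j) (X i) (p i j))"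
proof -
  interpret proper_system_bullet I r X p b
    by unfold_locales (use assms in \<open>simp_all add: strongly_sober_def\<close>)
  show ?thesis
    using projective_system_convex_lenses projective_limit_convex_lenses by blast
qed

end
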